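(* Let $k\ge 2$ be an integer (so $2k+1\ge 5$) and let $n\ge 1$ be an integer. Then $$ \mathrm{ex}(n;C_{2k+1})= \begin{cases} \binom{n}{2} & \text{for } n\le 2k,\\ g(n,k) & \text{for } 2k+1\le n\le 4k-1, \text{ and}\\ \lfloor n^2/4\rfloor & \text{for } n\ge 4k-2 \end{cases} $$ (for $n\in\{4k-2,4k-1\}$ both of the last two lines apply, with equal values). Furthermore, up to isomorphism, the only extremal graphs, i.e. the only $C_{2k+1}$-free graphs on $n$ vertices with exactly $\mathrm{ex}(n;C_{2k+1})$ edges, are: (i) $K_n$ for $n\le 2k$; (ii) $B(n;2k,n-2k+1)$ for $2k+1\le n\le 4k-1$; (iii) $H_1(n,k)$ for $n\in\{3k-1,3k\}$; (iv) the complete bipartite graph $K_{\lceil n/2\rceil,\lfloor n/2\rfloor}$ for $n\ge 4k-2$. (For a given $n$, the extremal graphs are exactly all those graphs in the list (i)–(iv) whose stated range contains $n$.)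
   Context: All graphs are finite and simple. A graph is $F$-free if it contains no copy of $F$ as a (not necessarily induced) subgraph. $\mathrm{ex}(n;F)$ is the maximum number of edges in an $F$-free graph on $n$ vertices. $C_\ell$ is the cycle of length $\ell$. A cactus $B(n;n_1,\dots,n_s)$ (for $n\ge 2$, $s\ge 1$, $n_i\ge 2$, $\sum_i (n_i-1)=n-1$) is a connected $n$-vertex graph whose blocks are complete graphs of sizes $n_1,\dots,n_s$ (a block of size $2$ being a single edge). In particular, $B(n;2k,n-2k+1)$ consists of a complete graph on $2k$ vertices and a complete graph on $n-2k+1$ vertices sharing exactly one vertex. For $n\ge 2$, $g(n,k)$ denotes the largest number of edges of a $C_{2k+1}$-free $n$-vertex cactus; explicitly, writing $n=(s-1)(2k-1)+r$ with integers $s\ge 1$ and $2\le r\le 2k$, one has $g(n,k)=(s-1)\binom{2k}{2}+\binom{r}{2}$. For $n\ge k$, $H_1(n,k)$ is the $n$-vertex graph obtained from the complete bipartite graph $K_{k,n-k}$ by adding all possible edges inside the part of size $k$. *)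

theory Defs
  imports Complex_Main "HOL-Library.Multiset"
begin

section \<open>Finite simple graphs\<close>

text \<open>A graph is a pair of a vertex set and a set of edges, each edge being a two-element set of
  vertices.\<close>

type_synonym 'a ugraph = "'a set \<times> 'a set set"

abbreviation verts :: "'a ugraph \<Rightarrow> 'a set" where "verts \<equiv> fst"
abbreviation edges :: "'a ugraph \<Rightarrow> 'a set set" where "edges \<equiv> snd"

definition all_pairs :: "'a set \<Rightarrow> 'a set set" where
  "all_pairs S = {e. e \<subseteq> S \<and> card e = 2}"

definition simple_graph :: "'a ugraph \<Rightarrow> bool" where
  "simple_graph G \<longleftrightarrow> finite (verts G) \<and> edges G \<subseteq> all_pairs (verts G)"

text \<open>Meaningful for simple graphs only: the values of \<open>f\<close> outside \<open>verts G\<close> are arbitrary.\<close>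

definition graph_iso :: "'a ugraph \<Rightarrow> 'b ugraph \<Rightarrow> bool" where
  "graph_iso G H \<longleftrightarrow> (\<exists>f. bij_betw f (verts G) (verts H) \<and> edges H = (`) f ` edges G)"

definition contains_copy :: "'a ugraph \<Rightarrow> 'b ugraph \<Rightarrow> bool" where
  "contains_copy G F \<longleftrightarrow>
     (\<exists>f. inj_on f (verts F) \<and> f ` verts F \<subseteq> verts G \<and> (`) f ` edges F \<subseteq> edges G)"

definition free_of :: "'b ugraph \<Rightarrow> 'a ugraph \<Rightarrow> bool" where
  "free_of F G \<longleftrightarrow> \<not> contains_copy G F"

section \<open>Connectedness, blocks and cacti\<close>

definition subgraph :: "'a ugraph \<Rightarrow> 'a ugraph \<Rightarrow> bool" where
  "subgraph H G \<longleftrightarrow> simple_graph H \<and> verts H \<subseteq> verts G \<and> edges H \<subseteq> edges G"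

definition reachable :: "'a ugraph \<Rightarrow> 'a \<Rightarrow> 'a \<Rightarrow> bool" where
  "reachable G u v \<longleftrightarrow> (u, v) \<in> {(x, y). {x, y} \<in> edges G}\<^sup>*"

definition connected_graph :: "'a ugraph \<Rightarrow> bool" where
  "connected_graph G \<longleftrightarrow>
     verts G \<noteq> {} \<and> (\<forall>u \<in> verts G. \<forall>v \<in> verts G. reachable G u v)"

definition delete_vertex :: "'a ugraph \<Rightarrow> 'a \<Rightarrow> 'a ugraph" where
  "delete_vertex G v = (verts G - {v}, {e \<in> edges G. v \<notin> e})"

definition cut_vertex :: "'a ugraph \<Rightarrow> 'a \<Rightarrow> bool" where
  "cut_vertex G v \<longleftrightarrow> v \<in> verts G \<and>
     (\<exists>x \<in> verts G - {v}. \<exists>y \<in> verts G - {v}.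
        reachable G x y \<and> \<not> reachable (delete_vertex G v) x y)"

definition nonseparable :: "'a ugraph \<Rightarrow> bool" where
  "nonseparable G \<longleftrightarrow> connected_graph G \<and> (\<nexists>v. cut_vertex G v)"

text \<open>A block is a maximal connected subgraph without a cut vertex of its own.\<close>

definition blocks :: "'a ugraph \<Rightarrow> 'a ugraph set" where
  "blocks G = {H. subgraph H G \<and> nonseparable H \<and>
     (\<forall>H'. subgraph H' G \<and> nonseparable H' \<and> subgraph H H' \<longrightarrow> H' = H)}"

definition is_complete :: "'a ugraph \<Rightarrow> bool" where
  "is_complete G \<longleftrightarrow> edges G = all_pairs (verts G)"

text \<open>\<open>cactus G [n\<^sub>1, \<dots>, n\<^sub>s]\<close> says that \<open>G\<close> is a \<open>B(n; n\<^sub>1, \<dots>, n\<^sub>s)\<close>, with \<open>n\<close> the number of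
  vertices of \<open>G\<close>. Sizes are compared as multisets, so their order is irrelevant.\<close>

definition cactus :: "'a ugraph \<Rightarrow> nat list \<Rightarrow> bool" where
  "cactus G ns \<longleftrightarrow>
     2 \<le> card (verts G) \<and> ns \<noteq> [] \<and> (\<forall>m \<in> set ns. 2 \<le> m) \<and>
     (\<Sum>m\<leftarrow>ns. m - 1) = card (verts G) - 1 \<and>
     simple_graph G \<and> connected_graph G \<and> (\<forall>H \<in> blocks G. is_complete H) \<and>
     image_mset (\<lambda>H. card (verts H)) (mset_set (blocks G)) = mset ns"

section \<open>The particular graphs\<close>

definition cycle_graph :: "nat \<Rightarrow> nat ugraph" where
  "cycle_graph l = ({..<l}, {{i, Suc i mod l} | i. i < l})"

definition complete_graph :: "nat \<Rightarrow> nat ugraph" where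
  "complete_graph n = ({..<n}, all_pairs {..<n})"

definition complete_bipartite :: "nat \<Rightarrow> nat \<Rightarrow> nat ugraph" where
  "complete_bipartite a b = ({..<a + b}, {{u, v} | u v. u < a \<and> a \<le> v \<and> v < a + b})"

definition H1 :: "nat \<Rightarrow> nat \<Rightarrow> nat ugraph" where
  "H1 n k = ({..<n}, edges (complete_bipartite k (n - k)) \<union> all_pairs {..<k})"

text \<open>The cactus \<open>B(a + b - 1; a, b)\<close>: two complete graphs sharing exactly the vertex \<open>a - 1\<close>
  (for \<open>a, b \<ge> 2\<close>; see \<open>cactus_two_blocks\<close> below).\<close>

definition two_blocks :: "nat \<Rightarrow> nat \<Rightarrow> nat ugraph" where
  "two_blocks a b =
     ({..<a + b - 1}, all_pairs {..<a} \<union> all_pairs {a - 1..<a + b - 1})"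

section \<open>Extremal numbers\<close>

text \<open>Both maxima range over finite sets of numbers, as every isomorphism type of finite graphs
  occurs with vertices in \<^typ>\<open>nat\<close> and \<open>card (edges G) \<le> n choose 2\<close>.\<close>

definition ex_number :: "nat \<Rightarrow> 'b ugraph \<Rightarrow> nat" where
  "ex_number n F = Max {card (edges G) | G :: nat ugraph.
     simple_graph G \<and> card (verts G) = n \<and> free_of F G}"

definition extremal_graph :: "nat \<Rightarrow> 'b ugraph \<Rightarrow> 'a ugraph \<Rightarrow> bool" where
  "extremal_graph n F G \<longleftrightarrow>
     simple_graph G \<and> card (verts G) = n \<and> free_of F G \<and> card (edges G) = ex_number n F"

definition g_cactus :: "nat \<Rightarrow> nat \<Rightarrow> nat" where
  "g_cactus n k = Max {card (edges G) | G :: nat ugraph.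
     (\<exists>ns. cactus G ns) \<and> card (verts G) = n \<and> free_of (cycle_graph (2 * k + 1)) G}"

section \<open>The graph \<open>two_blocks a b\<close> is a cactus with blocks of sizes \<open>a\<close> and \<open>b\<close>\<close>

lemma pair_in_all_pairs: "{x, y} \<in> all_pairs S \<longleftrightarrow> x \<in> S \<and> y \<in> S \<and> x \<noteq> y"
  by (auto simp: all_pairs_def card_insert_if)

lemma reachable_edge: "{x, y} \<in> edges G \<Longrightarrow> reachable G x y"
  by (auto simp: reachable_def)

lemma reachable_refl: "reachable G x x"
  by (simp add: reachable_def)

lemma reachable_trans: "reachable G x y \<Longrightarrow> reachable G y z \<Longrightarrow> reachable G x z"
  unfolding reachable_def by (rule rtrancl_trans)

lemma nonseparable_complete:
  assumes "S \<noteq> {}"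
  shows "nonseparable (S, all_pairs S)"
proof -
  have "reachable (S, all_pairs S) x y" if "x \<in> S" "y \<in> S" for x y
    using that by (cases "x = y") (auto intro: reachable_edge reachable_refl simp: pair_in_all_pairs)
  moreover have "reachable (delete_vertex (S, all_pairs S) v) x y"
    if "x \<in> S - {v}" "y \<in> S - {v}" for x y v
    using that by (cases "x = y")
      (auto intro!: reachable_edge reachable_refl simp: pair_in_all_pairs delete_vertex_def)
  ultimately show ?thesis
    using assms by (auto simp: nonseparable_def connected_graph_def cut_vertex_def)
qed

lemma cactus_two_blocks:
  assumes a: "2 \<le> a" and b: "2 \<le> b"
  shows "cactus (two_blocks a b) [a, b]"
proof -
  define A where "A = {..<a}"
  define B where "B = {a - 1..<a + b - 1}"
  define c where "c = a - 1"
  define G where "G = two_blocks a b"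
  have G: "G = (A \<union> B, all_pairs A \<union> all_pairs B)"
    using a b by (auto simp: G_def two_blocks_def A_def B_def)
  have AB: "A \<inter> B = {c}" "finite A" "finite B" "card A = a" "card B = b" "0 \<in> A" "0 \<notin> B"
    "a \<in> B" "a \<notin> A"
    using a b by (auto simp: A_def B_def c_def)
  have AB1: "x = c" if "x \<in> A" "x \<in> B" for x using AB that by blast
  have cAB: "c \<in> A" "c \<in> B" using AB by blast+
  have simpG: "simple_graph G"
    using AB by (auto simp: G simple_graph_def all_pairs_def)
  have edgeG: "{x, y} \<in> edges G \<longleftrightarrow> x \<noteq> y \<and> (x \<in> A \<and> y \<in> A \<or> x \<in> B \<and> y \<in> B)" for x y
    by (auto simp: G pair_in_all_pairs)
  have reach_c: "reachable G x c" "reachable G c x" if "x \<in> verts G" for x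
    using that cAB by (cases "x = c"; auto intro!: reachable_edge reachable_refl simp: edgeG; simp add: G)+
  have connG: "connected_graph G"
    unfolding connected_graph_def
    using reach_c AB by (auto intro: reachable_trans simp: G)
  have split: "verts H \<subseteq> A \<or> verts H \<subseteq> B" if H: "subgraph H G" "nonseparable H" for H
  proof (rule ccontr)
    assume "\<not> ?thesis"
    then obtain x y where xy: "x \<in> verts H" "x \<notin> B" "y \<in> verts H" "y \<notin> A" by blast
    have HG: "verts H \<subseteq> A \<union> B" "edges H \<subseteq> edges G" "edges H \<subseteq> all_pairs (verts H)"
      using H by (auto simp: subgraph_def simple_graph_def G)
    have xA: "x \<in> A" and yB: "y \<in> B" and xc: "x \<noteq> c" and yc: "y \<noteq> c" using xy HG cAB by auto
    have stay: "z \<in> A - {c}" if "reachable (delete_vertex H c) x z" for z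
      using that unfolding reachable_def
    proof (induction rule: rtrancl_induct)
      case base
      then show ?case using xA xc by simp
    next
      case (step u v)
      then have "{u, v} \<in> edges G" "v \<noteq> c" "u \<noteq> c"
        using HG by (auto simp: delete_vertex_def)
      then show ?case using step.IH AB1 by (auto simp: edgeG)
    qed
    have nr: "\<not> reachable (delete_vertex H c) x y" using stay xy by auto
    have r: "reachable H x y"
      using H xy by (auto simp: nonseparable_def connected_graph_def)
    show False
    proof (cases "c \<in> verts H")
      case True
      then have "cut_vertex H c" using r nr xy xc yc by (auto simp: cut_vertex_def)
      then show False using H by (auto simp: nonseparable_def)
    next
      case False
      then have "edges (delete_vertex H c) = edges H"
        using HG by (auto simp: delete_vertex_def all_pairs_def)
      then show False using r nr by (simp add: reachable_def)
    qed
  qed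
  let ?KA = "(A, all_pairs A)" and ?KB = "(B, all_pairs B)"
  have sub: "subgraph ?KA G" "subgraph ?KB G"
    using AB by (auto simp: subgraph_def simple_graph_def G)
  have ns: "nonseparable ?KA" "nonseparable ?KB"
    using cAB by (auto intro!: nonseparable_complete)
  have into: "subgraph H ?KA \<or> subgraph H ?KB" if H: "subgraph H G" "nonseparable H" for H
    using split[OF H] H(1) by (fastforce simp: subgraph_def simple_graph_def all_pairs_def)
  have antisym: "H = K" if "subgraph H K" "subgraph K H" for H K :: "nat ugraph"
    using that by (auto simp: subgraph_def prod_eq_iff)
  have nAB: "\<not> A \<subseteq> B" "\<not> B \<subseteq> A" using AB by auto
  have maxA: "H = ?KA" if H: "subgraph H G" "nonseparable H" "subgraph ?KA H" for H
  proof -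
    have "\<not> subgraph H ?KB"
    proof
      assume "subgraph H ?KB"
      then have "A \<subseteq> B" using H(3) unfolding subgraph_def fst_conv by (blast intro: order_trans)
      then show False using nAB(1) by contradiction
    qed
    then have "subgraph H ?KA" using into[OF H(1,2)] by argo
    then show ?thesis using H(3) by (rule antisym)
  qed
  have maxB: "H = ?KB" if H: "subgraph H G" "nonseparable H" "subgraph ?KB H" for H
  proof -
    have "\<not> subgraph H ?KA"
    proof
      assume "subgraph H ?KA"
      then have "B \<subseteq> A" using H(3) unfolding subgraph_def fst_conv by (blast intro: order_trans)
      then show False using nAB(2) by contradiction
    qed
    then have "subgraph H ?KB" using into[OF H(1,2)] by argo
    then show ?thesis using H(3) by (rule antisym)
  qed
  have blocks: "blocks G = {?KA, ?KB}"
  proof (intro equalityI subsetI)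
    fix H assume "H \<in> blocks G"
    then have "subgraph H G" "nonseparable H"
      "\<And>H'. subgraph H' G \<Longrightarrow> nonseparable H' \<Longrightarrow> subgraph H H' \<Longrightarrow> H' = H"
      by (auto simp: blocks_def)
    then show "H \<in> {?KA, ?KB}" using into[of H] sub ns by blast
  next
    fix H assume "H \<in> {?KA, ?KB}"
    then show "H \<in> blocks G" using sub ns maxA maxB by (auto simp: blocks_def)
  qed
  have cardG: "card (verts G) = a + b - 1" by (simp add: G_def two_blocks_def)
  have "?KA \<noteq> ?KB" using nAB by auto
  then have "image_mset (\<lambda>H. card (verts H)) (mset_set (blocks G)) = mset [a, b]"
    using AB by (simp add: blocks)
  moreover have "\<forall>H \<in> blocks G. is_complete H" by (simp add: blocks is_complete_def)
  ultimately show ?thesis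
    using a b cardG simpG connG unfolding G_def[symmetric] by (simp add: cactus_def)
qed

end

theory Submission
  imports Defs
begin

text \<open>
  The proof is by induction on \<open>n\<close>. A vertex whose degree is at most the increment of the claimed
  bound is deleted; if equality holds, the smaller graph has one of the listed shapes and the only way
  to put the vertex back without creating a \<open>C\<^bsub>2k+1\<^esub>\<close> leads to a listed shape again. So
  let every degree be larger than the increment, and let \<open>C\<close> be a longest cycle, with vertex set \<open>U\<close>
  and length \<open>c\<close>. The ends of a longest path outside \<open>C\<close> have few neighbours on \<open>C\<close>, because a
  detour through the path must not lengthen \<open>C\<close>. This has two consequences.

  If \<open>c > 2k + 1\<close>, the vertices outside \<open>C\<close> can be peeled off with degrees less than half of the
  current order, and Bondy's argument for Hamiltonian graphs without a cycle of a given length bounds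
  the number of edges inside \<open>U\<close> by \<open>c\<^sup>2/4\<close>. Hence there are at most \<open>n\<^sup>2/4\<close> edges, and
  equality forces \<open>C\<close> to be Hamiltonian and the chords to join exactly the vertices at odd distance.

  If \<open>c \<le> 2k\<close>, the number of edges is at most \<open>c choose 2 + (n - c + 1) choose 2\<close>. Let \<open>a\<close> be the
  largest minimum degree (in \<open>U \<union> S\<close>) of a nonempty set \<open>S\<close> outside \<open>C\<close>. The successors on \<open>C\<close>
  of the neighbours of a component of \<open>S\<close> have, with one exception, degree at most \<open>c/2\<close> inside
  \<open>U\<close>, which leaves few edges inside \<open>U\<close> when \<open>a\<close> is large, while the vertices outside are peeled
  off with degrees at most \<open>a\<close>. Equality forces \<open>c = 2k\<close>, \<open>a = k\<close> and \<open>n = 3k - 1\<close>, and then the graph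
  is \<open>H\<^sub>1(n, k)\<close>.
\<close>

section \<open>Paths and cycles\<close>

text \<open>The forbidden length is a single one: longer cycles are allowed, and this is what splits
  the proof at the length of a longest cycle. The degree assumption enters through Dirac's
  observation: if all degrees exceed the increment, the longest cycle is longer than the increment
  by at least 2. The function \<open>c choose 2 + (n - c + 1 choose 2)\<close> is convex in
  \<open>c\<close> and takes equal values at \<open>c = 2 * k\<close> and
  \<open>c = n - 2 * k + 1\<close>. Below \<open>4 * k - 1\<close> the longest cycle exceeds the
  latter, so among the lengths up to \<open>2 * k\<close> only \<open>2 * k\<close> can reach the
  bound. The obstacle in the case of short cycles is a set outside the cycle all of whose vertices
  have more neighbours than the set has elements. Its edges to the cycle must be paid for by pairs
  missing inside the cycle; hence the interest in successors. The order \<open>3 * k - 1\<close> of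
  the join comes from equality there, and \<open>3 * k\<close> from adding one vertex. The next
  increment is \<open>k + 1\<close>, but a vertex added to the join has at most \<open>k\<close>
  neighbours, so the family stops.\<close>

definition nbrs :: "'a set set \<Rightarrow> 'a set \<Rightarrow> 'a \<Rightarrow> 'a set" where
  "nbrs E S v = {u \<in> S. {u, v} \<in> E}"

text \<open>Degrees and edge counts take a vertex set as argument, so that peeling off vertices
  changes \<open>S\<close> only and never \<open>E\<close>.\<close>

definition ecount :: "'a set set \<Rightarrow> 'a set \<Rightarrow> nat" where
  "ecount E S = card {e \<in> E. e \<subseteq> S}"

definition is_path :: "'a set set \<Rightarrow> 'a list \<Rightarrow> bool" where
  "is_path E xs \<longleftrightarrow> distinct xs \<and> successively (\<lambda>u v. {u, v} \<in> E) xs"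

definition is_cyc :: "'a set set \<Rightarrow> 'a list \<Rightarrow> bool" where
  "is_cyc E xs \<longleftrightarrow> 3 \<le> length xs \<and> is_path E xs \<and> {last xs, hd xs} \<in> E"

lemma is_path_append:
  "is_path E (xs @ ys) \<longleftrightarrow> is_path E xs \<and> is_path E ys \<and> set xs \<inter> set ys = {} \<and>
     (xs = [] \<or> ys = [] \<or> {last xs, hd ys} \<in> E)"
  by (auto simp: is_path_def successively_append_iff)

lemma is_path_rev [simp]: "is_path E (rev xs) \<longleftrightarrow> is_path E xs"
  by (simp add: is_path_def insert_commute)

lemma is_path_Nil [simp]: "is_path E []" and is_path_single [simp]: "is_path E [x]"
  by (simp_all add: is_path_def)

lemma is_path_Cons:
  "is_path E (x # xs) \<longleftrightarrow> is_path E xs \<and> x \<notin> set xs \<and> (xs = [] \<or> {x, hd xs} \<in> E)"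
  using is_path_append[of E "[x]" xs] by auto

lemma is_path_nth: "is_path E xs \<Longrightarrow> Suc i < length xs \<Longrightarrow> {xs ! i, xs ! Suc i} \<in> E"
  by (auto simp: is_path_def successively_conv_nth)

lemma is_path_take: "is_path E xs \<Longrightarrow> is_path E (take i xs)"
  by (metis append_take_drop_id is_path_append)

lemma is_path_drop: "is_path E xs \<Longrightarrow> is_path E (drop i xs)"
  by (metis append_take_drop_id is_path_append)

text \<open>A cycle of length \<open>c\<close> is unrolled to a \<open>c\<close>-periodic sequence of vertices, so that arcs need
  no arithmetic modulo \<open>c\<close>.\<close>

definition cycfun :: "'a set set \<Rightarrow> nat \<Rightarrow> (nat \<Rightarrow> 'a) \<Rightarrow> bool" where
  "cycfun E c \<nu> \<longleftrightarrow> 3 \<le> c \<and> (\<forall>i. \<nu> (i + c) = \<nu> i) \<and> inj_on \<nu> {..<c} \<and>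
     (\<forall>i. {\<nu> i, \<nu> (Suc i)} \<in> E)"

lemma is_cyc_cycfun:
  assumes "is_cyc E xs"
  shows "cycfun E (length xs) (\<lambda>i. xs ! (i mod length xs))"
proof -
  let ?c = "length xs"
  have c: "3 \<le> ?c" and p: "is_path E xs" and l: "{last xs, hd xs} \<in> E"
    using assms by (auto simp: is_cyc_def)
  have "{xs ! (i mod ?c), xs ! (Suc i mod ?c)} \<in> E" for i
  proof (cases "Suc (i mod ?c) = ?c")
    case True
    then have "Suc i mod ?c = 0" by (simp add: mod_Suc)
    moreover have "i mod ?c = ?c - 1" using True by linarith
    moreover have "xs \<noteq> []" using c by auto
    ultimately show ?thesis using l by (simp add: last_conv_nth hd_conv_nth)
  next
    case False
    then have "Suc i mod ?c = Suc (i mod ?c)" by (simp add: mod_Suc)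
    moreover have "i mod ?c < ?c" using c by (intro mod_less_divisor) auto
    then have "Suc (i mod ?c) < ?c" using False by simp
    ultimately show ?thesis using is_path_nth[OF p, of "i mod ?c"] by simp
  qed
  moreover have "inj_on (\<lambda>i. xs ! (i mod ?c)) {..<?c}"
    using p by (auto simp: inj_on_def is_path_def nth_eq_iff_index_eq)
  ultimately show ?thesis using c by (auto simp: cycfun_def)
qed

lemma range_cyc: "xs \<noteq> [] \<Longrightarrow> range (\<lambda>i. xs ! (i mod length xs)) = set xs"
  unfolding set_conv_nth by (auto simp: image_iff) (metis mod_less)

lemma cycfun_mod:
  assumes "cycfun E c \<nu>" shows "\<nu> (i mod c) = \<nu> i"
proof -
  have "\<nu> (j + c * q) = \<nu> j" for j q
  proof (induction q)
    case (Suc q)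
    have "\<nu> (j + c * Suc q) = \<nu> ((j + c * q) + c)" by (simp add: algebra_simps)
    then show ?case using Suc assms by (simp add: cycfun_def)
  qed simp
  from this[of "i mod c" "i div c"] show ?thesis by (simp add: mult.commute)
qed

lemma cycfun_inj:
  assumes "cycfun E c \<nu>" shows "inj_on \<nu> {m..<m + c}"
proof -
  have "\<And>i. i mod c < c" using assms by (auto simp: cycfun_def)
  then have eq: "i mod c = j mod c" if "\<nu> i = \<nu> j" for i j
    using assms that cycfun_mod[OF assms, of i] cycfun_mod[OF assms, of j]
    by (auto simp: cycfun_def inj_on_def)
  have "i = j" if "m \<le> i" "i < m + c" "m \<le> j" "j < m + c" "i mod c = j mod c" "i \<le> j" for i j
  proof -
    have "c dvd j - i" using that(5,6) by (metis mod_eq_dvd_iff_nat)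
    moreover have "j - i < c" using that by linarith
    ultimately show ?thesis using \<open>i \<le> j\<close> by (metis dvd_imp_le diff_is_0_eq le_antisym not_less gr0I)
  qed
  then show ?thesis using eq unfolding inj_on_def
    by (metis atLeastLessThan_iff nat_le_linear)
qed

lemma cycfun_eqD:
  assumes "cycfun E c \<nu>" "\<nu> i = \<nu> j" "i \<le> j" "j < i + c" shows "i = j"
  using cycfun_inj[OF assms(1), of i] assms by (auto simp: inj_on_def)

lemma cycfun_range:
  assumes "cycfun E c \<nu>" shows "range \<nu> = \<nu> ` {m..<m + c}"
proof -
  have c: "c > 0" using assms by (auto simp: cycfun_def)
  have "range \<nu> \<subseteq> \<nu> ` {..<c}"
    using cycfun_mod[OF assms] c by (metis image_eqI image_subsetI lessThan_iff mod_less_divisor)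
  then have "card (range \<nu>) \<le> c" and f: "finite (range \<nu>)"
    using finite_surj[of "{..<c}" "range \<nu>" \<nu>] by (auto intro: surj_card_le[of "{..<c}", simplified])
  moreover have "card (\<nu> ` {m..<m + c}) = c" using cycfun_inj[OF assms] by (simp add: card_image)
  ultimately show ?thesis by (metis card_seteq image_mono top_greatest)
qed

lemma card_cycfun: "cycfun E c \<nu> \<Longrightarrow> card (range \<nu>) = c"
  using cycfun_inj[of E c \<nu> 0] cycfun_range[of E c \<nu> 0] by (simp add: card_image)

lemma finite_cycfun: "cycfun E c \<nu> \<Longrightarrow> finite (range \<nu>)"
  using cycfun_range[of E c \<nu> 0] by simp

lemma cycfun_arc:
  assumes "cycfun E c \<nu>" "j \<le> i + c" shows "is_path E (map \<nu> [i..<j])"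
proof -
  have "inj_on \<nu> {i..<j}"
    using cycfun_inj[OF assms(1), of i] assms(2) by (auto intro: inj_on_subset)
  then show ?thesis
    using assms(1) by (auto simp: is_path_def distinct_map successively_conv_nth cycfun_def)
qed

lemma hd_arc: "a < b \<Longrightarrow> hd (map f [a..<b]) = f a"
  and last_arc: "a < b \<Longrightarrow> last (map f [a..<b]) = f (b - 1)"
  by (simp_all add: hd_map last_map)

lemma cycfun_is_cyc:
  assumes "cycfun E c \<nu>" shows "\<exists>ys. is_cyc E ys \<and> length ys = c"
proof (intro exI conjI)
  let ?ys = "map \<nu> [0..<c]"
  have "3 \<le> c" "{\<nu> (c - 1), \<nu> (Suc (c - 1))} \<in> E" "\<nu> (0 + c) = \<nu> 0"
    using assms by (simp_all only: cycfun_def)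
  then show "is_cyc E ?ys" using cycfun_arc[OF assms, of c 0]
    by (auto simp: is_cyc_def hd_arc last_arc)
  show "length ?ys = c" by simp
qed

text \<open>Turns the size of a vertex set on the cycle into a number of positions in a window that
  may start anywhere, where gaps can be counted.\<close>

lemma cycfun_card:
  assumes "cycfun E c \<nu>"
  shows "card {i \<in> {m..<m + c}. \<nu> i \<in> T} = card (T \<inter> range \<nu>)"
proof -
  have "T \<inter> range \<nu> = \<nu> ` {i \<in> {m..<m + c}. \<nu> i \<in> T}"
    unfolding cycfun_range[OF assms, of m] by auto
  moreover have "inj_on \<nu> {i \<in> {m..<m + c}. \<nu> i \<in> T}"
    using cycfun_inj[OF assms, of m] by (rule inj_on_subset) auto
  ultimately show ?thesis by (simp add: card_image)
qed

lemma disjoint_arcs: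
  assumes "cycfun E c \<nu>" "b \<le> a'" "b' \<le> a + c"
  shows "\<nu> ` {a..<b} \<inter> \<nu> ` {a'..<b'} = {}"
proof -
  have "False" if "a \<le> i" "i < b" "a' \<le> j" "j < b'" "\<nu> i = \<nu> j" for i j
    using cycfun_eqD[OF assms(1) that(5)] that assms by linarith
  then show ?thesis by auto
qed

lemma choose2: "2 * (m choose 2) = m * (m - 1)"
proof -
  have "even (m * (m - 1))" by (cases m) auto
  then show ?thesis by (simp add: choose_two)
qed

text \<open>Doubling removes the division and the integers remove truncated subtraction, so the
  later estimates become polynomial identities.\<close>

lemma choose2_int: "2 * int (m choose 2) = int m * (int m - 1)"
proof -
  have "2 * int (m choose 2) = int (m * (m - 1))" by (metis choose2 of_nat_mult of_nat_numeral)
  then show ?thesis by (cases m) (simp_all add: algebra_simps)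
qed

lemma card_all_pairs: "finite S \<Longrightarrow> card (all_pairs S) = card S choose 2"
  unfolding all_pairs_def by (rule n_subsets)

section \<open>Degrees, edge counts and longest paths\<close>

locale sgraph =
  fixes V :: "'a set" and E :: "'a set set"
  assumes finV: "finite V" and E: "E \<subseteq> all_pairs V"
begin

lemma finE: "finite E"
  using finV E by (auto intro: finite_subset[of _ "Pow V"] simp: all_pairs_def)

lemma edgeD: "{u, v} \<in> E \<Longrightarrow> u \<in> V \<and> v \<in> V \<and> u \<noteq> v"
  using E by (simp add: subset_iff) (metis pair_in_all_pairs)

lemma no_loop [simp]: "{u} \<notin> E"
  by (metis edgeD insert_absorb2)

lemma edge_cases:
  assumes "e \<in> E" obtains u v where "e = {u, v}" "u \<noteq> v"
  using assms E unfolding all_pairs_def by (auto simp: card_2_iff)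

lemma finite_nbrs: "finite (nbrs E S v)"
  using finV edgeD by (auto intro: finite_subset[of _ V] simp: nbrs_def)

lemma nbrs_mono: "S \<subseteq> T \<Longrightarrow> card (nbrs E S v) \<le> card (nbrs E T v)"
  by (rule card_mono[OF finite_nbrs]) (auto simp: nbrs_def)

lemma nbrs_union: "S \<inter> T = {} \<Longrightarrow> card (nbrs E (S \<union> T) v) = card (nbrs E S v) + card (nbrs E T v)"
  by (subst card_Un_disjoint[symmetric])
    (auto simp: finite_nbrs, auto simp: nbrs_def intro: arg_cong[of _ _ card])

lemma nbrs_le: "finite S \<Longrightarrow> v \<in> S \<Longrightarrow> card (nbrs E S v) \<le> card S - 1"
  by (subst card_Diff_singleton[symmetric]) (auto simp: nbrs_def intro!: card_mono)

lemma ecount_insert: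
  assumes "v \<notin> S"
  shows "ecount E (insert v S) = ecount E S + card (nbrs E S v)"
proof -
  have "{e \<in> E. e \<subseteq> insert v S} = {e \<in> E. e \<subseteq> S} \<union> (\<lambda>u. {u, v}) ` nbrs E S v"
  proof (intro equalityI subsetI)
    fix e assume e: "e \<in> {e \<in> E. e \<subseteq> insert v S}"
    then obtain x y where xy: "e = {x, y}" "x \<noteq> y" by (auto elim: edge_cases)
    show "e \<in> {e \<in> E. e \<subseteq> S} \<union> (\<lambda>u. {u, v}) ` nbrs E S v"
    proof (cases "v \<in> e")
      case True
      then obtain u where "e = {u, v}" "u \<noteq> v" using xy by fastforce
      then show ?thesis using e by (auto simp: nbrs_def)
    qed (use e in auto)
  qed (auto simp: nbrs_def)
  moreover have "inj_on (\<lambda>u. {u, v}) (nbrs E S v)"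
    using assms by (auto simp: inj_on_def nbrs_def doubleton_eq_iff)
  then have "card ((\<lambda>u. {u, v}) ` nbrs E S v) = card (nbrs E S v)" by (rule card_image)
  moreover have "{e \<in> E. e \<subseteq> S} \<inter> (\<lambda>u. {u, v}) ` nbrs E S v = {}" using assms by auto
  ultimately show ?thesis unfolding ecount_def using finE finite_nbrs
    by (simp add: card_Un_disjoint)
qed

lemma ecount_V: "ecount E V = card E"
  using E by (auto simp: ecount_def all_pairs_def intro!: arg_cong[of _ _ card])

lemma ecount_empty [simp]: "ecount E {} = 0"
  using no_loop by (auto simp: ecount_def elim: edge_cases)

lemma ecount_le: "finite S \<Longrightarrow> ecount E S \<le> card S choose 2"
  unfolding ecount_def card_all_pairs[symmetric] using E
  by (intro card_mono) (auto simp: all_pairs_def)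

lemma handshake:
  assumes "finite S" shows "(\<Sum>v\<in>S. card (nbrs E S v)) = 2 * ecount E S"
  using assms
proof (induction S)
  case (insert x S)
  have n: "nbrs E (insert x S) v = (if v \<in> nbrs E S x then insert x (nbrs E S v) else nbrs E S v)"
    if "v \<in> S" for v using that by (auto simp: nbrs_def insert_commute)
  have "(\<Sum>v\<in>S. card (nbrs E (insert x S) v)) =
      (\<Sum>v\<in>S. card (nbrs E S v) + (if v \<in> nbrs E S x then 1 else 0))"
    using insert(2) by (intro sum.cong) (auto simp: n finite_nbrs card_insert_if, auto simp: nbrs_def)
  also have "\<dots> = 2 * ecount E S + card (nbrs E S x)"
    using insert by (simp add: sum.distrib sum.If_cases) (auto simp: nbrs_def intro!: arg_cong[of _ _ card])
  finally have "(\<Sum>v\<in>S. card (nbrs E (insert x S) v)) = 2 * ecount E S + card (nbrs E S x)" .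
  moreover have "nbrs E (insert x S) x = nbrs E S x" by (auto simp: nbrs_def)
  ultimately show ?case using insert ecount_insert[OF insert(2)] by simp
qed simp

text \<open>Vertices of \<open>X\<close> are deleted one by one, each counted with its degree into
  \<open>S\<close> and what is left of \<open>X\<close>; hence \<open>b\<close> may depend on the
  number of vertices left.\<close>

lemma peel:
  assumes "finite X" "S \<inter> X = {}"
    and "\<And>Y. Y \<subseteq> X \<Longrightarrow> Y \<noteq> {} \<Longrightarrow> \<exists>v\<in>Y. card (nbrs E (S \<union> Y) v) \<le> b (card Y)"
  shows "ecount E (S \<union> X) \<le> ecount E S + (\<Sum>j\<in>{1..card X}. b j)"
  using assms
proof (induction "card X" arbitrary: X)
  case (Suc m)
  then obtain v where v: "v \<in> X" "card (nbrs E (S \<union> X) v) \<le> b (card X)"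
    by (metis card_0_eq nat.distinct(1) subset_refl)
  let ?Y = "X - {v}"
  have "ecount E (S \<union> ?Y) \<le> ecount E S + (\<Sum>j\<in>{1..card ?Y}. b j)"
    using Suc v by (intro Suc.hyps(1)) auto
  moreover have "S \<union> X = insert v (S \<union> ?Y)" "v \<notin> S \<union> ?Y" using v Suc.prems by auto
  then have "ecount E (S \<union> X) = ecount E (S \<union> ?Y) + card (nbrs E (S \<union> ?Y) v)"
    by (simp add: ecount_insert)
  moreover have "card (nbrs E (S \<union> ?Y) v) \<le> b (card X)"
    using v(2) nbrs_mono[of "S \<union> ?Y" "S \<union> X" v] by (simp add: sup.coboundedI2)
  moreover have "card X = Suc (card ?Y)" using v Suc by simp
  ultimately show ?case by simp
qed simp

text \<open>An end with a neighbour in \<open>S\<close> off the path would prolong it. So an end has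
  fewer than \<open>length ps\<close> neighbours in \<open>S\<close>, and the rest of its degree
  must go elsewhere.\<close>

lemma longest_path:
  assumes "finite S" "S \<noteq> {}"
  obtains ps where "is_path E ps" "ps \<noteq> []" "set ps \<subseteq> S" "length ps \<le> card S"
    "nbrs E S (hd ps) \<subseteq> set ps" "nbrs E S (last ps) \<subseteq> set ps"
    "\<And>qs. is_path E qs \<Longrightarrow> set qs \<subseteq> S \<Longrightarrow> length qs \<le> length ps"
proof -
  let ?P = "\<lambda>ps. is_path E ps \<and> ps \<noteq> [] \<and> set ps \<subseteq> S"
  have len: "length ps \<le> card S" if "?P ps" for ps
    using that assms(1) by (metis card_mono distinct_card is_path_def)
  obtain x where "x \<in> S" using assms by auto
  then have "?P [x]" by simp
  then obtain ps where ps: "?P ps" and mx: "\<And>qs. ?P qs \<Longrightarrow> length qs \<le> length ps"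
    using ex_has_greatest_nat[of ?P "[x]" length "Suc (card S)"] len by (metis le_imp_less_Suc)
  have "y \<in> set ps" if "y \<in> nbrs E S (hd ps)" for y
  proof (rule ccontr)
    assume "y \<notin> set ps"
    then have "?P (y # ps)" using that ps by (auto simp: is_path_Cons nbrs_def)
    from mx[OF this] show False by simp
  qed
  moreover have "y \<in> set ps" if "y \<in> nbrs E S (last ps)" for y
  proof (rule ccontr)
    assume "y \<notin> set ps"
    then have "?P (ps @ [y])" using that ps by (auto simp: is_path_append nbrs_def insert_commute)
    from mx[OF this] show False by simp
  qed
  moreover have "length qs \<le> length ps" if "is_path E qs" "set qs \<subseteq> S" for qs
    using mx[of qs] that by (cases "qs = []") auto
  ultimately show ?thesis using that ps len by blast
qed

lemma nbrs_in_path: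
  assumes "is_path E ps" "v \<in> set ps" "nbrs E S v \<subseteq> set ps"
  shows "card (nbrs E S v) \<le> length ps - 1"
proof -
  have "card (nbrs E S v) \<le> card (set ps - {v})"
    using assms by (intro card_mono) (auto simp: nbrs_def)
  then show ?thesis using assms by (simp add: is_path_def distinct_card)
qed

text \<open>Dirac's argument: all neighbours of the head of a longest path lie on it, at positions
  at least 1, so the farthest one has position at least \<open>d\<close> and closes a cycle.\<close>

lemma long_cycle:
  assumes "V \<noteq> {}" and "\<And>v. v \<in> V \<Longrightarrow> d \<le> card (nbrs E V v)" "2 \<le> d"
  obtains xs where "is_cyc E xs" "Suc d \<le> length xs"
proof -
  obtain ps where ps: "is_path E ps" "ps \<noteq> []" "set ps \<subseteq> V" "nbrs E V (hd ps) \<subseteq> set ps"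
    using longest_path[OF finV assms(1)] by metis
  have D: "distinct ps" using ps by (simp add: is_path_def)
  define J where "J = {j. j < length ps \<and> {ps ! j, hd ps} \<in> E}"
  have fJ: "finite J" by (simp add: J_def)
  have img: "nbrs E V (hd ps) = (!) ps ` J"
    using ps by (fastforce simp: nbrs_def J_def in_set_conv_nth)
  moreover have "inj_on ((!) ps) J" using D by (auto simp: inj_on_def J_def nth_eq_iff_index_eq)
  ultimately have cJ: "d \<le> card J" using assms(2)[of "hd ps"] ps by (simp add: card_image subset_iff)
  then have "J \<noteq> {}" using assms(3) by auto
  define m where "m = Max J"
  have mJ: "m \<in> J" using \<open>J \<noteq> {}\<close> fJ by (simp add: m_def)
  have "J \<subseteq> {1..m}"
  proof
    fix j assume j: "j \<in> J"
    then have "j \<noteq> 0" using ps(2) by (cases j) (auto simp: J_def hd_conv_nth)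
    then show "j \<in> {1..m}" using j fJ by (simp add: m_def)
  qed
  then have dm: "d \<le> m" using cJ card_mono[of "{1..m}" J] by simp
  have l: "m < length ps" and e: "{ps ! m, hd ps} \<in> E" using mJ by (auto simp: J_def)
  have "last (take (Suc m) ps) = ps ! m" using l by (simp add: take_Suc_conv_app_nth)
  then have "is_cyc E (take (Suc m) ps)"
    using l e dm assms(3) is_path_take[OF ps(1)] by (simp add: is_cyc_def hd_take)
  then show ?thesis using that[of "take (Suc m) ps"] l dm by simp
qed

end

section \<open>Longest cycles\<close>

text \<open>The marked positions in \<open>{i..<j}\<close> own disjoint intervals of
  \<open>g\<close> positions, the last one because \<open>j\<close> is marked too.\<close>

lemma gaps_uniform:
  fixes S :: "nat \<Rightarrow> bool"
  assumes "S i" "S j" "i \<le> j"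
    and "\<And>x y. S x \<Longrightarrow> S y \<Longrightarrow> i \<le> x \<Longrightarrow> x < y \<Longrightarrow> y \<le> j \<Longrightarrow> x + g \<le> y"
  shows "g * card {x \<in> {i..<j}. S x} \<le> j - i"
  using assms
proof (induction j rule: less_induct)
  case (less j)
  show ?case
  proof (cases "i = j")
    case False
    define T where "T = {x \<in> {i..<j}. S x}"
    have T: "finite T" "i \<in> T" using less.prems False by (auto simp: T_def)
    define y where "y = Max T"
    have yT: "y \<in> T" unfolding y_def using T Max_in by blast
    have "x \<le> y" if "x \<in> T" for x using T that by (simp add: y_def)
    then have split: "T = insert y {x \<in> {i..<y}. S x}" using yT by (force simp: T_def)
    have "g * card {x \<in> {i..<y}. S x} \<le> y - i"
      using yT less.prems by (intro less.IH) (auto simp: T_def)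
    moreover have "y + g \<le> j" using yT less.prems by (auto simp: T_def)
    moreover have "i \<le> y" using yT by (simp add: T_def)
    moreover have "card T = Suc (card {x \<in> {i..<y}. S x})"
      unfolding split by (subst card_insert_disjoint) auto
    ultimately show ?thesis unfolding T_def[symmetric] by simp
  qed simp
qed

text \<open>Between a \<open>P\<close>-mark at \<open>i\<close> and a \<open>Q\<close>-mark at
  \<open>j\<close> some \<open>P\<close>-mark is directly followed by a \<open>Q\<close>-mark, and
  that gap is \<open>p + 1\<close> instead of 2. The induction searches for it from the
  right.\<close>

lemma gaps_crossing:
  fixes P Q :: "nat \<Rightarrow> bool"
  assumes "P i" "Q j" "i < j" "1 \<le> p"
    and "\<And>x y. P x \<or> Q x \<Longrightarrow> P y \<or> Q y \<Longrightarrow> i \<le> x \<Longrightarrow> x < y \<Longrightarrow> y \<le> j \<Longrightarrow> x + 2 \<le> y"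
    and "\<And>x y. P x \<Longrightarrow> Q y \<Longrightarrow> i \<le> x \<Longrightarrow> x < y \<Longrightarrow> y \<le> j \<Longrightarrow> x + p + 1 \<le> y"
  shows "2 * card {x \<in> {i..<j}. P x \<or> Q x} + (p - 1) \<le> j - i"
  using assms
proof (induction j rule: less_induct)
  case (less j)
  define T where "T = {x \<in> {i..<j}. P x \<or> Q x}"
  have T: "finite T" "i \<in> T" using less.prems by (auto simp: T_def)
  define y where "y = Max T"
  have yT: "y \<in> T" unfolding y_def using T Max_in by blast
  then have iy: "i \<le> y" "y < j" by (auto simp: T_def)
  have "x \<le> y" if "x \<in> T" for x using T that by (simp add: y_def)
  then have split: "T = insert y {x \<in> {i..<y}. P x \<or> Q x}" using yT by (force simp: T_def)
  have "2 * card {x \<in> {i..<y}. P x \<or> Q x} + (if P y then 0 else p - 1) \<le> y - i"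
  proof (cases "P y")
    case True
    have "2 * card {x \<in> {i..<y}. P x \<or> Q x} \<le> y - i"
      using True iy less.prems(1,5) by (intro gaps_uniform) auto
    then show ?thesis using True by simp
  next
    case False
    then have "y \<noteq> i" "Q y" using less.prems yT by (auto simp: T_def)
    then have "2 * card {x \<in> {i..<y}. P x \<or> Q x} + (p - 1) \<le> y - i"
      using iy less.prems by (intro less.IH) auto
    then show ?thesis using False by simp
  qed
  moreover have "y + (if P y then p + 1 else 2) \<le> j"
    using yT less.prems(2) less.prems(6)[of y j] less.prems(5)[of y j] iy by (auto simp: T_def)
  moreover have "card T = Suc (card {x \<in> {i..<y}. P x \<or> Q x})"
    unfolding split by (subst card_insert_disjoint) auto
  ultimately show ?case unfolding T_def[symmetric] using iy less.prems(4) by (cases "P y") simp_all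
qed

text \<open>Ore's rotation: run to \<open>qs ! i\<close>, jump to the last vertex, run back to
  \<open>qs ! Suc i\<close> and close up at the head.\<close>

lemma (in sgraph) crossing_cycle:
  assumes "is_path E qs" "3 \<le> length qs" "Suc i < length qs"
    "{hd qs, qs ! Suc i} \<in> E" "{last qs, qs ! i} \<in> E"
  shows "\<exists>xs. is_cyc E xs \<and> length xs = length qs"
proof -
  let ?a = "take (Suc i) qs" and ?b = "drop (Suc i) qs"
  have ne: "?a \<noteq> []" "?b \<noteq> []" "qs \<noteq> []" using assms(3) by auto
  have "set ?a \<inter> set ?b = {}" using assms(1) by (simp add: is_path_def set_take_disj_set_drop_if_distinct)
  moreover have "last ?a = qs ! i" using assms(3) by (simp add: take_Suc_conv_app_nth)
  moreover have "hd (rev ?b) = last qs" using ne by (simp add: hd_rev)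
  ultimately have "is_path E (?a @ rev ?b)"
    using assms by (auto simp: is_path_append is_path_take is_path_drop insert_commute)
  moreover have "last (?a @ rev ?b) = qs ! Suc i" using assms(3) ne by (simp add: last_rev hd_drop_conv_nth)
  moreover have "hd (?a @ rev ?b) = hd qs" using ne by (simp add: hd_append hd_take)
  ultimately have "is_cyc E (?a @ rev ?b)" using assms by (simp add: is_cyc_def insert_commute)
  then show ?thesis using assms(3) by (intro exI[of _ "?a @ rev ?b"]) simp
qed

locale longest_cycle = sgraph V E for V :: "'a set" and E +
  fixes c :: nat and \<nu> :: "nat \<Rightarrow> 'a"
  assumes cyc: "cycfun E c \<nu>" and longest: "\<And>xs. is_cyc E xs \<Longrightarrow> length xs \<le> c"
begin

abbreviation U where "U \<equiv> range \<nu>"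

lemma c3: "3 \<le> c" and per [simp]: "\<nu> (i + c) = \<nu> i" and step: "{\<nu> i, \<nu> (Suc i)} \<in> E"
  using cyc by (auto simp: cycfun_def)

lemma finU: "finite U" and cardU: "card U = c"
  using finite_cycfun[OF cyc] card_cycfun[OF cyc] by auto

lemma U_V: "U \<subseteq> V"
  using step edgeD by blast

text \<open>Otherwise \<open>ps\<close> in place of the arc from \<open>\<nu> i\<close> to
  \<open>\<nu> j\<close> would give a longer cycle. For \<open>ps = [v]\<close> this says that
  neighbours of \<open>v\<close> are never consecutive on the cycle.\<close>

lemma detour:
  assumes ps: "is_path E ps" "ps \<noteq> []" "set ps \<inter> U = {}"
    and ij: "i < j" "j < i + c" and e: "{\<nu> i, hd ps} \<in> E" "{\<nu> j, last ps} \<in> E"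
  shows "i + length ps + 1 \<le> j"
proof -
  let ?b = "map \<nu> [j..<Suc (i + c)]"
  have "is_path E ?b" using ij by (intro cycfun_arc[OF cyc]) auto
  moreover have "hd ?b = \<nu> j" using ij by (simp add: hd_map del: upt_Suc)
  moreover have lb: "last ?b = \<nu> i" using ij by simp
  moreover have "?b \<noteq> []" using ij by simp
  ultimately have "is_path E (ps @ ?b)"
    using ps e by (auto simp: is_path_append insert_commute simp del: upt_Suc)
  moreover have "length (ps @ ?b) = length ps + (i + c + 1 - j)" using ij by auto
  moreover have "length ps \<ge> 1" using ps(2) by (cases ps) auto
  ultimately have "is_cyc E (ps @ ?b)" unfolding is_cyc_def
    using ij ps(2) e lb by (simp del: upt_Suc)
  from longest[OF this] show ?thesis using ij by (simp del: upt_Suc)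
qed

lemma window: "\<exists>j\<in>{m..<m + c}. \<nu> j = \<nu> i"
  using cycfun_range[OF cyc, of m] by (metis image_iff rangeI)

text \<open>Let p be the length of a longest path in \<open>S\<close>. Positions adjacent to an end
  of it are at least 2 apart, and a position of one end is followed by one of the other end only
  after p + 1 steps. A full turn from a neighbour of the head past a neighbour of the last vertex
  contains two such changes, each of which gains p - 1.\<close>

lemma outside_ends:
  assumes S: "S \<subseteq> V - U" "S \<noteq> {}" and deg: "\<And>v. v \<in> S \<Longrightarrow> \<alpha> \<le> card (nbrs E (U \<union> S) v)"
    and \<alpha>: "card S + 1 \<le> \<alpha>"
  obtains ps where "is_path E ps" "ps \<noteq> []" "set ps \<subseteq> S" "length ps \<le> card S"
    "\<alpha> \<le> card (nbrs E U (hd ps)) + (length ps - 1)" "\<alpha> \<le> card (nbrs E U (last ps)) + (length ps - 1)"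
    "2 * card (nbrs E U (hd ps) \<union> nbrs E U (last ps)) + 2 * (length ps - 1) \<le> c"
    "\<And>qs. is_path E qs \<Longrightarrow> set qs \<subseteq> S \<Longrightarrow> length qs \<le> length ps"
proof -
  have finS: "finite S" using S(1) finV by (auto intro: finite_subset)
  obtain ps where ps: "is_path E ps" "ps \<noteq> []" "set ps \<subseteq> S" "length ps \<le> card S"
    "nbrs E S (hd ps) \<subseteq> set ps" "nbrs E S (last ps) \<subseteq> set ps"
    "\<And>qs. is_path E qs \<Longrightarrow> set qs \<subseteq> S \<Longrightarrow> length qs \<le> length ps"
    using longest_path[OF finS S(2)] by metis
  have US: "U \<inter> S = {}" using S by auto
  have d: "\<alpha> \<le> card (nbrs E U v) + (length ps - 1)" if "v \<in> set ps" "nbrs E S v \<subseteq> set ps" for v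
    using deg[of v] nbrs_in_path[OF ps(1) that] nbrs_union[OF US, of v] that ps(3) by (simp add: subset_iff)
  let ?A = "nbrs E U (hd ps)" and ?B = "nbrs E U (last ps)"
  have hA: "\<alpha> \<le> card ?A + (length ps - 1)" and hB: "\<alpha> \<le> card ?B + (length ps - 1)"
    using d ps by auto
  have "length ps \<ge> 1" using ps(2) by (cases ps) auto
  \<comment> \<open>An end has at most \<open>card S - 1\<close> neighbours in \<open>S\<close>, so
    \<open>card S + 1 \<le> \<alpha>\<close> leaves it two on the cycle. This makes it possible to
    choose distinct attachment vertices for the two ends.\<close>
  then have A2: "2 \<le> card ?A" and B2: "2 \<le> card ?B" using hA hB \<alpha> ps(4) by linarith+
  obtain i where i: "\<nu> i \<in> ?A" 
  proof -
    have "?A \<noteq> {}" using A2 by auto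
    then show ?thesis using that by (auto simp: nbrs_def)
  qed
  have "\<not> ?B \<subseteq> {\<nu> i}" using B2 card_mono[of "{\<nu> i}" ?B] by auto
  then obtain b where "b \<in> ?B" "b \<noteq> \<nu> i" by blast
  then obtain j where j: "j \<in> {i..<i + c}" "\<nu> j \<in> ?B" "\<nu> j \<noteq> \<nu> i"
    using window[of i] by (auto simp: nbrs_def) (metis atLeastLessThan_iff)
  then have ij: "i < j" "j < i + c" by (auto simp: order.order_iff_strict)
  define P where "P x = (\<nu> x \<in> ?A)" for x
  define Q where "Q x = (\<nu> x \<in> ?B)" for x
  have dis: "set ps \<inter> U = {}" using ps(3) S by auto
  have hl: "hd ps \<in> set ps" "last ps \<in> set ps" using ps(2) by auto
  have big: "x + length ps + 1 \<le> y" if "P x \<and> Q y \<or> Q x \<and> P y" "x < y" "y < x + c" for x y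
    using detour[OF ps(1,2) dis that(2,3)] detour[of "rev ps" x y] ps dis that
    by (auto simp: P_def Q_def nbrs_def hd_rev last_rev)
  have "x + 2 \<le> y" if "P x \<or> Q x" "P y \<or> Q y" "x < y" "y < x + c" for x y
  proof (cases "P x \<and> Q y \<or> Q x \<and> P y")
    case True then show ?thesis using big[OF True that(3,4)] ps(2) by (cases ps) auto
  next
    case False
    then have "(P x \<and> P y) \<or> (Q x \<and> Q y)" using that by auto
    moreover have "x + 2 \<le> y" if "v \<in> set ps" "{\<nu> x, v} \<in> E" "{\<nu> y, v} \<in> E" for v
      using detour[of "[v]" x y] that \<open>x < y\<close> \<open>y < x + c\<close> dis by auto
    ultimately show ?thesis using hl by (auto simp: P_def Q_def nbrs_def)
  qed
  note small = this
  have p1: "1 \<le> length ps" using ps(2) by (cases ps) auto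
  have "2 * card {x \<in> {i..<j}. P x \<or> Q x} + (length ps - 1) \<le> j - i"
  proof (rule gaps_crossing)
    show "P i" "Q j" using i j by (auto simp: P_def Q_def)
    show "x + 2 \<le> y" if "P x \<or> Q x" "P y \<or> Q y" "i \<le> x" "x < y" "y \<le> j" for x y
      using that ij by (intro small) auto
    show "x + length ps + 1 \<le> y" if "P x" "Q y" "i \<le> x" "x < y" "y \<le> j" for x y
      using that ij by (intro big) auto
  qed (use ij p1 in auto)
  moreover have "2 * card {x \<in> {j..<i + c}. Q x \<or> P x} + (length ps - 1) \<le> i + c - j"
  proof (rule gaps_crossing)
    show "Q j" "P (i + c)" using i j by (auto simp: P_def Q_def)
    show "x + 2 \<le> y" if "Q x \<or> P x" "Q y \<or> P y" "j \<le> x" "x < y" "y \<le> i + c" for x y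
      using that ij by (intro small) auto
    show "x + length ps + 1 \<le> y" if "Q x" "P y" "j \<le> x" "x < y" "y \<le> i + c" for x y
      using that ij by (intro big) auto
  qed (use ij p1 in auto)
  moreover have "card {x \<in> {i..<i + c}. \<nu> x \<in> ?A \<union> ?B} =
      card {x \<in> {i..<j}. P x \<or> Q x} + card {x \<in> {j..<i + c}. Q x \<or> P x}"
    using ij by (subst card_Un_disjoint[symmetric]) (auto simp: P_def Q_def intro!: arg_cong[of _ _ card])
  moreover have "card {x \<in> {i..<i + c}. \<nu> x \<in> ?A \<union> ?B} = card (?A \<union> ?B)"
    unfolding cycfun_card[OF cyc] by (auto simp: nbrs_def intro!: arg_cong[of _ _ card])
  ultimately have "2 * card (?A \<union> ?B) + 2 * (length ps - 1) \<le> c" using ij by linarith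
  then show ?thesis using that ps hA hB by blast
qed

text \<open>In \<open>outside_ends\<close> the length of the path cancels: what an end gains in
  neighbours on the path, the gaps take away on the cycle.\<close>

lemma outside_degree:
  assumes S: "S \<subseteq> V - U" "S \<noteq> {}" and deg: "\<And>v. v \<in> S \<Longrightarrow> \<alpha> \<le> card (nbrs E (U \<union> S) v)"
    and \<alpha>: "card S + 1 \<le> \<alpha>"
  shows "2 * \<alpha> \<le> c"
proof -
  obtain ps where ps: "\<alpha> \<le> card (nbrs E U (hd ps)) + (length ps - 1)"
    "2 * card (nbrs E U (hd ps) \<union> nbrs E U (last ps)) + 2 * (length ps - 1) \<le> c"
    using outside_ends[OF S deg \<alpha>] by metis
  have "card (nbrs E U (hd ps)) \<le> card (nbrs E U (hd ps) \<union> nbrs E U (last ps))"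
    by (rule card_mono) (auto simp: finite_nbrs)
  then show ?thesis using ps by linarith
qed

end

section \<open>Successors of attachment vertices\<close>

locale detoured_cycle = longest_cycle +
  fixes ps x y
  assumes ps: "is_path E ps" "ps \<noteq> []" "set ps \<inter> U = {}"
    and xy: "x < y" "y < x + c" and e: "{\<nu> x, last ps} \<in> E" "{\<nu> y, hd ps} \<in> E"
begin

text \<open>A path through all of \<open>U\<close> and \<open>ps\<close> whose ends are the two
  successors: forward from \<open>\<nu> (Suc x)\<close> to \<open>\<nu> y\<close>, through
  \<open>ps\<close> to \<open>\<nu> x\<close>, then backward to
  \<open>\<nu> (Suc y)\<close>.\<close>

definition qs where "qs = map \<nu> [Suc x..<Suc y] @ ps @ rev (map \<nu> [Suc y..<Suc (x + c)])"

lemma qs_ends: "hd qs = \<nu> (Suc x)" "last qs = \<nu> (Suc y)"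
  using xy by (auto simp: qs_def hd_append last_rev hd_map simp del: upt_Suc)

lemma length_qs: "length qs = c + length ps"
  using xy by (simp add: qs_def del: upt_Suc)

lemma qs_path: "is_path E qs"
proof -
  define as bs where "as = map \<nu> [Suc x..<Suc y]" and "bs = map \<nu> [Suc y..<Suc (x + c)]"
  have "set as \<inter> set bs = {}" unfolding as_def bs_def set_map set_upt
    by (rule disjoint_arcs[OF cyc]) auto
  moreover have "is_path E as" "is_path E bs" unfolding as_def bs_def
    using xy by (auto intro!: cycfun_arc[OF cyc] simp del: upt_Suc)
  moreover have "as \<noteq> []" "bs \<noteq> []" "last as = \<nu> y" "last bs = \<nu> x"
    using xy by (auto simp: as_def bs_def)
  moreover have "set as \<subseteq> U" "set bs \<subseteq> U" unfolding as_def bs_def set_map by blast+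
  then have "set ps \<inter> set as = {}" "set ps \<inter> set bs = {}" using ps(3) by blast+
  moreover have "qs = as @ ps @ rev bs" by (simp add: qs_def as_def bs_def)
  ultimately show ?thesis using ps(1,2) e
    by (auto simp: is_path_append hd_rev insert_commute)
qed

lemma set_qs: "set qs = U \<union> set ps"
proof -
  have "{Suc x..<Suc y} \<union> {Suc y..<Suc (x + c)} = {Suc x..<Suc x + c}" using xy by auto
  then show ?thesis unfolding qs_def cycfun_range[OF cyc, of "Suc x"]
    by (auto simp del: upt_Suc simp flip: image_Un)
qed

lemma succ_nonadjacent: "{\<nu> (Suc x), \<nu> (Suc y)} \<notin> E"
proof
  assume "{\<nu> (Suc x), \<nu> (Suc y)} \<in> E"
  then have "is_cyc E qs" using qs_path qs_ends length_qs c3 by (simp add: is_cyc_def insert_commute)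
  from longest[OF this] show False using length_qs ps(2) by simp
qed

text \<open>Ore's crossing argument on \<open>qs\<close>: an index in both \<open>I1\<close> and
  \<open>I2\<close> would close \<open>qs\<close> to a cycle longer than \<open>c\<close>. Only
  neighbours in \<open>U\<close> are counted, so that the length of \<open>ps\<close> does not enter
  the bound.\<close>

lemma succ_degree_sum:
  "card (nbrs E U (\<nu> (Suc x))) + card (nbrs E U (\<nu> (Suc y))) \<le> c"
proof -
  let ?m = "length qs"
  have D: "distinct qs" using qs_path by (simp add: is_path_def)
  have q0: "qs \<noteq> []" using length_qs c3 by auto
  define I1 where "I1 = {i. Suc i < ?m \<and> {hd qs, qs ! Suc i} \<in> E \<and> qs ! Suc i \<in> U}"
  define I2 where "I2 = {i. Suc i < ?m \<and> {last qs, qs ! i} \<in> E \<and> qs ! i \<in> U}"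
  have fin: "finite I1" "finite I2"
    by (auto simp: I1_def I2_def intro: finite_subset[of _ "{..<?m}"])
  have "nbrs E U (hd qs) \<subseteq> (\<lambda>i. qs ! Suc i) ` I1"
  proof
    fix u assume u: "u \<in> nbrs E U (hd qs)"
    then have "u \<in> set qs" using set_qs by (auto simp: nbrs_def)
    then obtain i where i: "i < ?m" "u = qs ! i" by (metis in_set_conv_nth)
    moreover have "i \<noteq> 0" using u i q0 by (cases i) (auto simp: nbrs_def hd_conv_nth)
    ultimately show "u \<in> (\<lambda>i. qs ! Suc i) ` I1" using u
      by (intro image_eqI[of _ _ "i - 1"]) (auto simp: I1_def nbrs_def insert_commute)
  qed
  then have c1: "card (nbrs E U (hd qs)) \<le> card I1" using fin by (meson card_image_le card_mono finite_imageI le_trans)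
  have "nbrs E U (last qs) \<subseteq> (\<lambda>i. qs ! i) ` I2"
  proof
    fix u assume u: "u \<in> nbrs E U (last qs)"
    then have "u \<in> set qs" using set_qs by (auto simp: nbrs_def)
    then obtain i where i: "i < ?m" "u = qs ! i" by (metis in_set_conv_nth)
    moreover have "i \<noteq> ?m - 1" using u i q0 by (auto simp: nbrs_def last_conv_nth)
    ultimately show "u \<in> (\<lambda>i. qs ! i) ` I2" using u
      by (intro image_eqI[of _ _ "i"]) (auto simp: I2_def nbrs_def insert_commute)
  qed
  then have c2: "card (nbrs E U (last qs)) \<le> card I2" using fin by (meson card_image_le card_mono finite_imageI le_trans)
  have "I1 \<inter> I2 = {}"
  proof (rule ccontr)
    assume "I1 \<inter> I2 \<noteq> {}"
    then obtain i where "Suc i < ?m" "{hd qs, qs ! Suc i} \<in> E" "{last qs, qs ! i} \<in> E"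
      by (auto simp: I1_def I2_def)
    then obtain xs where "is_cyc E xs" "length xs = ?m"
      using crossing_cycle[OF qs_path] length_qs c3 by force
    then show False using longest[of xs] length_qs ps(2) by simp
  qed
  then have c3': "card I1 + card I2 = card (I1 \<union> I2)" using fin by (simp add: card_Un_disjoint)
  define I where "I = {i. Suc i < ?m \<and> qs ! i \<in> U}"
  have fI: "finite I" by (auto simp: I_def intro: finite_subset[of _ "{..<?m}"])
  have inU: "qs ! i \<in> U" if "i < ?m" "i < y - x \<or> y - x + length ps \<le> i" for i
  proof -
    have "qs ! i \<in> set (map \<nu> [Suc x..<Suc y]) \<union> set (rev (map \<nu> [Suc y..<Suc (x + c)]))"
    proof (cases "i < y - x")
      case True
      then have "qs ! i = map \<nu> [Suc x..<Suc y] ! i" unfolding qs_def by (simp add: nth_append del: upt_Suc)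
      then show ?thesis using True by (metis UnI1 diff_Suc_Suc length_map length_upt nth_mem)
    next
      case False
      then have "qs ! i = rev (map \<nu> [Suc y..<Suc (x + c)]) ! (i - (y - x) - length ps)"
        using that unfolding qs_def by (auto simp: nth_append simp del: upt_Suc)
      moreover have "i - (y - x) - length ps < length (rev (map \<nu> [Suc y..<Suc (x + c)]))"
        using that False length_qs xy by (simp del: upt_Suc)
      ultimately show ?thesis by (metis UnI2 nth_mem)
    qed
    then show ?thesis by (auto simp del: upt_Suc)
  qed
  have notU: "qs ! i \<notin> U" if "y - x \<le> i" "i < y - x + length ps" for i
  proof -
    have "i - (y - x) < length ps" using that by linarith
    moreover from this have "qs ! i = ps ! (i - (y - x))"
      using that by (simp add: qs_def nth_append del: upt_Suc)
    ultimately have "qs ! i \<in> set ps" by simp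
    then show ?thesis using ps(3) by auto
  qed
  have "i = y - x + length ps - 1" if "Suc i < ?m" "qs ! Suc i \<in> U" "qs ! i \<notin> U" for i
  proof -
    have "i < ?m" using that by simp
    then have "\<not> (i < y - x \<or> y - x + length ps \<le> i)" using inU[of i] that(3) by blast
    moreover have "\<not> (y - x \<le> Suc i \<and> Suc i < y - x + length ps)" using notU[of "Suc i"] that(2) by blast
    ultimately show ?thesis by linarith
  qed
  \<comment> \<open>\<open>I1\<close> holds the index before a neighbour. That index points outside
    \<open>U\<close> only at the last vertex of \<open>ps\<close>, which \<open>\<nu> x\<close>
    follows.\<close>
  then have "I1 \<union> I2 \<subseteq> insert (y - x + length ps - 1) I" by (auto simp: I1_def I2_def I_def)
  then have "card (I1 \<union> I2) \<le> card (insert (y - x + length ps - 1) I)"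
    using fI by (intro card_mono) auto
  also have "\<dots> \<le> Suc (card I)" using fI by (simp add: card_insert_if)
  finally have "card (I1 \<union> I2) \<le> Suc (card I)" .
  moreover have "card I \<le> c - 1"
  proof -
    have "qs ! i \<noteq> last qs" if "Suc i < ?m" for i
      using that D q0 nth_eq_iff_index_eq[OF D, of i "?m - 1"] by (simp add: last_conv_nth)
    then have "(\<lambda>i. qs ! i) ` I \<subseteq> U - {last qs}" by (auto simp: I_def)
    moreover have "inj_on (\<lambda>i. qs ! i) I" using D by (auto simp: inj_on_def I_def nth_eq_iff_index_eq)
    ultimately have "card I \<le> card (U - {last qs})" using finU
      by (metis card_image card_mono finite_Diff)
    moreover have "last qs \<in> U" using qs_ends by simp
    ultimately show ?thesis using cardU finU by simp
  qed
  ultimately show ?thesis using c1 c2 c3' c3 unfolding qs_ends by linarith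
qed

end

section \<open>Edges outside a longest cycle\<close>

text \<open>A walk that returns to the path built so far is cut back to that vertex.\<close>

lemma rtrancl_path:
  assumes "(x, y) \<in> {(u, v). u \<in> S \<and> v \<in> S \<and> {u, v} \<in> E}\<^sup>*" "x \<in> S"
  shows "\<exists>ps. is_path E ps \<and> ps \<noteq> [] \<and> set ps \<subseteq> S \<and> hd ps = x \<and> last ps = y"
  using assms
proof (induction rule: rtrancl_induct)
  case base
  then show ?case by (intro exI[of _ "[x]"]) auto
next
  case (step y z)
  then obtain ps where ps: "is_path E ps" "ps \<noteq> []" "set ps \<subseteq> S" "hd ps = x" "last ps = y" by auto
  show ?case
  proof (cases "z \<in> set ps")
    case True
    then obtain as bs where ab: "ps = as @ z # bs" by (metis split_list)
    have "ps = (as @ [z]) @ bs" using ab by simp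
    then have "is_path E (as @ [z])" using ps(1) is_path_append by metis
    then show ?thesis using ps ab by (intro exI[of _ "as @ [z]"]) (auto simp: hd_append split: if_splits)
  next
    case False
    then show ?thesis using ps step by (intro exI[of _ "ps @ [z]"]) (auto simp: is_path_append)
  qed
qed

text \<open>The summands fall short of \<open>a\<close> by a - s, a - s - 1, ..., 1, and
  \<open>a - s \<le> m\<close> ensures that all these deficits occur; the binomial is their
  sum.\<close>

lemma sum_min:
  fixes a s m :: nat
  assumes "1 \<le> s" "s \<le> a" "a - s \<le> m"
  shows "(\<Sum>j\<in>{1..m}. min a (s + j - 1)) + (a - s + 1 choose 2) = a * m"
  using assms(3)
proof (induction m rule: nat_induct_at_least)
  case base
  have "x \<le> a - s \<Longrightarrow> 2 * (\<Sum>j\<in>{1..x}. min a (s + j - 1)) + x = 2 * s * x + x * x" for x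
  proof (induction x)
    case (Suc x)
    then have "min a (s + Suc x - 1) = s + x" using assms(2) by simp
    then show ?case using Suc by (simp add: algebra_simps)
  qed simp
  from this[of "a - s"] obtain x where x: "a = s + x"
    "2 * (\<Sum>j\<in>{1..x}. min a (s + j - 1)) + x = 2 * s * x + x * x"
    using assms(2) by (metis le_Suc_ex add_diff_cancel_left' order_refl)
  have "2 * (x + 1 choose 2) = (x + 1) * x" by (simp add: choose2 del: binomial_Suc_Suc)
  then show ?case using x by (simp add: algebra_simps)
next
  case (Suc m)
  then have "min a (s + Suc m - 1) = a" using assms by linarith
  then show ?case using Suc by (simp add: algebra_simps)
qed

text \<open>With t = a - (r + 1), doubling turns the hypothesis into 2e + t(t + 1) + (s - 1)(c - 2a)
  \<le> c(c - 1) + (r + 1)r. Both extra terms are nonnegative, and as \<open>2 \<le> s\<close> they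
  vanish only for a = r + 1 and c = 2a.\<close>

lemma dense_outside_arith:
  fixes e c s a r :: nat
  assumes "2 \<le> s" "s \<le> a" "2 * a \<le> c" "r + 1 \<le> a"
    and e: "e + (a - s + 1 choose 2) \<le> (c - s + 1 choose 2) + (s - 1) * (c div 2) + a * r"
  shows "e \<le> (c choose 2) + (r + 1 choose 2)"
    and "e = (c choose 2) + (r + 1 choose 2) \<Longrightarrow> c = 2 * (r + 1)"
proof -
  have "2 * ((s - 1) * (c div 2)) \<le> (s - 1) * c"
    by (metis mult.left_commute mult_le_mono2 times_div_less_eq_dividend)
  then have h: "2 * int ((s - 1) * (c div 2)) \<le> (int s - 1) * int c"
  proof -
    have "int (2 * ((s - 1) * (c div 2))) \<le> int ((s - 1) * c)"
      unfolding of_nat_le_iff by fact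
    moreover have "int (s - 1) = int s - 1" using assms(1) by simp
    ultimately show ?thesis by (simp only: of_nat_mult of_nat_numeral)
  qed
  have 1: "2 * int (a - s + 1 choose 2) = (int a - int s + 1) * (int a - int s)"
    and 2: "2 * int (c - s + 1 choose 2) = (int c - int s + 1) * (int c - int s)"
    using assms by (simp_all add: choose2_int of_nat_diff del: binomial_Suc_Suc)
  have 3: "2 * int (c choose 2) = int c * (int c - 1)" by (rule choose2_int)
  have 4: "2 * int (r + 1 choose 2) = (int r + 1) * int r" by (simp add: choose2_int del: binomial_Suc_Suc)
  define t where "t = int a - (int r + 1)"
  have "2 * int e + (int a - int s + 1) * (int a - int s) \<le>
      (int c - int s + 1) * (int c - int s) + (int s - 1) * int c + 2 * (int a * int r)"
  proof -
    have "int e + int (a - s + 1 choose 2) \<le>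
        int (c - s + 1 choose 2) + int ((s - 1) * (c div 2)) + int (a * r)"
      using e unfolding of_nat_add[symmetric] of_nat_le_iff .
    then show ?thesis using h 1 2 unfolding of_nat_mult[of a r] by linarith
  qed
  then have main: "2 * int e + t * (t + 1) + (int s - 1) * (int c - 2 * int a) \<le>
      int c * (int c - 1) + (int r + 1) * int r"
    unfolding t_def by (simp add: algebra_simps)
  have t: "t \<ge> 0" using assms by (simp add: t_def)
  have p1: "t * (t + 1) \<ge> 0" using t by simp
  have p2: "(int s - 1) * (int c - 2 * int a) \<ge> 0" using assms by simp
  show "e \<le> (c choose 2) + (r + 1 choose 2)" using main p1 p2 3 4 by linarith
  show "c = 2 * (r + 1)" if "e = (c choose 2) + (r + 1 choose 2)"
  proof -
    have "2 * int e = int c * (int c - 1) + (int r + 1) * int r" using that 3 4 by linarith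
    then have "t * (t + 1) = 0" "(int s - 1) * (int c - 2 * int a) = 0" using main p1 p2 by linarith+
    then have "t = 0" "int c = 2 * int a" using t assms(1) by auto
    then show ?thesis by (simp add: t_def)
  qed
qed

context longest_cycle
begin

text \<open>Reversing \<open>ps\<close> if necessary orders the two positions as
  \<open>detoured_cycle\<close> requires.\<close>

lemma attachment_degree_sum:
  assumes ps: "is_path E ps" "ps \<noteq> []" "set ps \<inter> U = {}"
    and ij: "i < c" "j < c" "i \<noteq> j" and e: "{\<nu> i, last ps} \<in> E" "{\<nu> j, hd ps} \<in> E"
  shows "card (nbrs E U (\<nu> (Suc i))) + card (nbrs E U (\<nu> (Suc j))) \<le> c"
    and "{\<nu> (Suc i), \<nu> (Suc j)} \<notin> E"
proof -
  have "card (nbrs E U (\<nu> (Suc i))) + card (nbrs E U (\<nu> (Suc j))) \<le> c \<and>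
      {\<nu> (Suc i), \<nu> (Suc j)} \<notin> E"
  proof (cases "i < j")
    case True
    then interpret detoured_cycle V E c \<nu> ps i j using assms by unfold_locales auto
    show ?thesis using succ_degree_sum succ_nonadjacent by auto
  next
    case False
    then interpret detoured_cycle V E c \<nu> "rev ps" j i
      using assms by unfold_locales (auto simp: hd_rev last_rev)
    show ?thesis using succ_degree_sum succ_nonadjacent by (auto simp: insert_commute)
  qed
  then show "card (nbrs E U (\<nu> (Suc i))) + card (nbrs E U (\<nu> (Suc j))) \<le> c"
    and "{\<nu> (Suc i), \<nu> (Suc j)} \<notin> E" by auto
qed

text \<open>The case that \<open>extension_bound\<close> cannot settle by deletion: every vertex of
  \<open>R\<close> has more than \<open>card R\<close> neighbours. The equality clause starts the
  characterisation of the join.\<close>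

lemma dense_outside:
  assumes R: "R \<subseteq> V - U" "R \<noteq> {}"
    and deg: "\<And>v. v \<in> R \<Longrightarrow> card R + 1 \<le> card (nbrs E (U \<union> R) v)"
  shows "ecount E (U \<union> R) \<le> (c choose 2) + (card R + 1 choose 2)"
    and "ecount E (U \<union> R) = (c choose 2) + (card R + 1 choose 2) \<Longrightarrow> c = 2 * (card R + 1)"
proof -
  have finR: "finite R" using R finV by (auto intro: finite_subset)
  txt \<open>\<open>R'\<close> is chosen of maximum size for the maximum \<open>a\<close>, so that all of \<open>R\<close> can be peeled down
    to \<open>R'\<close> and \<open>R'\<close> down to the empty set with degrees at most \<open>a\<close>.\<close>
  define mind where "mind a S \<longleftrightarrow> S \<subseteq> R \<and> S \<noteq> {} \<and> (\<forall>v\<in>S. a \<le> card (nbrs E (U \<union> S) v))" for a S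
  have mR: "mind (card R + 1) R" using R deg by (simp add: mind_def)
  have "a \<le> card V" if S: "mind a S" for a S
  proof -
    obtain v where "v \<in> S" "a \<le> card (nbrs E (U \<union> S) v)" using S unfolding mind_def by blast
    moreover have "card (nbrs E (U \<union> S) v) \<le> card V"
      using edgeD finV by (intro card_mono) (auto simp: nbrs_def)
    ultimately show ?thesis by simp
  qed
  then have "\<forall>a. (\<exists>S. mind a S) \<longrightarrow> a < Suc (card V)" by (auto simp: less_Suc_eq_le)
  then obtain a where a: "\<exists>S. mind a S" and amax: "\<And>b S. mind b S \<Longrightarrow> b \<le> a"
    using ex_has_greatest_nat[of "\<lambda>a. \<exists>S. mind a S" "card R + 1" "\<lambda>a. a" "Suc (card V)"] mR by blast
  then obtain S0 where "mind a S0" by auto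
  moreover have "\<forall>S. mind a S \<longrightarrow> card S < Suc (card R)"
    using finR by (auto simp: mind_def less_Suc_eq_le intro: card_mono)
  ultimately obtain R' where R': "mind a R'" and R'max: "\<And>S. mind a S \<Longrightarrow> card S \<le> card R'"
    using ex_has_greatest_nat[of "mind a" S0 card "Suc (card R)"] by blast
  have ra: "card R + 1 \<le> a" using amax mR by blast
  have R'R: "R' \<subseteq> R" "R' \<noteq> {}" and R'deg: "\<And>v. v \<in> R' \<Longrightarrow> a \<le> card (nbrs E (U \<union> R') v)"
    using R' by (auto simp: mind_def)
  have finR': "finite R'" and cR': "card R' \<le> card R"
    using R'R finR by (auto intro: finite_subset card_mono)
  have R'V: "R' \<subseteq> V - U" using R R'R by blast
  have ac: "2 * a \<le> c"
    using outside_degree[OF R'V R'R(2) R'deg] ra cR' by simp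
  have D: "\<exists>v\<in>Y. card (nbrs E (U \<union> Y) v) \<le> a" if "Y \<subseteq> R" "Y \<noteq> {}" for Y
  proof (rule ccontr)
    assume "\<not> ?thesis"
    then have "mind (Suc a) Y" using that by (auto simp: mind_def not_le Suc_le_eq)
    then show False using amax by fastforce
  qed
  have D2: "\<exists>v\<in>Y. card (nbrs E ((U \<union> R') \<union> Y) v) \<le> a" if "Y \<subseteq> R - R'" "Y \<noteq> {}" for Y
  proof (rule ccontr)
    assume n: "\<not> ?thesis"
    have "a \<le> card (nbrs E (U \<union> (R' \<union> Y)) v)" if "v \<in> R' \<union> Y" for v
    proof (cases "v \<in> R'")
      case True
      have "card (nbrs E (U \<union> R') v) \<le> card (nbrs E (U \<union> (R' \<union> Y)) v)"
        by (rule nbrs_mono) auto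
      then show ?thesis using R'deg[OF True] by simp
    qed (use that n in \<open>auto simp: Un_assoc not_le\<close>)
    then have "mind a (R' \<union> Y)" using that R'R by (auto simp: mind_def)
    then have "card (R' \<union> Y) \<le> card R'" by (rule R'max)
    moreover have "finite Y" using that finR by (auto intro: finite_subset)
    moreover have "R' \<inter> Y = {}" using that by auto
    ultimately show False using that finR' by (simp add: card_Un_disjoint)
  qed
  define rel where "rel = {(u, v). u \<in> R' \<and> v \<in> R' \<and> {u, v} \<in> E}"
  have rel_sym: "sym (rel\<^sup>*)" by (rule sym_rtrancl) (auto simp: sym_def rel_def insert_commute)
  have rel_in: "y \<in> R'" if "(x, y) \<in> rel\<^sup>*" "x \<in> R'" for x y
    using that by (induction rule: rtrancl_induct) (auto simp: rel_def)
  \<comment> \<open>The neighbours on the cycle of the whole component of \<open>x\<close>: any two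
    of them are joined through \<open>R'\<close>, so \<open>attachment_degree_sum\<close> applies to
    their successors.\<close>
  define N where "N x = {u \<in> U. \<exists>y. (x, y) \<in> rel\<^sup>* \<and> {u, y} \<in> E}" for x
  have fN: "finite (N x)" for x using finU by (simp add: N_def)
  \<comment> \<open>For the component with most attachments a single number serves two ends: it
    yields that many successors, and it bounds the neighbours on the cycle of every vertex of
    \<open>R'\<close>.\<close>
  obtain x where x: "x \<in> R'" and xmax: "\<And>y. y \<in> R' \<Longrightarrow> card (N y) \<le> card (N x)"
  proof -
    let ?M = "(\<lambda>y. card (N y)) ` R'"
    have "Max ?M \<in> ?M" using finR' R'R(2) by (intro Max_in) auto
    then obtain x where "x \<in> R'" "card (N x) = Max ?M" by fastforce
    moreover have "card (N y) \<le> Max ?M" if "y \<in> R'" for y using finR' that by (intro Max_ge) auto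
    ultimately show thesis using that by auto
  qed
  have UR': "U \<inter> R' = {}" using R'V by auto
  have nN: "card (nbrs E U v) \<le> card (N x)" if "v \<in> R'" for v
  proof -
    have "nbrs E U v \<subseteq> N v" by (auto simp: nbrs_def N_def)
    then show ?thesis using xmax[OF that] fN by (meson card_mono le_trans)
  qed
  have xdeg: "a \<le> card (nbrs E U x) + (card R' - 1)"
    using R'deg[OF x] nbrs_union[OF UR', of x] nbrs_le[OF finR' x] by linarith
  have R'1: "1 \<le> card R'" using finR' R'R(2) by (simp add: Suc_le_eq card_gt_0_iff)
  \<comment> \<open>The cap at \<open>a\<close> loses nothing when \<open>R'\<close> is peeled,
    where degrees are at most \<open>a\<close> anyway, and it provides \<open>s \<le> a\<close> for
    the arithmetic.\<close>
  define s where "s = min (card (N x)) a"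
  have s2: "2 \<le> s" using xdeg nN[OF x] ra cR' R'1 by (auto simp: s_def)
  have sa: "s \<le> a" and sm: "a - s \<le> card R'"
    using xdeg nN[OF x] by (auto simp: s_def)
  obtain Z where Z: "Z \<subseteq> N x" "card Z = s" "finite Z"
    using obtain_subset_with_card_n[of s "N x"] by (auto simp: s_def)
  have "\<forall>z\<in>Z. \<exists>i<c. \<nu> i = z"
    using Z(1) cycfun_range[OF cyc, of 0] by (force simp: N_def image_iff)
  then obtain pos where pos: "\<And>z. z \<in> Z \<Longrightarrow> pos z < c \<and> \<nu> (pos z) = z" by metis
  define sc where "sc z = \<nu> (Suc (pos z))" for z
  have sc_inj: "inj_on sc Z"
  proof (rule inj_onI)
    fix z z' assume z: "z \<in> Z" "z' \<in> Z" "sc z = sc z'"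
    have "Suc (pos z) = Suc (pos z')"
      by (rule inj_onD[OF cycfun_inj[OF cyc, of 1]]) (use z pos in \<open>auto simp: sc_def\<close>)
    then show "z = z'" using pos z by (metis Suc_inject)
  qed
  have pair: "card (nbrs E U (sc z)) + card (nbrs E U (sc z')) \<le> c"
    if z: "z \<in> Z" "z' \<in> Z" "z \<noteq> z'" for z z'
  proof -
    have "z \<in> N x" "z' \<in> N x" using z Z(1) by blast+
    then obtain y y' where y: "(x, y) \<in> rel\<^sup>*" "{z, y} \<in> E" "(x, y') \<in> rel\<^sup>*" "{z', y'} \<in> E"
      unfolding N_def by blast
    then have "(y', y) \<in> rel\<^sup>*" using rel_sym by (meson rtrancl_trans symD)
    then obtain ps where ps: "is_path E ps" "ps \<noteq> []" "set ps \<subseteq> R'" "hd ps = y'" "last ps = y"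
      using rtrancl_path[of y' y R' E] rel_in[OF y(3) x] unfolding rel_def by blast
    have ne: "pos z \<noteq> pos z'" using pos z by metis
    show ?thesis unfolding sc_def
      by (rule attachment_degree_sum(1)[of ps]) (use ne ps UR' pos z y in auto)
  qed
  \<comment> \<open>Two successors of degree above c/2 would contradict \<open>pair\<close>. The
    single possible exception is the loss from \<open>s\<close> to \<open>s - 1\<close>.\<close>
  define L0 where "L0 = {z \<in> Z. 2 * card (nbrs E U (sc z)) \<le> c}"
  have "card (Z - L0) \<le> 1"
  proof (rule ccontr)
    assume "\<not> ?thesis"
    then obtain z z' where "z \<in> Z - L0" "z' \<in> Z - L0" "z \<noteq> z'"
      using card_le_Suc0_iff_eq[of "Z - L0"] Z(3) by auto
    then show False using pair[of z z'] by (auto simp: L0_def)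
  qed
  moreover have "card L0 + card (Z - L0) = s"
    using Z by (subst card_Un_disjoint[symmetric]) (auto simp: L0_def intro!: arg_cong[of _ _ card] finite_subset[of _ Z])
  ultimately have "s - 1 \<le> card (sc ` L0)"
    using sc_inj by (subst card_image) (auto simp: L0_def inj_on_def)
  then obtain L where L: "L \<subseteq> sc ` L0" "card L = s - 1" "finite L"
    using obtain_subset_with_card_n by metis
  have LU: "L \<subseteq> U" and Ldeg: "\<And>v. v \<in> L \<Longrightarrow> card (nbrs E U v) \<le> c div 2"
    using L by (auto simp: L0_def sc_def)
  have "ecount E ((U - L) \<union> L) \<le> ecount E (U - L) + (\<Sum>j\<in>{1..card L}. c div 2)"
  proof (rule peel)
    show "\<exists>v\<in>Y. card (nbrs E ((U - L) \<union> Y) v) \<le> c div 2" if Y: "Y \<subseteq> L" "Y \<noteq> {}" for Y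
    proof -
      obtain v where "v \<in> Y" using Y by auto
      moreover from this have "card (nbrs E ((U - L) \<union> Y) v) \<le> c div 2"
        using Ldeg[of v] nbrs_mono[of "(U - L) \<union> Y" U v] LU Y by (meson Diff_subset Un_least le_trans subsetD subset_trans)
      ultimately show ?thesis by auto
    qed
  qed (use L in auto)
  moreover have "(U - L) \<union> L = U" using LU by auto
  moreover have "card (U - L) = c - s + 1"
    using LU L cardU finU s2 sa ac by (simp add: card_Diff_subset)
  then have "ecount E (U - L) \<le> (c - s + 1 choose 2)" using ecount_le[of "U - L"] finU by simp
  ultimately have eU: "ecount E U \<le> (c - s + 1 choose 2) + (s - 1) * (c div 2)"
    using L(2) by simp
  \<comment> \<open>Two bounds meet: \<open>a\<close> by its maximality, and
    \<open>card (N x)\<close> neighbours on the cycle plus \<open>card Y - 1\<close> in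
    \<open>Y\<close>. The second one is the better while \<open>Y\<close> is small.\<close>
  have "ecount E (U \<union> R') \<le> ecount E U + (\<Sum>j\<in>{1..card R'}. min a (s + j - 1))"
  proof (rule peel)
    fix Y assume Y: "Y \<subseteq> R'" "Y \<noteq> {}"
    have fY: "finite Y" using Y finR' finite_subset by auto
    obtain v where v: "v \<in> Y" "card (nbrs E (U \<union> Y) v) \<le> a" using D[of Y] Y R'R by auto
    have UY: "U \<inter> Y = {}" and vR': "v \<in> R'" using UR' Y v by auto
    have "card (nbrs E (U \<union> Y) v) \<le> card (N x) + (card Y - 1)"
      using nbrs_union[OF UY, of v] nbrs_le[OF fY v(1)] nN[OF vR'] by linarith
    moreover have "1 \<le> card Y" using fY Y by (simp add: Suc_le_eq card_gt_0_iff)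
    ultimately have "card (nbrs E (U \<union> Y) v) \<le> min a (s + card Y - 1)" using v(2) by (auto simp: s_def)
    then show "\<exists>v\<in>Y. card (nbrs E (U \<union> Y) v) \<le> min a (s + card Y - 1)" using v by auto
  qed (use UR' finR' in auto)
  moreover have "(\<Sum>j\<in>{1..card R'}. min a (s + j - 1)) + (a - s + 1 choose 2) = a * card R'"
    using sum_min[of s a "card R'"] s2 sa sm by linarith
  moreover have "ecount E ((U \<union> R') \<union> (R - R')) \<le> ecount E (U \<union> R') + (\<Sum>j\<in>{1..card (R - R')}. a)"
    by (rule peel) (use D2 finR R in auto)
  moreover have "(U \<union> R') \<union> (R - R') = U \<union> R" using R'R by auto
  moreover have "card (R - R') = card R - card R'" using R'R finR' by (simp add: card_Diff_subset)
  moreover have "a * card R' + (card R - card R') * a = a * card R"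
    using cR' by (metis add_mult_distrib2 le_add_diff_inverse mult.commute)
  ultimately have "ecount E (U \<union> R) + (a - s + 1 choose 2) \<le>
      (c - s + 1 choose 2) + (s - 1) * (c div 2) + a * card R" using eU by simp
  from dense_outside_arith[OF s2 sa ac ra this]
  show "ecount E (U \<union> R) \<le> (c choose 2) + (card R + 1 choose 2)"
    and "ecount E (U \<union> R) = (c choose 2) + (card R + 1 choose 2) \<Longrightarrow> c = 2 * (card R + 1)" .
qed

end

lemma choose2_Suc: "(Suc m choose 2) = (m choose 2) + m"
  by (simp add: numeral_2_eq_2)

text \<open>The second binomial grows by r when \<open>R\<close> gains its r-th vertex, so a vertex
  of degree at most \<open>card R\<close> can be removed; without such a vertex
  \<open>dense_outside\<close> applies.\<close>

lemma (in longest_cycle) extension_bound: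
  assumes "R \<subseteq> V - U"
  shows "ecount E (U \<union> R) \<le> (c choose 2) + (card R + 1 choose 2)"
  using assms
proof (induction "card R" arbitrary: R)
  case 0
  then have "R = {}" using finV by (metis card_0_eq finite_Diff finite_subset)
  then show ?case using ecount_le[OF finU] cardU by simp
next
  case (Suc m)
  have finR: "finite R" using Suc.prems finV by (auto intro: finite_subset)
  show ?case
  proof (cases "\<exists>v\<in>R. card (nbrs E (U \<union> R) v) \<le> card R")
    case True
    then obtain v where v: "v \<in> R" "card (nbrs E (U \<union> R) v) \<le> card R" by auto
    let ?R = "R - {v}"
    have c: "card R = Suc (card ?R)" using v(1) finR by (metis card_Suc_Diff1)
    have "ecount E (U \<union> ?R) \<le> (c choose 2) + (card ?R + 1 choose 2)"
      using Suc c by (intro Suc.hyps(1)) auto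
    moreover have "U \<union> R = insert v (U \<union> ?R)" "v \<notin> U \<union> ?R" using v Suc.prems by auto
    then have "ecount E (U \<union> R) = ecount E (U \<union> ?R) + card (nbrs E (U \<union> ?R) v)"
      by (simp add: ecount_insert)
    moreover have "card (nbrs E (U \<union> ?R) v) \<le> card (nbrs E (U \<union> R) v)" by (rule nbrs_mono) auto
    ultimately show ?thesis using v(2) c choose2_Suc[of "card R"] by simp
  next
    case False
    then show ?thesis using Suc.prems Suc.hyps(2)
      by (intro dense_outside(1)) (auto simp: not_le Suc_le_eq)
  qed
qed

section \<open>Hamiltonian graphs with a missing cycle length\<close>

locale missing_length = sgraph V E for V :: "'a set" and E +
  fixes c l :: nat and \<nu> :: "nat \<Rightarrow> 'a"
  assumes cyc: "cycfun E c \<nu>" and l: "3 \<le> l" "l < c"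
    and missing: "\<And>xs. is_cyc E xs \<Longrightarrow> length xs \<noteq> l"
begin

abbreviation U where "U \<equiv> range \<nu>"

lemma per [simp]: "\<nu> (i + c) = \<nu> i" and step: "{\<nu> i, \<nu> (Suc i)} \<in> E"
  using cyc by (auto simp: cycfun_def)

lemma finU: "finite U"
  using finite_cycfun[OF cyc] .

text \<open>Chords from \<open>\<nu> (i + 1)\<close> to \<open>\<nu> (i + j)\<close> and from \<open>\<nu> i\<close> to \<open>\<nu> (i + \<phi> j)\<close> would close a
  cycle of length \<open>l\<close>.\<close>

definition \<phi> where "\<phi> j = (if j \<le> c + 2 - l then j + l - 3 else j - (c + 1 - l))"

lemma \<phi>_in: "j \<in> {2..c - 1} \<Longrightarrow> \<phi> j \<in> {2..c - 1}"
  using l by (auto simp: \<phi>_def)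

lemma \<phi>_inj: "inj_on \<phi> {2..c - 1}"
  using l by (auto simp: \<phi>_def inj_on_def split: if_splits)

text \<open>For \<open>j \<le> c + 2 - l\<close> the cycle consists of \<open>\<nu> (i + 1)\<close>,
  the arc of \<open>l - 2\<close> vertices from \<open>\<nu> (i + j)\<close> forward to
  \<open>\<nu> (i + \<phi> j)\<close>, and \<open>\<nu> i\<close>. For larger \<open>j\<close> that
  arc would run into \<open>\<nu> i\<close>; instead the arc from \<open>\<nu> (i + 1)\<close> to
  \<open>\<nu> (i + \<phi> j)\<close> is joined with the one from \<open>\<nu> (i + j)\<close> to
  \<open>\<nu> (i + c)\<close>, and \<open>\<phi> j + (c + 1 - j) = l\<close>.\<close>

lemma \<phi>_conflict:
  assumes "j \<in> {2..c - 1}" "{\<nu> (i + 1), \<nu> (i + j)} \<in> E"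
  shows "{\<nu> i, \<nu> (i + \<phi> j)} \<notin> E"
proof
  assume e: "{\<nu> i, \<nu> (i + \<phi> j)} \<in> E"
  show False
  proof (cases "j \<le> c + 2 - l")
    case True
    define as bs ds where "as = map \<nu> [i + 1..<i + 2]" and "bs = map \<nu> [i + j..<i + j + l - 2]"
      and "ds = map \<nu> [i + c..<i + c + 1]"
    have p: "is_path E as" "is_path E bs" "is_path E ds" unfolding as_def bs_def ds_def
      using l True by (auto intro!: cycfun_arc[OF cyc] simp del: upt_Suc)
    have d1: "set as \<inter> set bs = {}" unfolding as_def bs_def set_map set_upt
      by (rule disjoint_arcs[OF cyc]) (use l True assms in auto)
    have d2: "set bs \<inter> set ds = {}" unfolding bs_def ds_def set_map set_upt
      by (rule disjoint_arcs[OF cyc]) (use l True assms in auto)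
    have d3: "set as \<inter> set ds = {}" unfolding as_def ds_def set_map set_upt
      by (rule disjoint_arcs[OF cyc]) (use l True assms in auto)
    note d = d1 d2 d3
    have ne: "as \<noteq> []" "bs \<noteq> []" "ds \<noteq> []" using l by (auto simp: as_def bs_def ds_def)
    have "i + j + l - 2 = Suc (i + \<phi> j)" using l assms True by (auto simp: \<phi>_def)
    then have h: "hd as = \<nu> (i + 1)" "last as = \<nu> (i + 1)" "hd bs = \<nu> (i + j)"
      "last bs = \<nu> (i + \<phi> j)" "hd ds = \<nu> i" "last ds = \<nu> i"
      using l \<open>j \<le> c + 2 - l\<close>
      by (simp_all add: as_def bs_def ds_def hd_arc last_arc \<phi>_def del: upt_Suc)
    have "is_path E (as @ bs @ ds)" using p d ne h assms e
      by (auto simp: is_path_append insert_commute)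
    moreover have "length (as @ bs @ ds) = l" using l by (simp add: as_def bs_def ds_def)
    ultimately have "is_cyc E (as @ bs @ ds)" using l step[of i] ne h by (simp add: is_cyc_def)
    from missing[OF this] show False using \<open>length (as @ bs @ ds) = l\<close> by simp
  next
    case False
    define as bs where "as = map \<nu> [i + 1..<i + \<phi> j + 1]" and "bs = map \<nu> [i + j..<i + c + 1]"
    have t: "\<phi> j = j - (c + 1 - l)" "\<phi> j < j" "2 \<le> \<phi> j" using False l by (auto simp: \<phi>_def)
    have p: "is_path E as" "is_path E bs" unfolding as_def bs_def
      using l t assms by (auto intro!: cycfun_arc[OF cyc] simp del: upt_Suc)
    have d: "set as \<inter> set bs = {}" unfolding as_def bs_def set_map set_upt
      using l t assms by (intro disjoint_arcs[OF cyc]) auto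
    have ne: "as \<noteq> []" "bs \<noteq> []" using t assms by (auto simp: as_def bs_def)
    have h: "hd as = \<nu> (i + 1)" "last as = \<nu> (i + \<phi> j)" "hd bs = \<nu> (i + j)" "last bs = \<nu> i"
      using t(2,3) assms(1) by (simp_all add: as_def bs_def hd_arc last_arc del: upt_Suc)
    have "is_path E (as @ rev bs)" using p d ne h e
      by (auto simp: is_path_append hd_rev insert_commute)
    moreover have len: "length (as @ rev bs) = l" using l t assms False by (auto simp: as_def bs_def)
    ultimately have "is_cyc E (as @ rev bs)" using l assms ne h
      by (simp add: is_cyc_def last_rev insert_commute)
    from missing[OF this] show False using len by simp
  qed
qed

lemma window_nbrs: "card {x \<in> {m..<m + c}. {\<nu> x, v} \<in> E} = card (nbrs E U v)"
proof -
  have "nbrs E U v \<inter> U = nbrs E U v" by (auto simp: nbrs_def)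
  then show ?thesis using cycfun_card[OF cyc, of m "nbrs E U v"] by (simp add: nbrs_def)
qed

text \<open>The offsets 1 and \<open>c\<close> are left out here and in \<open>Q\<close>: one of
  them is the vertex itself, the other the edge between \<open>\<nu> i\<close> and
  \<open>\<nu> (i + 1)\<close>. Hence the \<open>+ 1\<close> in \<open>deg_P\<close> and
  \<open>deg_Q\<close>, and hence a range that \<open>\<phi>\<close> maps to itself.\<close>

definition P where "P i = {j \<in> {2..c - 1}. {\<nu> (i + 1), \<nu> (i + j)} \<in> E}"
definition Q where "Q i = {j \<in> {2..c - 1}. {\<nu> i, \<nu> (i + j)} \<in> E}"

lemma finPQ: "finite (P i)" "finite (Q i)"
  by (auto simp: P_def Q_def)

lemma deg_P: "card (nbrs E U (\<nu> (i + 1))) \<le> card (P i) + 1"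
proof -
  have "{x \<in> {i + 1..<i + 1 + c}. {\<nu> x, \<nu> (i + 1)} \<in> E} \<subseteq> (\<lambda>j. i + j) ` insert c (P i)"
  proof
    fix x assume x: "x \<in> {x \<in> {i + 1..<i + 1 + c}. {\<nu> x, \<nu> (i + 1)} \<in> E}"
    then have "x \<noteq> i + 1" using no_loop by auto
    then have "x - i \<in> insert c (P i)" using x by (auto simp: P_def insert_commute)
    then show "x \<in> (\<lambda>j. i + j) ` insert c (P i)" using x by (intro image_eqI[of _ _ "x - i"]) auto
  qed
  then have "card (nbrs E U (\<nu> (i + 1))) \<le> card ((\<lambda>j. i + j) ` insert c (P i))"
    unfolding window_nbrs[of "i + 1", symmetric] using finPQ by (intro card_mono) auto
  also have "\<dots> \<le> card (insert c (P i))" using finPQ by (intro card_image_le) auto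
  also have "\<dots> \<le> card (P i) + 1" using finPQ by (simp add: card_insert_if)
  finally show ?thesis .
qed

lemma deg_Q: "card (nbrs E U (\<nu> i)) \<le> card (Q i) + 1"
proof -
  have "{x \<in> {i + 1..<i + 1 + c}. {\<nu> x, \<nu> i} \<in> E} \<subseteq> (\<lambda>j. i + j) ` insert 1 (Q i)"
  proof
    fix x assume x: "x \<in> {x \<in> {i + 1..<i + 1 + c}. {\<nu> x, \<nu> i} \<in> E}"
    then have "x \<noteq> i + c" using no_loop by auto
    then have "x - i \<in> insert 1 (Q i)" using x by (auto simp: Q_def insert_commute)
    then show "x \<in> (\<lambda>j. i + j) ` insert 1 (Q i)" using x by (intro image_eqI[of _ _ "x - i"]) auto
  qed
  then have "card (nbrs E U (\<nu> i)) \<le> card ((\<lambda>j. i + j) ` insert 1 (Q i))"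
    unfolding window_nbrs[of "i + 1", symmetric] using finPQ by (intro card_mono) auto
  also have "\<dots> \<le> card (insert 1 (Q i))" using finPQ by (intro card_image_le) auto
  also have "\<dots> \<le> card (Q i) + 1" using finPQ by (simp add: card_insert_if)
  finally show ?thesis .
qed

lemma PQ: "\<phi> ` P i \<inter> Q i = {}" "\<phi> ` P i \<union> Q i \<subseteq> {2..c - 1}"
    "card (\<phi> ` P i \<union> Q i) = card (P i) + card (Q i)"
proof -
  show 1: "\<phi> ` P i \<inter> Q i = {}" using \<phi>_conflict by (auto simp: P_def Q_def)
  show "\<phi> ` P i \<union> Q i \<subseteq> {2..c - 1}" using \<phi>_in unfolding P_def Q_def by blast
  have "card (\<phi> ` P i) = card (P i)"
    by (intro card_image inj_on_subset[OF \<phi>_inj]) (auto simp: P_def)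
  then show "card (\<phi> ` P i \<union> Q i) = card (P i) + card (Q i)"
    using 1 finPQ by (simp add: card_Un_disjoint)
qed

text \<open>\<open>\<phi>\<close> sends the chords at \<open>\<nu> (i + 1)\<close> injectively to
  non-chords at \<open>\<nu> i\<close> among \<open>c - 2\<close> offsets; the edge between the two
  vertices adds 1 to each degree.\<close>

lemma consecutive_degrees: "card (nbrs E U (\<nu> i)) + card (nbrs E U (\<nu> (i + 1))) \<le> c"
proof -
  have "card (\<phi> ` P i \<union> Q i) \<le> card {2..c - 1}" by (intro card_mono PQ) simp
  then show ?thesis using deg_P[of i] deg_Q[of i] PQ(3)[of i] l by simp
qed

text \<open>If the degree sum reaches \<open>c\<close>, the image of \<open>P i\<close> under
  \<open>\<phi>\<close> and \<open>Q i\<close> together fill all offsets, so a missing chord forces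
  its partner.\<close>

lemma \<phi>_tight:
  assumes "c \<le> card (nbrs E U (\<nu> i)) + card (nbrs E U (\<nu> (i + 1)))"
    and j: "j \<in> {2..c - 1}" "{\<nu> (i + 1), \<nu> (i + j)} \<notin> E"
  shows "{\<nu> i, \<nu> (i + \<phi> j)} \<in> E"
proof -
  have "card {2..c - 1} \<le> card (\<phi> ` P i \<union> Q i)"
    using assms(1) deg_P[of i] deg_Q[of i] PQ(3)[of i] by simp
  then have "\<phi> ` P i \<union> Q i = {2..c - 1}" using PQ(2) by (intro card_seteq) auto
  moreover have "\<phi> j \<notin> \<phi> ` P i" 
  proof
    assume "\<phi> j \<in> \<phi> ` P i"
    then obtain j' where "j' \<in> P i" "\<phi> j = \<phi> j'" by auto
    then have "j \<in> P i" using inj_onD[OF \<phi>_inj, of j j'] j(1) by (auto simp: P_def)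
    then show False using j by (simp add: P_def)
  qed
  ultimately show ?thesis using \<phi>_in[OF j(1)] unfolding Q_def by blast
qed

lemma sum_window: "(\<Sum>x\<in>{m..<m + c}. g (\<nu> x)) = (\<Sum>v\<in>U. g v)"
  unfolding cycfun_range[OF cyc, of m] using cycfun_inj[OF cyc, of m] by (simp add: sum.reindex)

text \<open>Summed around the cycle, \<open>consecutive_degrees\<close> counts every degree twice
  and so every edge four times.\<close>

lemma hamiltonian_ecount: "4 * ecount E U \<le> c * c"
proof -
  let ?d = "\<lambda>v. card (nbrs E U v)"
  have "(\<Sum>i\<in>{0..<c}. ?d (\<nu> i) + ?d (\<nu> (i + 1))) \<le> (\<Sum>i\<in>{0..<c}. c)"
    by (intro sum_mono consecutive_degrees)
  moreover have "(\<Sum>i\<in>{0..<c}. ?d (\<nu> (i + 1))) = (\<Sum>v\<in>U. ?d v)"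
    using sum_window[of ?d 1] sum.shift_bounds_Suc_ivl[of "\<lambda>x. ?d (\<nu> x)" 0 c] by simp
  moreover have "(\<Sum>i\<in>{0..<c}. ?d (\<nu> i)) = (\<Sum>v\<in>U. ?d v)" using sum_window[of ?d 0] by simp
  ultimately show ?thesis using handshake[OF finU] by (simp add: sum.distrib)
qed

text \<open>All consecutive degree sums are tight, so \<open>\<phi>\<close> decides chord by chord:
  chords over distance 2t + 1 exclude those over m + 2t + 1, and their absence forces those over 2t
  + 3. Distances above \<open>m\<close> are read from the other end.\<close>

lemma alternating:
  assumes c: "c = 2 * m" "l = m + 2" and m: "odd m"
    and deg: "\<And>i. m \<le> card (nbrs E U (\<nu> i))" and s: "odd s" "s < c"
  shows "{\<nu> i, \<nu> (i + s)} \<in> E"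
proof -
  have tight: "c \<le> card (nbrs E U (\<nu> i)) + card (nbrs E U (\<nu> (i + 1)))" for i
    using deg[of i] deg[of "i + 1"] c by simp
  have odds: "2 * t + 1 \<le> m \<Longrightarrow> {\<nu> i, \<nu> (i + (2 * t + 1))} \<in> E" for t i
  proof (induction t arbitrary: i)
    case 0
    then show ?case using step by simp
  next
    case (Suc t)
    have no: "{\<nu> i, \<nu> (i + (m + 2 * t + 1))} \<notin> E" for i
    proof -
      have "{\<nu> (i + 1), \<nu> (i + (2 * t + 2))} \<in> E" using Suc.IH[of "i + 1"] Suc.prems by simp
      then have "{\<nu> i, \<nu> (i + \<phi> (2 * t + 2))} \<notin> E" using Suc.prems c by (intro \<phi>_conflict) auto
      moreover have "\<phi> (2 * t + 2) = m + 2 * t + 1" unfolding \<phi>_def using Suc.prems c by simp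
      ultimately show ?thesis by simp
    qed
    have "{\<nu> (i + 1), \<nu> (i + (m + 2 * t + 2))} \<notin> E" using no[of "i + 1"] by (simp add: add_ac)
    then have "{\<nu> i, \<nu> (i + \<phi> (m + 2 * t + 2))} \<in> E" using Suc.prems c by (intro \<phi>_tight tight) auto
    moreover have "\<phi> (m + 2 * t + 2) = 2 * Suc t + 1" unfolding \<phi>_def using Suc.prems c by simp
    ultimately show ?case by simp
  qed
  show ?thesis
  proof (cases "s \<le> m")
    case True
    then show ?thesis using odds s by (metis oddE)
  next
    case False
    have "odd (c - s)" using s c by (simp add: even_diff_nat)
    then obtain t where t: "c - s = 2 * t + 1" by (elim oddE)
    then have "{\<nu> (i + s), \<nu> (i + s + (2 * t + 1))} \<in> E" using False c by (intro odds) linarith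
    moreover have "i + s + (2 * t + 1) = i + c" using t s by linarith
    ultimately show ?thesis using per[of i] by (metis insert_commute)
  qed
qed

end

text \<open>Putting back a vertex of degree below half of the new order n adds at most 2n - 2 to the
  left side, while the square grows by 2n - 1. The extra summand records this slack, so that
  equality later forces \<open>R = {}\<close>.\<close>

lemma (in longest_cycle) missing_length_ecount:
  assumes l: "3 \<le> l" "l < c" and missing: "\<And>xs. is_cyc E xs \<Longrightarrow> length xs \<noteq> l"
    and R: "R \<subseteq> V - U" "card R < c"
  shows "4 * ecount E (U \<union> R) + (if R = {} then 0 else 1) \<le> (c + card R)\<^sup>2"
  using R
proof (induction "card R" arbitrary: R)
  case 0
  interpret ml: missing_length V E c l \<nu> using cyc l missing by unfold_locales auto
  have "R = {}" using 0 finV by (metis card_0_eq finite_Diff finite_subset)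
  then show ?case using ml.hamiltonian_ecount by (simp add: power2_eq_square)
next
  case (Suc m)
  have finR: "finite R" and ne: "R \<noteq> {}" using Suc finV by (auto intro: finite_subset)
  have "\<exists>v\<in>R. 2 * card (nbrs E (U \<union> R) v) < c + card R"
  proof (rule ccontr)
    assume n: "\<not> ?thesis"
    \<comment> \<open>Half of the current order, rounded up; \<open>card R < c\<close> makes it at
      least \<open>card R + 1\<close>, as \<open>outside_degree\<close> requires.\<close>
    have "2 * ((c + card R + 1) div 2) \<le> c"
    proof (rule outside_degree[OF Suc.prems(1) ne])
      show "(c + card R + 1) div 2 \<le> card (nbrs E (U \<union> R) v)" if "v \<in> R" for v
      proof -
        have "c + card R \<le> 2 * card (nbrs E (U \<union> R) v)" using n that by (auto simp: not_less)
        then show ?thesis by linarith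
      qed
      show "card R + 1 \<le> (c + card R + 1) div 2" using Suc.prems by linarith
    qed
    then show False using Suc.hyps(2) by linarith
  qed
  then obtain v where v: "v \<in> R" "2 * card (nbrs E (U \<union> R) v) < c + card R" by auto
  let ?R = "R - {v}"
  have cR: "card R = Suc (card ?R)" using v(1) finR by (metis card_Suc_Diff1)
  have IH: "4 * ecount E (U \<union> ?R) + (if ?R = {} then 0 else 1) \<le> (c + card ?R)\<^sup>2"
    using Suc cR by (intro Suc.hyps(1)) auto
  have "U \<union> R = insert v (U \<union> ?R)" "v \<notin> U \<union> ?R" using v Suc.prems by auto
  then have "ecount E (U \<union> R) = ecount E (U \<union> ?R) + card (nbrs E (U \<union> ?R) v)"
    by (simp add: ecount_insert)
  moreover have "card (nbrs E (U \<union> ?R) v) \<le> card (nbrs E (U \<union> R) v)" by (rule nbrs_mono) auto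
  moreover have "(c + card R)\<^sup>2 = (c + card ?R)\<^sup>2 + 2 * (c + card ?R) + 1"
    unfolding cR by (simp add: power2_eq_square algebra_simps)
  ultimately show ?case using IH v(2) ne cR by (auto split: if_splits)
qed

section \<open>The case of equality\<close>

context longest_cycle
begin

text \<open>Needed to discard graphs such as the join of \<open>K\<^sub>2\<close> with three copies of \<open>K\<^bsub>k-1\<^esub>\<close>,
  which have \<open>3k - 1\<close> vertices, circumference \<open>2k\<close> and minimum degree \<open>k\<close> like \<open>H\<^sub>1(3k - 1, k)\<close>.\<close>

lemma antipodal_attachment:
  assumes c: "c = 2 * k" and ps: "is_path E ps" "length ps = k - 1" "set ps \<inter> U = {}" and k: "3 \<le> k"
    and e: "{\<nu> i, hd ps} \<in> E" "{\<nu> (i + k), last ps} \<in> E"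
    and ab: "1 \<le> a" "a \<le> k - 1" "1 \<le> b" "b \<le> k - 1"
  shows "{\<nu> (i + a), \<nu> (i + k + b)} \<notin> E"
proof
  assume ed: "{\<nu> (i + a), \<nu> (i + k + b)} \<in> E"
  have ps0: "ps \<noteq> []" using ps(2) k by auto
  have ic: "\<nu> (i + 2 * k) = \<nu> i" using per[of i] c by simp
  have disj: "set ps \<inter> set (map \<nu> [x..<y]) = {}" for x y using ps(3) by auto
  \<comment> \<open>The chord and \<open>ps\<close> close two cycles, with
    \<open>3 * k + 1 - (a + b)\<close> and \<open>k + 1 + a + b\<close> vertices. Together these are
    \<open>4 * k + 2\<close>, so one of the cycles is longer than \<open>c\<close>.\<close>
  show False
  proof (cases "a + b \<le> k")
    case True
    define as bs where "as = map \<nu> [i + a..<i + k + 1]" and "bs = map \<nu> [i + k + b..<i + 2 * k + 1]"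
    have p: "is_path E as" "is_path E bs" unfolding as_def bs_def
      using c ab by (auto intro!: cycfun_arc[OF cyc] simp del: upt_Suc)
    have d: "set as \<inter> set bs = {}" unfolding as_def bs_def set_map set_upt
      by (rule disjoint_arcs[OF cyc]) (use c ab in auto)
    have ne: "as \<noteq> []" "bs \<noteq> []" using ab by (auto simp: as_def bs_def)
    have h: "hd as = \<nu> (i + a)" "last as = \<nu> (i + k)" "hd bs = \<nu> (i + k + b)" "last bs = \<nu> i"
      using ab ic by (simp_all add: as_def bs_def hd_arc last_arc del: upt_Suc)
    have "is_path E (ps @ rev as @ bs)"
      using p d ne h e ps ps0 ed disj[of "i + a" "i + k + 1"] disj[of "i + k + b" "i + 2 * k + 1"]
      unfolding as_def[symmetric] bs_def[symmetric]
      by (auto simp: is_path_append hd_append last_rev hd_rev insert_commute)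
    moreover have "length as = k + 1 - a" "length bs = k + 1 - b"
      by (simp_all add: as_def bs_def del: upt_Suc)
    then have len: "length (ps @ rev as @ bs) = k - 1 + (k + 1 - a) + (k + 1 - b)"
      using ps(2) by simp
    ultimately have "is_cyc E (ps @ rev as @ bs)" using ne h e ps0 k ab by (simp add: is_cyc_def insert_commute)
    from longest[OF this] show False using len True ab c k by simp
  next
    case False
    define as bs where "as = map \<nu> [i + k..<i + k + b + 1]" and "bs = map \<nu> [i..<i + a + 1]"
    have p: "is_path E as" "is_path E bs" unfolding as_def bs_def
      using c ab by (auto intro!: cycfun_arc[OF cyc] simp del: upt_Suc)
    have d: "set bs \<inter> set as = {}" unfolding as_def bs_def set_map set_upt
      by (rule disjoint_arcs[OF cyc]) (use c ab in auto)
    have ne: "as \<noteq> []" "bs \<noteq> []" using ab by (auto simp: as_def bs_def)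
    have h: "hd as = \<nu> (i + k)" "last as = \<nu> (i + k + b)" "last bs = \<nu> (i + a)" "hd bs = \<nu> i"
      using ab by (simp_all add: as_def bs_def hd_arc last_arc del: upt_Suc)
    have "is_path E (ps @ as @ rev bs)"
      using p d ne h e ps ps0 ed disj[of i "i + a + 1"] disj[of "i + k" "i + k + b + 1"]
      unfolding as_def[symmetric] bs_def[symmetric]
      by (auto simp: is_path_append hd_append last_rev hd_rev insert_commute)
    moreover have len: "length (ps @ as @ rev bs) = k - 1 + (b + 1) + (a + 1)"
      using ps(2) by (simp add: as_def bs_def)
    ultimately have "is_cyc E (ps @ as @ rev bs)" using ne h e ps0 k ab
      by (simp add: is_cyc_def last_rev insert_commute)
    from longest[OF this] show False using len False ab c k by simp
  qed
qed

section \<open>Structure of the graph when \<open>c = 2 * k\<close> and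
  \<open>card R = k - 1\<close>\<close>

context
  fixes k R
  assumes c: "c = 2 * k" and R: "R \<subseteq> V - U" "R \<noteq> {}" and cardR: "card R + 1 = k"
    and deg: "\<And>v. v \<in> R \<Longrightarrow> k \<le> card (nbrs E (U \<union> R) v)"
    and many: "ecount E (U \<union> R) = (2 * k choose 2) + (k choose 2)"
begin

lemma finR: "finite R"
  using R finV by (auto intro: finite_subset)

lemma UR: "U \<inter> R = {}"
  using R by auto

text \<open>A set outside with all degrees above \<open>k\<close> would contradict
  \<open>outside_degree\<close>, as \<open>c = 2 * k\<close>. Together with \<open>many\<close> this
  allows at most \<open>k choose 2\<close> missing pairs inside \<open>U\<close>.\<close>

lemma tight_outside: "ecount E (U \<union> R) \<le> ecount E U + k * (k - 1)"
proof -
  have "\<exists>v\<in>Y. card (nbrs E (U \<union> Y) v) \<le> k" if Y: "Y \<subseteq> R" "Y \<noteq> {}" for Y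
  proof (rule ccontr)
    assume "\<not> ?thesis"
    then have "\<And>v. v \<in> Y \<Longrightarrow> k + 1 \<le> card (nbrs E (U \<union> Y) v)" by (auto simp: not_le Suc_le_eq)
    moreover have "card Y + 1 \<le> k + 1" using card_mono[OF finR Y(1)] cardR by simp
    moreover have "Y \<subseteq> V - U" using Y R by auto
    ultimately have "2 * (k + 1) \<le> c" using outside_degree[of Y "k + 1"] Y by simp
    then show False using c by simp
  qed
  then have "ecount E (U \<union> R) \<le> ecount E U + (\<Sum>j\<in>{1..card R}. k)"
    by (intro peel finR UR) auto
  moreover have "card R = k - 1" using cardR by simp
  ultimately show ?thesis by (simp add: mult.commute)
qed

text \<open>An edge inside \<open>R\<close> yields a longest path with p \<ge> 2 vertices. Its ends
  share their neighbours on the cycle, at mutual distance at least p + 1, which leaves only two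
  antipodal neighbours and p = k - 1. Then \<open>antipodal_attachment\<close> removes too many
  pairs inside \<open>U\<close>.\<close>

lemma tight_independent: "{u, v} \<notin> E" if uv: "u \<in> R" "v \<in> R"
proof
  assume uvE: "{u, v} \<in> E"
  obtain ps where ps: "is_path E ps" "ps \<noteq> []" "set ps \<subseteq> R" "length ps \<le> card R"
    "k \<le> card (nbrs E U (hd ps)) + (length ps - 1)" "k \<le> card (nbrs E U (last ps)) + (length ps - 1)"
    "2 * card (nbrs E U (hd ps) \<union> nbrs E U (last ps)) + 2 * (length ps - 1) \<le> c"
    and mx: "\<And>qs. is_path E qs \<Longrightarrow> set qs \<subseteq> R \<Longrightarrow> length qs \<le> length ps"
    using outside_ends[OF R deg] cardR by (metis order_refl)
  define p where "p = length ps"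
  let ?A = "nbrs E U (hd ps)" and ?B = "nbrs E U (last ps)"
  have "u \<noteq> v" using uvE by auto
  then have "is_path E [u, v]" using uvE by (simp add: is_path_Cons)
  from mx[OF this] have p2: "2 \<le> p" using uv by (simp add: p_def)
  have pk: "p + 1 \<le> k" using ps(4) cardR by (simp add: p_def)
  have fin: "finite (?A \<union> ?B)" by (simp add: finite_nbrs)
  have AB: "card (?A \<union> ?B) + (p - 1) \<le> k" "k \<le> card ?A + (p - 1)" "k \<le> card ?B + (p - 1)"
    using ps(5-7) c by (simp_all add: p_def)
  \<comment> \<open>For \<open>\<alpha> = k\<close> and \<open>c = 2 * k\<close> the bounds of
    \<open>outside_ends\<close> coincide, so neither end has a neighbour of its own.\<close>
  have A: "?A = ?A \<union> ?B" using AB fin by (intro card_seteq) auto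
  have B: "?B = ?A \<union> ?B" using AB fin by (intro card_seteq) auto
  have eqAB: "?A = ?B" using A B by auto
  have cA: "card ?A + (p - 1) = k" using AB A by simp
  have dis: "set ps \<inter> U = {}" using ps(3) UR by auto
  have gap: "x + (p + 1) \<le> y" if "\<nu> x \<in> ?A" "\<nu> y \<in> ?A" "x < y" "y < x + c" for x y
    using detour[OF ps(1,2) dis that(3,4)] that eqAB by (auto simp: nbrs_def p_def)
  have "?A \<noteq> {}" using cA pk by auto
  then obtain i where i: "\<nu> i \<in> ?A" by (auto simp: nbrs_def)
  have "(p + 1) * card {x \<in> {i..<i + c}. \<nu> x \<in> ?A} \<le> i + c - i"
  proof (rule gaps_uniform)
    show "x + (p + 1) \<le> y" if "\<nu> x \<in> ?A" "\<nu> y \<in> ?A" "i \<le> x" "x < y" "y \<le> i + c" for x y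
    proof (cases "y = x + c")
      case True
      then show ?thesis using pk c by simp
    next
      case False
      then show ?thesis using that by (intro gap) auto
    qed
  qed (use i in auto)
  moreover have "card {x \<in> {i..<i + c}. \<nu> x \<in> ?A} = card ?A"
    unfolding cycfun_card[OF cyc] by (rule arg_cong[of _ _ card]) (auto simp: nbrs_def)
  ultimately have gp: "(p + 1) * card ?A \<le> 2 * k" using c by simp
  have m2: "2 \<le> card ?A" using cA pk p2 by linarith
  \<comment> \<open>In these variables the gap count becomes
    \<open>(x + 1) * y \<le> 0\<close>.\<close>
  obtain x y where xy: "p = x + 2" "card ?A = y + 2"
    using p2 m2 by (metis add.commute le_Suc_ex)
  then have "k = x + y + 3" using cA by simp
  then have "(x + 3) * (y + 2) \<le> 2 * (x + y + 3)" using gp xy by simp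
  then have "(x + 1) * y \<le> 0" by (simp add: algebra_simps)
  then have "y = 0" by simp
  then have kp: "card ?A = 2" "p + 1 = k" using xy \<open>k = x + y + 3\<close> by auto
  have k3: "3 \<le> k" using kp p2 by simp
  have "\<not> ?A \<subseteq> {\<nu> i}" using kp card_mono[of "{\<nu> i}" ?A] by auto
  then obtain b where "b \<in> ?A" "b \<noteq> \<nu> i" by blast
  then obtain j where j: "j \<in> {i..<i + c}" "\<nu> j \<in> ?A" "\<nu> j \<noteq> \<nu> i"
    using window[of i] by (auto simp: nbrs_def) (metis atLeastLessThan_iff)
  then have ij: "i < j" "j < i + c" by (auto simp: order.order_iff_strict)
  have "i + k \<le> j" using gap[OF i j(2) ij] kp by simp
  moreover have "j + k \<le> i + c" using gap[of j "i + c"] i j ij kp by simp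
  ultimately have "j = i + k" using c by simp
  then have jk: "\<nu> (i + k) \<in> ?A" using j by simp
  have cross: "{\<nu> (i + a), \<nu> (i + k + b)} \<notin> E" if "a \<in> {1..k - 1}" "b \<in> {1..k - 1}" for a b
  proof -
    have "\<nu> (i + k) \<in> ?B" using jk eqAB by simp
    then have "{\<nu> i, hd ps} \<in> E" "{\<nu> (i + k), last ps} \<in> E" using i by (auto simp: nbrs_def)
    then show ?thesis
      using that kp(2) by (intro antipodal_attachment[OF c ps(1) _ dis k3]) (auto simp: p_def)
  qed
  define X where "X = (\<lambda>(a, b). {\<nu> (i + a), \<nu> (i + k + b)}) ` ({1..k - 1} \<times> {1..k - 1})"
  have inj: "x = y" if "\<nu> x = \<nu> y" "x \<in> {i..<i + c}" "y \<in> {i..<i + c}" for x y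
    using inj_onD[OF cycfun_inj[OF cyc, of i]] that by auto
  have lt: "a < k" if "a \<in> {1..k - 1}" for a using that by auto
  have ne: "\<nu> (i + a) \<noteq> \<nu> (i + k + b)" if "a \<in> {1..k - 1}" "b \<in> {1..k - 1}" for a b
    using inj[of "i + a" "i + k + b"] lt[OF that(1)] lt[OF that(2)] c by auto
  have "inj_on (\<lambda>(a, b). {\<nu> (i + a), \<nu> (i + k + b)}) ({1..k - 1} \<times> {1..k - 1})"
  proof (rule inj_onI, clarify)
    fix a b a' b' assume *: "a \<in> {1..k - 1}" "b \<in> {1..k - 1}" "a' \<in> {1..k - 1}" "b' \<in> {1..k - 1}"
      and eq: "{\<nu> (i + a), \<nu> (i + k + b)} = {\<nu> (i + a'), \<nu> (i + k + b')}"
    have "\<nu> (i + a) \<noteq> \<nu> (i + k + b')" using * by (intro ne)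
    then have "\<nu> (i + a) = \<nu> (i + a')" "\<nu> (i + k + b) = \<nu> (i + k + b')"
      using eq by (auto simp: doubleton_eq_iff)
    then show "a = a' \<and> b = b'"
      using inj[of "i + a" "i + a'"] inj[of "i + k + b" "i + k + b'"] *[THEN lt] c by auto
  qed
  then have cX: "card X = (k - 1) * (k - 1)" unfolding X_def by (simp add: card_image)
  have XU: "X \<subseteq> all_pairs U" using ne by (auto simp: X_def pair_in_all_pairs)
  have fU: "finite (all_pairs U)" using finU by (auto simp: all_pairs_def)
  have "{e \<in> E. e \<subseteq> U} \<subseteq> all_pairs U - X"
    using E cross by (auto simp: X_def all_pairs_def)
  then have "ecount E U \<le> card (all_pairs U - X)" unfolding ecount_def using fU by (intro card_mono) auto
  also have "\<dots> = (2 * k choose 2) - (k - 1) * (k - 1)"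
    using XU fU finU cX cardU c by (simp add: card_Diff_subset finite_subset card_all_pairs)
  finally have eU: "ecount E U \<le> (2 * k choose 2) - (k - 1) * (k - 1)" .
  have "(k - 1) * (k - 1) \<le> (2 * k choose 2)"
    using card_mono[OF fU XU] cX finU cardU c by (simp add: card_all_pairs)
  \<comment> \<open>At least \<open>(k - 1) * (k - 1)\<close> pairs are missing where at most
    \<open>k choose 2\<close> may be, which is impossible for \<open>k \<ge> 3\<close>.\<close>
  then have "(k choose 2) + (k - 1) * (k - 1) \<le> k * (k - 1)" using tight_outside eU many by linarith
  then have "2 * (k choose 2) + 2 * ((k - 1) * (k - 1)) \<le> 2 * (k * (k - 1))" by linarith
  then have "k * (k - 1) + 2 * ((k - 1) * (k - 1)) \<le> 2 * (k * (k - 1))" unfolding choose2 .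
  moreover obtain q where "k = q + 3" using k3 by (metis add.commute le_Suc_ex)
  ultimately show False by (simp add: algebra_simps)
qed

text \<open>As \<open>R\<close> is independent, at least \<open>k\<close> neighbours of
  \<open>v\<close> lie on the cycle of length \<open>2 * k\<close>, and by \<open>detour\<close> no
  two of them are consecutive.\<close>

lemma tight_alternate:
  assumes v: "v \<in> R" shows "{\<nu> x, v} \<in> E \<longleftrightarrow> {\<nu> (Suc x), v} \<notin> E"
proof -
  define S where "S x = ({\<nu> x, v} \<in> E)" for x
  have vU: "v \<notin> U" using v UR by auto
  have nR: "nbrs E R v = {}" using tight_independent v by (auto simp: nbrs_def)
  have k2: "2 \<le> k" using cardR R(2) finR by (cases "card R") auto
  have gap: "x + 2 \<le> y" if "S x" "S y" "x < y" "y < x + c" for x y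
    using detour[of "[v]" x y] that vU by (auto simp: S_def)
  have "k \<le> card (nbrs E U v)" using deg[OF v] nbrs_union[OF UR, of v] nR by simp
  moreover have "card {y \<in> {x..<x + c}. \<nu> y \<in> nbrs E U v} = card (nbrs E U v)"
    unfolding cycfun_card[OF cyc] by (rule arg_cong[of _ _ card]) (auto simp: nbrs_def)
  ultimately have card_S: "k \<le> card {y \<in> {x..<x + c}. S y}" by (simp add: nbrs_def S_def)
  have "\<not> (S x \<and> S (Suc x))" using gap[of x "Suc x"] c k2 by auto
  moreover have "S x \<or> S (Suc x)"
  proof (rule ccontr)
    assume n: "\<not> ?thesis"
    define T where "T = {y \<in> {x..<x + c}. S y}"
    have T: "T \<subseteq> {x + 2..<x + c}"
    proof
      fix y assume "y \<in> T"
      moreover from this have "y \<noteq> x" "y \<noteq> Suc x" using n by (auto simp: T_def)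
      ultimately show "y \<in> {x + 2..<x + c}" by (auto simp: T_def)
    qed
    \<comment> \<open>With two consecutive positions missed, \<open>T\<close> and its shift would be
      at least \<open>2 * k\<close> positions among \<open>2 * k - 1\<close>.\<close>
    have "T \<inter> Suc ` T = {}" using gap by (fastforce simp: T_def)
    moreover have "finite T" by (simp add: T_def)
    ultimately have "card (T \<union> Suc ` T) = card T + card T"
      by (simp add: card_Un_disjoint card_image)
    moreover have "card (T \<union> Suc ` T) \<le> card {x + 2..x + c}"
      using T by (intro card_mono) auto
    ultimately show False using card_S c k2 by (simp add: T_def)
  qed
  ultimately show ?thesis unfolding S_def by blast
qed

text \<open>If \<open>u\<close> and \<open>v\<close> used different parity classes, the cycle could
  be rerouted as \<open>\<nu> y\<close>, \<open>u\<close>, \<open>\<nu> (y + 2)\<close>,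
  \<open>\<nu> (y + 1)\<close>, \<open>v\<close>, \<open>\<nu> (y + 3)\<close>, ..., and gain two
  vertices.\<close>

lemma tight_same:
  assumes u: "u \<in> R" and v: "v \<in> R" shows "{\<nu> x, u} \<in> E \<longleftrightarrow> {\<nu> x, v} \<in> E"
proof (rule ccontr)
  assume ne: "\<not> ?thesis"
  have k2: "2 \<le> k" using cardR R(2) finR by (cases "card R") auto
  have uv: "u \<noteq> v" using ne by auto
  obtain y where y: "{\<nu> y, u} \<in> E" "{\<nu> (Suc y), v} \<in> E"
    using ne tight_alternate[OF u] tight_alternate[OF v] by metis
  then have y2: "{\<nu> (Suc (Suc y)), u} \<in> E" "{\<nu> (Suc (Suc (Suc y))), v} \<in> E"
    using tight_alternate[OF u] tight_alternate[OF v] by metis+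
  define bs where "bs = map \<nu> [y + 3..<y + c]"
  have bs: "is_path E bs" "bs \<noteq> []" "hd bs = \<nu> (y + 3)" "last bs = \<nu> (y + c - 1)" "set bs \<subseteq> U"
    using c k2 cycfun_arc[OF cyc, of "y + c" "y + 3"] by (auto simp: bs_def hd_arc last_arc)
  have nb: "\<nu> z \<notin> set bs" if "z \<in> {y, y + 1, y + 2}" for z
  proof -
    have "\<nu> ` {z..<z + 1} \<inter> \<nu> ` {y + 3..<y + c} = {}"
      using that by (intro disjoint_arcs[OF cyc]) auto
    then show ?thesis by (auto simp: bs_def)
  qed
  have "\<nu> y \<noteq> \<nu> (y + 1)" "\<nu> (y + 1) \<noteq> \<nu> (y + 2)" "\<nu> y \<noteq> \<nu> (y + 2)"
    using cycfun_eqD[OF cyc, of y "y + 1"] cycfun_eqD[OF cyc, of "y + 1" "y + 2"]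
      cycfun_eqD[OF cyc, of y "y + 2"] c k2 by auto
  moreover have "u \<notin> U" "v \<notin> U" using u v UR by auto
  moreover have "{\<nu> (y + 2), \<nu> (y + 1)} \<in> E" using step[of "y + 1"] by (simp add: insert_commute)
  ultimately have "is_path E ([\<nu> y, u, \<nu> (y + 2), \<nu> (y + 1), v] @ bs)"
    using y y2 uv bs nb by (auto simp: is_path_Cons insert_commute numeral_eq_Suc)
  moreover have "{last bs, \<nu> y} \<in> E"
    using step[of "y + c - 1"] per[of y] bs(4) c k2 by (simp del: per)
  moreover have "length bs = c - 3" by (simp add: bs_def)
  ultimately have "is_cyc E ([\<nu> y, u, \<nu> (y + 2), \<nu> (y + 1), v] @ bs)"
    using bs(2) by (auto simp: is_cyc_def)
  from longest[OF this] show False using \<open>length bs = c - 3\<close> c k2 by simp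
qed

lemma tight_structure:
  assumes VU: "V = U \<union> R"
  shows "\<exists>A\<subseteq>V. card A = k \<and> E = {e \<in> all_pairs V. e \<inter> A \<noteq> {}}"
proof -
  obtain u where u: "u \<in> R" using R by auto
  have k2: "2 \<le> k" using cardR R(2) finR by (cases "card R") auto
  define A where "A = nbrs E U u"
  have AV: "A \<subseteq> V" using U_V by (auto simp: A_def nbrs_def)
  have finA: "finite A" by (simp add: A_def finite_nbrs)
  have alt: "\<nu> x \<in> A \<longleftrightarrow> \<nu> (Suc x) \<notin> A" for x
    using tight_alternate[OF u, of x] by (simp add: A_def nbrs_def)
  have cA: "card A = k"
  proof -
    have "A \<union> (\<lambda>x. \<nu> (Suc x)) ` {x \<in> {0..<0 + c}. \<nu> x \<in> A} = U"
    proof (intro equalityI subsetI)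
      fix w assume "w \<in> U"
      then obtain x where x: "x \<in> {1..<1 + c}" "w = \<nu> x" using window[of 1] by (metis rangeE)
      then show "w \<in> A \<union> (\<lambda>x. \<nu> (Suc x)) ` {x \<in> {0..<0 + c}. \<nu> x \<in> A}"
        using alt[of "x - 1"] by (auto intro!: image_eqI[of _ _ "x - 1"])
    qed (auto simp: A_def nbrs_def)
    then have "c \<le> card A + card ((\<lambda>x. \<nu> (Suc x)) ` {x \<in> {0..<0 + c}. \<nu> x \<in> A})"
      using cardU card_Un_le by metis
    also have "\<dots> \<le> card A + card {x \<in> {0..<0 + c}. \<nu> x \<in> A}"
      by (intro add_left_mono card_image_le) simp
    also have "\<dots> = card A + card A"
      unfolding cycfun_card[OF cyc] by (simp, rule arg_cong[of _ _ card]) (auto simp: A_def nbrs_def)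
    finally have "k \<le> card A" using c by simp
    moreover have "card A \<le> k"
    proof -
      have inj: "inj_on (\<lambda>x. \<nu> (Suc x)) {x \<in> {0..<0 + c}. \<nu> x \<in> A}"
      proof (rule inj_onI)
        fix x y assume "x \<in> {x \<in> {0..<0 + c}. \<nu> x \<in> A}" "y \<in> {x \<in> {0..<0 + c}. \<nu> x \<in> A}"
          "\<nu> (Suc x) = \<nu> (Suc y)"
        then have "Suc x = Suc y" by (intro inj_onD[OF cycfun_inj[OF cyc, of 1]]) auto
        then show "x = y" by simp
      qed
      have "card A = card (A \<inter> U)" by (rule arg_cong[of _ _ card]) (auto simp: A_def nbrs_def)
      also have "\<dots> = card ((\<lambda>x. \<nu> (Suc x)) ` {x \<in> {0..<0 + c}. \<nu> x \<in> A})"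
        using inj cycfun_card[OF cyc, of 0 A] by (simp add: card_image)
      also have "\<dots> \<le> card (U - A)"
      proof -
        have "(\<lambda>x. \<nu> (Suc x)) ` {x \<in> {0..<0 + c}. \<nu> x \<in> A} \<subseteq> U - A" using alt by blast
        then show ?thesis using finU by (intro card_mono) auto
      qed
      also have "\<dots> = c - card A"
        using finA cardU by (subst card_Diff_subset) (auto simp: A_def nbrs_def)
      finally show ?thesis using c by simp
    qed
    ultimately show ?thesis by simp
  qed
  have ind: "{x, y} \<notin> E" if xy: "x \<in> V - A" "y \<in> V - A" for x y
  proof -
    have mixed: "{x, y} \<notin> E" if "x \<in> R" "y \<in> U - A" for x y
      using that tight_same[OF u that(1)] by (auto simp: A_def nbrs_def insert_commute)
    have cyclic: "{x, y} \<notin> E" if "x \<in> U - A" "y \<in> U - A" "x \<noteq> y" for x y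
    proof -
      have "\<exists>i<c. \<nu> (Suc i) = z \<and> \<nu> i \<in> A" if z: "z \<in> U - A" for z
      proof -
        obtain i where "i \<in> {1..<1 + c}" "z = \<nu> i" using window[of 1] z by (metis DiffD1 rangeE)
        then show ?thesis using alt[of "i - 1"] z by (intro exI[of _ "i - 1"]) auto
      qed
      from this[OF that(1)] this[OF that(2)] obtain i j where
        ij: "i < c" "\<nu> (Suc i) = x" "\<nu> i \<in> A" "j < c" "\<nu> (Suc j) = y" "\<nu> j \<in> A" by auto
      have "{\<nu> (Suc i), \<nu> (Suc j)} \<notin> E"
        by (rule attachment_degree_sum(2)[of "[u]"]) (use ij that u UR in \<open>auto simp: A_def nbrs_def\<close>)
      then show ?thesis using ij by simp
    qed
    have "x \<in> R \<or> x \<in> U - A" "y \<in> R \<or> y \<in> U - A" using xy VU by auto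
    then show ?thesis using mixed[of x y] mixed[of y x] cyclic[of x y] tight_independent[of x y]
      by (cases "x = y") (auto simp: insert_commute)
  qed
  define H where "H = {e \<in> all_pairs V. e \<inter> A \<noteq> {}}"
  have EH: "E \<subseteq> H"
  proof
    fix e assume e: "e \<in> E"
    then obtain x y where xy: "e = {x, y}" by (auto elim: edge_cases)
    then have "x \<in> V" "y \<in> V" using e edgeD by auto
    then show "e \<in> H" using ind[of x y] e E xy by (auto simp: H_def)
  qed
  have finAll: "finite (all_pairs V)" using finV by (auto simp: all_pairs_def)
  have "all_pairs V = H \<union> all_pairs (V - A)" "H \<inter> all_pairs (V - A) = {}"
    by (auto simp: H_def all_pairs_def)
  then have "card (all_pairs V) = card H + card (all_pairs (V - A))"
    using finAll by (metis card_Un_disjoint finite_Un)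
  moreover have cV: "card V = 3 * k - 1"
    using VU finU finR UR cardU c cardR by (simp add: card_Un_disjoint)
  moreover have "card (V - A) = 2 * k - 1" using cV cA AV finA by (simp add: card_Diff_subset)
  ultimately have "(3 * k - 1 choose 2) = card H + (2 * k - 1 choose 2)"
    using finV by (simp add: card_all_pairs)
  then have "2 * int (3 * k - 1 choose 2) = 2 * int (card H) + 2 * int (2 * k - 1 choose 2)" by simp
  then have cH: "2 * int (card H) = (3 * int k - 1) * (3 * int k - 2) - (2 * int k - 1) * (2 * int k - 2)"
    unfolding choose2_int using k2 by (simp add: of_nat_diff)
  have "card E = (2 * k choose 2) + (k choose 2)" using many VU ecount_V by simp
  then have "2 * int (card E) = 2 * int (2 * k choose 2) + 2 * int (k choose 2)" by simp
  also have "\<dots> = 2 * int k * (2 * int k - 1) + int k * (int k - 1)" unfolding choose2_int by simp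
  also have "\<dots> = 2 * int (card H)" unfolding cH by (simp add: algebra_simps)
  finally have "card H = card E" by simp
  moreover have "finite H" using finAll by (simp add: H_def)
  ultimately have "E = H" using EH by (intro card_seteq) auto
  then show ?thesis using AV cA unfolding H_def by blast
qed

end

end

section \<open>The extremal graphs\<close>

text \<open>The predicates \<open>two_cliques\<close>, \<open>clique_join\<close> and \<open>balanced_bipartite\<close> are intrinsic descriptions of
  \<open>B(n; 2k, n - 2k + 1)\<close>, \<open>H\<^sub>1(n, k)\<close> and the balanced complete bipartite graph.\<close>

definition two_cliques :: "nat \<Rightarrow> 'a set \<Rightarrow> 'a set set \<Rightarrow> bool" where
  "two_cliques k V E \<longleftrightarrow> (\<exists>X Y z. V = X \<union> Y \<and> X \<inter> Y = {z} \<and> card X = 2 * k \<and>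
     card Y = card V - 2 * k + 1 \<and> E = all_pairs X \<union> all_pairs Y)"

definition clique_join :: "nat \<Rightarrow> 'a set \<Rightarrow> 'a set set \<Rightarrow> bool" where
  "clique_join k V E \<longleftrightarrow> (\<exists>A\<subseteq>V. card A = k \<and> E = {e \<in> all_pairs V. e \<inter> A \<noteq> {}})"

definition balanced_bipartite :: "'a set \<Rightarrow> 'a set set \<Rightarrow> bool" where
  "balanced_bipartite V E \<longleftrightarrow> (\<exists>X Y. V = X \<union> Y \<and> X \<inter> Y = {} \<and> card X = (card V + 1) div 2 \<and>
     card Y = card V div 2 \<and> E = {{x, y} | x y. x \<in> X \<and> y \<in> Y})"

text \<open>The middle line is g(n,k) for s = 2 and r = n - 2k + 1; it ends where r reaches
  2k.\<close>

definition ex_value :: "nat \<Rightarrow> nat \<Rightarrow> nat" where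
  "ex_value k n = (if n \<le> 2 * k then n choose 2
     else if n \<le> 4 * k - 1 then (2 * k choose 2) + (n - 2 * k + 1 choose 2) else n\<^sup>2 div 4)"

definition extremal_shape :: "nat \<Rightarrow> 'a set \<Rightarrow> 'a set set \<Rightarrow> bool" where
  "extremal_shape k V E \<longleftrightarrow> (let n = card V in
     (n \<le> 2 * k \<and> E = all_pairs V) \<or> (2 * k + 1 \<le> n \<and> n \<le> 4 * k - 1 \<and> two_cliques k V E) \<or>
     (n \<in> {3 * k - 1, 3 * k} \<and> clique_join k V E) \<or> (4 * k - 2 \<le> n \<and> balanced_bipartite V E))"

section \<open>The listed graphs: no cycle of length \<open>2 * k + 1\<close>, number of
  edges\<close>

lemma contains_cycle_iff:
  assumes "simple_graph G" "3 \<le> l"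
  shows "contains_copy G (cycle_graph l) \<longleftrightarrow> (\<exists>xs. is_cyc (edges G) xs \<and> length xs = l)"
proof
  assume "contains_copy G (cycle_graph l)"
  then obtain f where f: "inj_on f {..<l}" "(`) f ` {{i, Suc i mod l} | i. i < l} \<subseteq> edges G"
    by (auto simp: contains_copy_def cycle_graph_def)
  have e: "{f i, f (Suc i mod l)} \<in> edges G" if "i < l" for i
    using that by (intro subsetD[OF f(2)] image_eqI[of _ _ "{i, Suc i mod l}"]) auto
  let ?xs = "map f [0..<l]"
  have "distinct ?xs" using f(1) by (simp add: distinct_map atLeast0LessThan)
  moreover have "{f i, f (Suc i)} \<in> edges G" if "Suc i < l" for i using e[of i] that by simp
  ultimately have "is_path (edges G) ?xs" by (simp add: is_path_def successively_conv_nth)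
  moreover have "{last ?xs, hd ?xs} \<in> edges G"
    using e[of "l - 1"] assms(2) by (simp add: last_map hd_map)
  ultimately have "is_cyc (edges G) ?xs" using assms(2) by (simp add: is_cyc_def)
  then show "\<exists>xs. is_cyc (edges G) xs \<and> length xs = l" by (intro exI[of _ ?xs]) simp
next
  assume "\<exists>xs. is_cyc (edges G) xs \<and> length xs = l"
  then obtain xs where xs: "is_cyc (edges G) xs" "length xs = l" by auto
  let ?f = "\<lambda>i. xs ! (i mod l)"
  have cf: "cycfun (edges G) l ?f" using is_cyc_cycfun[OF xs(1)] xs(2) by simp
  then have st: "{?f i, ?f (Suc i)} \<in> edges G" for i by (auto simp: cycfun_def)
  have inj: "inj_on ?f {..<l}" using cf by (auto simp: cycfun_def)
  have "?f i \<in> verts G" for i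
    using st[of i] assms(1) by (auto simp: simple_graph_def all_pairs_def)
  then have "?f ` {..<l} \<subseteq> verts G" by blast
  moreover have "(`) ?f ` {{i, Suc i mod l} | i. i < l} \<subseteq> edges G"
  proof
    fix e assume "e \<in> (`) ?f ` {{i, Suc i mod l} | i. i < l}"
    then obtain i where "e = ?f ` {i, Suc i mod l}" by blast
    then have "e = {?f i, ?f (Suc i)}" by simp
    then show "e \<in> edges G" using st[of i] by blast
  qed
  ultimately show "contains_copy G (cycle_graph l)"
    unfolding contains_copy_def cycle_graph_def using inj by (intro exI[of _ ?f]) simp
qed

text \<open>The successor of a vertex off \<open>A\<close> lies in \<open>A\<close>, so
  \<open>A\<close> contains at least half of the cycle. For the join this limits cycles to
  \<open>2 * k\<close> vertices.\<close>

lemma cyc_vertex_cover: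
  assumes cyc: "is_cyc E xs" and A: "finite A" "\<And>e. e \<in> E \<Longrightarrow> e \<inter> A \<noteq> {}"
  shows "length xs \<le> 2 * card A"
proof -
  define c \<nu> where "c = length xs" and "\<nu> = (\<lambda>i. xs ! (i mod length xs))"
  have cf: "cycfun E c \<nu>" using is_cyc_cycfun[OF cyc] by (simp add: c_def \<nu>_def)
  have "Suc ` {i \<in> {0..<0 + c}. \<nu> i \<notin> A} \<subseteq> {i \<in> {1..<1 + c}. \<nu> i \<in> A}"
    using A(2) cf by (fastforce simp: cycfun_def)
  then have "card {i \<in> {0..<0 + c}. \<nu> i \<notin> A} \<le> card {i \<in> {1..<1 + c}. \<nu> i \<in> A}"
    by (metis (no_types, lifting) card_image card_mono finite_Collect_conjI finite_atLeastLessThan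
        inj_Suc inj_on_subset mem_Collect_eq subset_UNIV finite_nat_set_iff_bounded)
  also have "\<dots> \<le> card A" unfolding cycfun_card[OF cf] using A(1) by (intro card_mono) auto
  finally have "card {i \<in> {0..<0 + c}. \<nu> i \<notin> A} \<le> card A" .
  moreover have "card {i \<in> {0..<0 + c}. \<nu> i \<in> A} \<le> card A"
    unfolding cycfun_card[OF cf] using A(1) by (intro card_mono) auto
  moreover have "{i \<in> {0..<0 + c}. \<nu> i \<notin> A} \<union> {i \<in> {0..<0 + c}. \<nu> i \<in> A} = {0..<c}" by auto
  then have "c \<le> card {i \<in> {0..<0 + c}. \<nu> i \<notin> A} + card {i \<in> {0..<0 + c}. \<nu> i \<in> A}"
    by (metis card_Un_le card_atLeastLessThan diff_zero)
  ultimately show ?thesis by (simp add: c_def)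
qed

lemma bipartite_cyc_even:
  assumes cyc: "is_cyc E xs" and X: "\<And>x y. {x, y} \<in> E \<Longrightarrow> x \<in> X \<longleftrightarrow> y \<notin> X"
  shows "even (length xs)"
proof -
  define c \<nu> where "c = length xs" and "\<nu> = (\<lambda>i. xs ! (i mod length xs))"
  have cf: "cycfun E c \<nu>" using is_cyc_cycfun[OF cyc] by (simp add: c_def \<nu>_def)
  have "\<nu> i \<in> X \<longleftrightarrow> (\<nu> 0 \<in> X \<longleftrightarrow> even i)" for i
  proof (induction i)
    case (Suc i)
    have "{\<nu> i, \<nu> (Suc i)} \<in> E" using cf by (simp add: cycfun_def)
    from X[OF this] Suc show ?case by auto
  qed simp
  from this[of c] show ?thesis using cf by (auto simp: cycfun_def c_def[symmetric] dest: spec[of _ 0])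
qed

text \<open>A cycle passes the shared vertex \<open>z\<close> at most once, so between two visits it
  has no way to change from one block to the other.\<close>

lemma cyc_in_block:
  assumes cyc: "is_cyc E xs" and XY: "X \<inter> Y \<subseteq> {z}" "\<And>e. e \<in> E \<Longrightarrow> e \<subseteq> X \<or> e \<subseteq> Y"
  shows "set xs \<subseteq> X \<or> set xs \<subseteq> Y"
proof -
  define c \<nu> where "c = length xs" and "\<nu> = (\<lambda>i. xs ! (i mod length xs))"
  have cf: "cycfun E c \<nu>" using is_cyc_cycfun[OF cyc] by (simp add: c_def \<nu>_def)
  then have c3: "3 \<le> c" and st: "{\<nu> i, \<nu> (Suc i)} \<in> E" for i by (auto simp: cycfun_def)
  \<comment> \<open>The position of \<open>z\<close>, where the turn starts; any position if the
    cycle avoids \<open>z\<close>.\<close>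
  obtain m where m: "\<And>a. m < a \<Longrightarrow> a < m + c \<Longrightarrow> \<nu> a \<noteq> z"
  proof (cases "z \<in> range \<nu>")
    case True
    then obtain m where m: "\<nu> m = z" by auto
    show ?thesis
    proof (rule that)
      show "\<nu> a \<noteq> z" if "m < a" "a < m + c" for a using cycfun_eqD[OF cf, of m a] m that by auto
    qed
  qed auto
  have stay: "range \<nu> \<subseteq> S" if S: "\<nu> (m + 1) \<in> S" and ST: "\<And>x y. {x, y} \<in> E \<Longrightarrow> x \<in> S \<Longrightarrow> x \<noteq> z \<Longrightarrow> y \<in> S" for S
  proof -
    have "\<nu> (m + 1 + j) \<in> S" if "j < c" for j
      using that
    proof (induction j)
      case (Suc j)
      then show ?case using ST[OF st[of "m + 1 + j"]] m[of "m + 1 + j"] by simp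
    qed (use S in simp)
    then have "\<nu> ` {m + 1..<m + 1 + c} \<subseteq> S"
      by (auto simp: image_subset_iff) (metis add_Suc_right add_less_cancel_left less_eqE add_Suc)
    then show ?thesis using cycfun_range[OF cf, of "m + 1"] by simp
  qed
  have "\<nu> (m + 1) \<in> X \<or> \<nu> (m + 1) \<in> Y" using XY(2)[OF st[of "m + 1"]] by auto
  moreover have "y \<in> X" if "{x, y} \<in> E" "x \<in> X" "x \<noteq> z" for x y using that XY by blast
  moreover have "y \<in> Y" if "{x, y} \<in> E" "x \<in> Y" "x \<noteq> z" for x y using that XY by blast
  ultimately have "range \<nu> \<subseteq> X \<or> range \<nu> \<subseteq> Y" using stay by metis
  moreover have "xs \<noteq> []" using c3 by (auto simp: c_def)
  ultimately show ?thesis using range_cyc[of xs] by (simp add: \<nu>_def)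
qed

lemma odd_cyc_excluded:
  assumes V: "finite V" and g: "extremal_shape k V E" and cyc: "is_cyc E xs" "length xs = 2 * k + 1"
  shows False
proof -
  have D: "card (set xs) = 2 * k + 1" using cyc by (auto simp: is_cyc_def is_path_def distinct_card)
  consider "card V \<le> 2 * k" "E = all_pairs V" | "card V \<le> 4 * k - 1" "2 * k + 1 \<le> card V" "two_cliques k V E"
    | "clique_join k V E" | "balanced_bipartite V E"
    using g by (auto simp: extremal_shape_def Let_def)
  then show False
  proof cases
    case 1
    \<comment> \<open>The complete graph is treated as a single block: \<open>Y\<close> is empty and
      the shared vertex is an arbitrary value.\<close>
    have "set xs \<subseteq> V \<or> set xs \<subseteq> {}"
      by (rule cyc_in_block[OF cyc(1), of V "{}" undefined]) (use 1 in \<open>auto simp: all_pairs_def\<close>)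
    then have "set xs \<subseteq> V" by auto
    from card_mono[OF V this] show False using D 1 by simp
  next
    case 2
    then obtain X Y z where XY: "V = X \<union> Y" "X \<inter> Y = {z}" "card X = 2 * k"
      "card Y = card V - 2 * k + 1" "E = all_pairs X \<union> all_pairs Y" by (auto simp: two_cliques_def)
    have "set xs \<subseteq> X \<or> set xs \<subseteq> Y"
      using XY by (intro cyc_in_block[OF cyc(1), of X Y z]) (auto simp: all_pairs_def)
    \<comment> \<open>Here \<open>card V \<le> 4 * k - 1\<close> enters: it keeps the second clique
      at no more than \<open>2 * k\<close> vertices.\<close>
    moreover have "finite X" "finite Y" "card Y \<le> 2 * k" using V XY 2 by auto
    ultimately show False using card_mono[of X "set xs"] card_mono[of Y "set xs"] D XY by auto
  next
    case 3
    then obtain A where "A \<subseteq> V" "card A = k" "E = {e \<in> all_pairs V. e \<inter> A \<noteq> {}}" by (auto simp: clique_join_def)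
    then show False using cyc_vertex_cover[OF cyc(1), of A] V cyc(2) by (auto dest: finite_subset)
  next
    case 4
    then obtain X Y where XY: "X \<inter> Y = {}" "E = {{x, y} | x y. x \<in> X \<and> y \<in> Y}" by (auto simp: balanced_bipartite_def)
    then have "even (length xs)"
      by (intro bipartite_cyc_even[OF cyc(1), of X]) (auto simp: doubleton_eq_iff)
    then show False using cyc(2) by simp
  qed
qed

text \<open>On the overlap the two formulas agree: both give \<open>(2 * k - 1)\<^sup>2\<close> at
  \<open>4 * k - 2\<close> and \<open>2 * k * (2 * k - 1)\<close> at
  \<open>4 * k - 1\<close>.\<close>

lemma ex_value_large: "1 \<le> k \<Longrightarrow> 4 * k - 2 \<le> n \<Longrightarrow> ex_value k n = n\<^sup>2 div 4"
proof -
  assume k: "1 \<le> k" and n: "4 * k - 2 \<le> n"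
  obtain q where q: "k = q + 1" using k by (metis add.commute le_Suc_ex)
  consider "n = 4 * k - 2" | "n = 4 * k - 1" | "4 * k \<le> n" using n by linarith
  then show ?thesis
  proof cases
    case 1
    have "2 * ((2 * k choose 2) + (2 * k - 1 choose 2)) = 2 * (2 * k - 1)\<^sup>2"
      unfolding distrib_left choose2 using q by (simp add: power2_eq_square algebra_simps)
    moreover have "n\<^sup>2 div 4 = (2 * k - 1)\<^sup>2"
    proof -
      have "n = 2 * (2 * k - 1)" using 1 by simp
      then show ?thesis by (simp add: power_mult_distrib)
    qed
    moreover have "n - 2 * k + 1 = 2 * k - 1" using 1 q by simp
    ultimately show ?thesis using 1 q unfolding ex_value_def by (cases "n \<le> 2 * k") auto
  next
    case 2
    have "4 * ((2 * k choose 2) + (2 * k choose 2)) = n\<^sup>2 - 1"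
      using 2 q choose2[of "2 * k"] by (simp add: power2_eq_square algebra_simps)
    moreover have "n\<^sup>2 \<ge> 1" using 2 q by simp
    ultimately have "n\<^sup>2 = 4 * ((2 * k choose 2) + (2 * k choose 2)) + 1" by linarith
    then have "n\<^sup>2 div 4 = (2 * k choose 2) + (2 * k choose 2)" by simp
    moreover have "n - 2 * k + 1 = 2 * k" using 2 q by simp
    ultimately show ?thesis using 2 q unfolding ex_value_def by auto
  next
    case 3
    then show ?thesis using q by (simp add: ex_value_def)
  qed
qed

lemma half_product: "((n + 1) div 2) * (n div 2) = n\<^sup>2 div (4 :: nat)"
proof (cases "even n")
  case True
  then obtain m where "n = 2 * m" by auto
  then show ?thesis by (simp add: power_mult_distrib power2_eq_square)
next
  case False
  then obtain m where "n = 2 * m + 1" by (elim oddE)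
  moreover have "(2 * m + 1)\<^sup>2 = 4 * ((m + 1) * m) + 1" by (simp add: power2_eq_square algebra_simps)
  ultimately show ?thesis by simp
qed

text \<open>For the join on n vertices, with n between 2k + 1 and 4k - 1, twice the difference
  between \<open>ex_value k n\<close> and its number of edges is (n - 3k)(n - 3k + 1). It vanishes
  exactly at the two listed orders.\<close>

lemma card_shape:
  assumes V: "finite V" and g: "extremal_shape k V E" and k: "2 \<le> k"
  shows "card E = ex_value k (card V)"
proof -
  let ?n = "card V"
  consider "?n \<le> 2 * k" "E = all_pairs V" | "?n \<le> 4 * k - 1" "2 * k + 1 \<le> ?n" "two_cliques k V E"
    | "?n \<in> {3 * k - 1, 3 * k}" "clique_join k V E" | "4 * k - 2 \<le> ?n" "balanced_bipartite V E"
    using g by (auto simp: extremal_shape_def Let_def)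
  then show ?thesis
  proof cases
    case 1
    then show ?thesis using card_all_pairs[OF V] by (simp add: ex_value_def)
  next
    case 2
    then obtain X Y z where XY: "V = X \<union> Y" "X \<inter> Y = {z}" "card X = 2 * k"
      "card Y = ?n - 2 * k + 1" "E = all_pairs X \<union> all_pairs Y" by (auto simp: two_cliques_def)
    have fin: "finite X" "finite Y" using XY V by auto
    have "all_pairs X \<inter> all_pairs Y = {}"
    proof (rule ccontr)
      assume "\<not> ?thesis"
      then obtain e where e: "e \<subseteq> X" "e \<subseteq> Y" "card e = 2" by (auto simp: all_pairs_def)
      then have "card e \<le> card {z}" using XY(2) by (intro card_mono) auto
      then show False using e by simp
    qed
    moreover have "finite (all_pairs X)" "finite (all_pairs Y)" using fin by (auto simp: all_pairs_def)
    ultimately have "card E = (2 * k choose 2) + (?n - 2 * k + 1 choose 2)"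
      unfolding XY(5) using XY(3,4) fin by (simp add: card_Un_disjoint card_all_pairs)
    then show ?thesis using 2 unfolding ex_value_def by auto
  next
    case 3
    then obtain A where A: "A \<subseteq> V" "card A = k" "E = {e \<in> all_pairs V. e \<inter> A \<noteq> {}}" by (auto simp: clique_join_def)
    have "all_pairs V = E \<union> all_pairs (V - A)" "E \<inter> all_pairs (V - A) = {}"
      unfolding A(3) by (auto simp: all_pairs_def)
    moreover have "finite (all_pairs V)" using V by (simp add: all_pairs_def)
    ultimately have "card (all_pairs V) = card E + card (all_pairs (V - A))"
      by (metis card_Un_disjoint finite_Un)
    moreover have "card (V - A) = ?n - k" using A V by (simp add: card_Diff_subset finite_subset)
    ultimately have "2 * (?n choose 2) = 2 * card E + 2 * (?n - k choose 2)"
      using V by (simp add: card_all_pairs)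
    then have eE: "?n * (?n - 1) = 2 * card E + (?n - k) * (?n - k - 1)" unfolding choose2 .
    obtain q where q: "k = q + 2" using k by (metis add.commute le_Suc_ex)
    have "2 * ((2 * k choose 2) + (?n - 2 * k + 1 choose 2)) = 2 * card E"
      unfolding distrib_left choose2 using 3(1) eE q by (auto simp: algebra_simps)
    then show ?thesis using 3(1) q unfolding ex_value_def by auto
  next
    case 4
    then obtain X Y where XY: "V = X \<union> Y" "X \<inter> Y = {}" "card X = (?n + 1) div 2" "card Y = ?n div 2"
      "E = {{x, y} | x y. x \<in> X \<and> y \<in> Y}" by (auto simp: balanced_bipartite_def)
    have "E = (\<lambda>(x, y). {x, y}) ` (X \<times> Y)" using XY(5) by auto
    moreover have "inj_on (\<lambda>(x, y). {x, y}) (X \<times> Y)"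
      using XY(2) by (auto simp: inj_on_def doubleton_eq_iff)
    ultimately have "card E = card X * card Y" by (simp add: card_image card_cartesian_product)
    then show ?thesis using XY(3,4) ex_value_large[of k ?n] 4(1) k half_product[of ?n] by simp
  qed
qed

section \<open>Isomorphisms with the model graphs\<close>

lemma all_pairs_image:
  assumes "inj_on f S" shows "(`) f ` all_pairs S = all_pairs (f ` S)"
proof (intro equalityI subsetI)
  fix e assume "e \<in> (`) f ` all_pairs S"
  then obtain d where "e = f ` d" "d \<subseteq> S" "card d = 2" by (auto simp: all_pairs_def)
  then show "e \<in> all_pairs (f ` S)"
    using assms by (auto simp: all_pairs_def card_image inj_on_subset)
next
  fix e assume e: "e \<in> all_pairs (f ` S)"
  then obtain d where "d \<subseteq> S" "e = f ` d" unfolding all_pairs_def by (auto elim: subset_imageE)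
  moreover from this have "card d = 2" using e assms
    by (metis (mono_tags, lifting) all_pairs_def card_image inj_on_subset mem_Collect_eq)
  ultimately show "e \<in> (`) f ` all_pairs S" by (auto simp: all_pairs_def)
qed

lemma bij_parts:
  assumes "finite A" "finite B" "finite A'" "finite B'" "card A = card A'" "card B = card B'"
    "A \<inter> B = {}" "A' \<inter> B' = {}"
  shows "\<exists>f. bij_betw f (A \<union> B) (A' \<union> B') \<and> f ` A = A' \<and> f ` B = B'"
proof -
  obtain g h where gh: "bij_betw g A A'" "bij_betw h B B'"
    using assms finite_same_card_bij by metis
  define f where "f x = (if x \<in> A then g x else h x)" for x
  have "bij_betw f A A' = bij_betw g A A'" by (rule bij_betw_cong) (simp add: f_def)
  moreover have "bij_betw f B B' = bij_betw h B B'"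
    by (rule bij_betw_cong) (use assms(7) in \<open>auto simp: f_def\<close>)
  ultimately have f: "bij_betw f A A'" "bij_betw f B B'" using gh by simp_all
  then show ?thesis using assms(8) by (intro exI[of _ f]) (auto simp: bij_betw_combine bij_betw_def[of f A] bij_betw_def[of f B])
qed

lemma clique_join_iso:
  assumes "finite V" "finite V'" "card V = card V'" "clique_join k V E" "clique_join k V' E'"
  shows "graph_iso (V, E) (V', E')"
proof -
  obtain A A' where A: "A \<subseteq> V" "card A = k" "E = {e \<in> all_pairs V. e \<inter> A \<noteq> {}}"
    "A' \<subseteq> V'" "card A' = k" "E' = {e \<in> all_pairs V'. e \<inter> A' \<noteq> {}}"
    using assms by (auto simp: clique_join_def)
  have fin: "finite A" "finite A'" using A assms finite_subset by auto
  obtain f where f: "bij_betw f (A \<union> (V - A)) (A' \<union> (V' - A'))" "f ` A = A'" "f ` (V - A) = V' - A'"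
    using bij_parts[of A "V - A" A' "V' - A'"] A fin assms by (auto simp: card_Diff_subset)
  have "A \<union> (V - A) = V" "A' \<union> (V' - A') = V'" using A by auto
  then have bij: "bij_betw f V V'" using f(1) by simp
  then have inj: "inj_on f V" and im: "f ` V = V'" by (auto simp: bij_betw_def)
  have "f ` e \<inter> A' \<noteq> {} \<longleftrightarrow> e \<inter> A \<noteq> {}" if "e \<subseteq> V" for e
    using f(2,3) that by blast
  then have "(`) f ` E = {e \<in> (`) f ` all_pairs V. e \<inter> A' \<noteq> {}}"
    unfolding A(3) by (auto simp: all_pairs_def)
  then have "(`) f ` E = E'" unfolding A(6) all_pairs_image[OF inj] im .
  then show ?thesis using bij by (auto simp: graph_iso_def)
qed

lemma balanced_bipartite_iso:
  assumes "finite V" "finite V'" "card V = card V'" "balanced_bipartite V E" "balanced_bipartite V' E'"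
  shows "graph_iso (V, E) (V', E')"
proof -
  obtain X Y X' Y' where X: "V = X \<union> Y" "X \<inter> Y = {}" "card X = (card V + 1) div 2"
     "card Y = card V div 2" "E = {{x, y} | x y. x \<in> X \<and> y \<in> Y}"
     "V' = X' \<union> Y'" "X' \<inter> Y' = {}" "card X' = (card V' + 1) div 2"
     "card Y' = card V' div 2" "E' = {{x, y} | x y. x \<in> X' \<and> y \<in> Y'}"
    using assms(4,5) unfolding balanced_bipartite_def by blast
  have fin: "finite X" "finite X'" "finite Y" "finite Y'" using X(1,6) assms(1,2) by auto
  have "card X = card X'" "card Y = card Y'" using X(3,4,8,9) assms(3) by auto
  then obtain f where f: "bij_betw f V V'" "f ` X = X'" "f ` Y = Y'"
    using bij_parts[of X Y X' Y'] X(1,2,6,7) fin by auto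
  have "(`) f ` E = E'"
    unfolding X(5,10) f(2,3)[symmetric] by (auto simp: image_iff) blast+
  then show ?thesis using f(1) by (auto simp: graph_iso_def)
qed

text \<open>The bijections of the two cliques are both chosen to send \<open>z\<close> to
  \<open>z'\<close>, so they agree on the overlap and can be glued.\<close>

lemma two_cliques_iso:
  assumes "finite V" "finite V'" "card V = card V'" "two_cliques k V E" "two_cliques k V' E'"
  shows "graph_iso (V, E) (V', E')"
proof -
  obtain X Y z X' Y' z' where X: "V = X \<union> Y" "X \<inter> Y = {z}" "card X = 2 * k"
     "card Y = card V - 2 * k + 1" "E = all_pairs X \<union> all_pairs Y"
     "V' = X' \<union> Y'" "X' \<inter> Y' = {z'}" "card X' = 2 * k"
     "card Y' = card V' - 2 * k + 1" "E' = all_pairs X' \<union> all_pairs Y'"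
    using assms(4,5) unfolding two_cliques_def by blast
  have fin: "finite X" "finite X'" "finite Y" "finite Y'" using X(1,6) assms(1,2) by auto
  have z: "z \<in> X" "z \<in> Y" "z' \<in> X'" "z' \<in> Y'" using X(2,7) by auto
  obtain g where g: "bij_betw g (X - {z} \<union> {z}) (X' - {z'} \<union> {z'})" "g ` {z} = {z'}"
    using bij_parts[of "X - {z}" "{z}" "X' - {z'}" "{z'}"] fin X(3,8) z by auto
  obtain h where h: "bij_betw h (Y - {z} \<union> {z}) (Y' - {z'} \<union> {z'})" "h ` {z} = {z'}"
    using bij_parts[of "Y - {z}" "{z}" "Y' - {z'}" "{z'}"] fin X(4,9) assms(3) z by auto
  have g: "bij_betw g X X'" "g z = z'" using g z by (auto simp: insert_absorb)
  have h: "bij_betw h Y Y'" "h z = z'" using h z by (auto simp: insert_absorb)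
  define f where "f x = (if x \<in> X then g x else h x)" for x
  have fX: "f x = g x" if "x \<in> X" for x using that by (simp add: f_def)
  have fY: "f x = h x" if "x \<in> Y" for x
    using that g(2) h(2) X(2) by (cases "x = z") (auto simp: f_def)
  have imX: "f ` X = X'" using g fX by (simp add: bij_betw_def cong: image_cong)
  have imY: "f ` Y = Y'" using h fY by (simp add: bij_betw_def cong: image_cong)
  have injX: "inj_on f X" using g fX by (auto simp: bij_betw_def inj_on_def)
  have injY: "inj_on f Y" using h fY by (auto simp: bij_betw_def inj_on_def)
  have cross: "x = y" if "x \<in> X" "y \<in> Y" "f x = f y" for x y
  proof -
    have "f x \<in> X' \<inter> Y'" using that imX imY by (metis IntI imageI)
    then have "f x = f z" "f y = f z" using X(7) that(3) g(2) z fX by auto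
    then show ?thesis using that injX injY z by (metis inj_onD)
  qed
  have "inj_on f V"
  proof (rule inj_onI)
    fix x y assume "x \<in> V" "y \<in> V" "f x = f y"
    then show "x = y"
      using cross[of x y] cross[of y x] inj_onD[OF injX, of x y] inj_onD[OF injY, of x y] X(1) by auto
  qed
  moreover have "f ` V = V'" unfolding X(1,6) image_Un imX imY ..
  ultimately have "bij_betw f V V'" by (simp add: bij_betw_def)
  moreover have "(`) f ` E = E'"
    unfolding X(5,10) image_Un all_pairs_image[OF injX] all_pairs_image[OF injY] imX imY ..
  ultimately show ?thesis by (auto simp: graph_iso_def)
qed

lemma complete_iso:
  assumes "finite V" "finite V'" "card V = card V'"
  shows "graph_iso (V, all_pairs V) (V', all_pairs V')"
proof -
  obtain f where "bij_betw f V V'" using assms finite_same_card_bij by metis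
  then show ?thesis using all_pairs_image[of f V] by (auto simp: graph_iso_def bij_betw_def)
qed

lemma two_blocks_two_cliques:
  assumes "1 \<le> k" "2 * k + 1 \<le> n"
  shows "two_cliques k (verts (two_blocks (2 * k) (n - 2 * k + 1))) (edges (two_blocks (2 * k) (n - 2 * k + 1)))"
    and "card (verts (two_blocks (2 * k) (n - 2 * k + 1))) = n"
proof -
  show 1: "card (verts (two_blocks (2 * k) (n - 2 * k + 1))) = n"
    using assms by (simp add: two_blocks_def)
  show "two_cliques k (verts (two_blocks (2 * k) (n - 2 * k + 1))) (edges (two_blocks (2 * k) (n - 2 * k + 1)))"
    unfolding two_cliques_def 1 using assms
    by (intro exI[of _ "{..<2 * k}"] exI[of _ "{2 * k - 1..<n}"] exI[of _ "2 * k - 1"])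
      (auto simp: two_blocks_def)
qed

lemma H1_clique_join:
  assumes "k \<le> n"
  shows "clique_join k (verts (H1 n k)) (edges (H1 n k))" and "card (verts (H1 n k)) = n"
proof -
  show "card (verts (H1 n k)) = n" by (simp add: H1_def)
  have "edges (H1 n k) = {e \<in> all_pairs {..<n}. e \<inter> {..<k} \<noteq> {}}"
  proof (intro equalityI subsetI)
    fix e assume "e \<in> edges (H1 n k)"
    then show "e \<in> {e \<in> all_pairs {..<n}. e \<inter> {..<k} \<noteq> {}}"
    proof (cases "e \<in> all_pairs {..<k}")
      case True
      then show ?thesis using assms by (auto simp: all_pairs_def card_2_iff)
    next
      case False
      then obtain u v where "e = {u, v}" "u < k" "k \<le> v" "v < n"
        using \<open>e \<in> edges (H1 n k)\<close> assms by (auto simp: H1_def complete_bipartite_def)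
      then show ?thesis by (auto simp: pair_in_all_pairs)
    qed
  next
    fix e assume e: "e \<in> {e \<in> all_pairs {..<n}. e \<inter> {..<k} \<noteq> {}}"
    then obtain u where u: "u \<in> e" "u < k" by auto
    then obtain v where v: "e = {u, v}" "u \<noteq> v" using e by (auto simp: all_pairs_def card_2_iff)
    show "e \<in> edges (H1 n k)"
    proof (cases "v < k")
      case True
      then show ?thesis using u v by (auto simp: H1_def pair_in_all_pairs)
    next
      case False
      then show ?thesis using u v e assms
        by (auto simp: H1_def complete_bipartite_def all_pairs_def)
    qed
  qed
  then show "clique_join k (verts (H1 n k)) (edges (H1 n k))" unfolding clique_join_def
    using assms by (intro exI[of _ "{..<k}"]) (auto simp: H1_def)
qed

lemma bipartite_balanced_bipartite:
  fixes n :: nat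
  defines "K \<equiv> complete_bipartite ((n + 1) div 2) (n div 2)"
  shows "balanced_bipartite (verts K) (edges K)" and "card (verts K) = n"
proof -
  have n: "(n + 1) div 2 + n div 2 = n" by presburger
  then show 1: "card (verts K) = n" by (simp add: K_def complete_bipartite_def)
  show "balanced_bipartite (verts K) (edges K)" unfolding balanced_bipartite_def 1 using n
    by (intro exI[of _ "{..<(n + 1) div 2}"] exI[of _ "{(n + 1) div 2..<n}"])
      (auto simp: K_def complete_bipartite_def)
qed

lemma iso_card_edges:
  assumes "simple_graph G" "graph_iso G H"
  shows "card (edges G) = card (edges H)" "card (verts G) = card (verts H)"
proof -
  obtain f where f: "bij_betw f (verts G) (verts H)" "edges H = (`) f ` edges G"
    using assms by (auto simp: graph_iso_def)
  have "inj_on ((`) f) (Pow (verts G))" using f(1) by (auto simp: bij_betw_def inj_on_image_Pow)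
  moreover have "edges G \<subseteq> Pow (verts G)" using assms(1) by (auto simp: simple_graph_def all_pairs_def)
  ultimately show "card (edges G) = card (edges H)" using f(2) by (simp add: card_image inj_on_subset)
  show "card (verts G) = card (verts H)" using f(1) by (rule bij_betw_same_card)
qed

lemma iso_contains_copy:
  assumes "graph_iso G H" "contains_copy G F"
  shows "contains_copy H F"
proof -
  obtain f where f: "bij_betw f (verts G) (verts H)" "edges H = (`) f ` edges G"
    using assms by (auto simp: graph_iso_def)
  obtain g where g: "inj_on g (verts F)" "g ` verts F \<subseteq> verts G" "(`) g ` edges F \<subseteq> edges G"
    using assms by (auto simp: contains_copy_def)
  have "inj_on (f \<circ> g) (verts F)"
    using g f(1) by (intro comp_inj_on) (auto simp: bij_betw_def inj_on_subset)
  moreover have "(f \<circ> g) ` verts F \<subseteq> verts H" using g(2) f(1) by (auto simp: bij_betw_def)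
  moreover have "(`) (f \<circ> g) ` edges F \<subseteq> edges H"
    using g(3) unfolding f(2) by (auto simp: image_comp[symmetric] intro!: imageI)
  ultimately show ?thesis unfolding contains_copy_def by (intro exI[of _ "f \<circ> g"]) simp
qed

section \<open>Graphs of large minimum degree\<close>

text \<open>The increment serves as degree threshold in the induction. At \<open>4 * k - 1\<close>
  both of its forms equal \<open>2 * k - 1\<close>.\<close>

lemma ex_value_step:
  assumes "2 \<le> k" "2 * k + 1 \<le> n"
  shows "ex_value k n = ex_value k (n - 1) + (if n \<le> 4 * k - 1 then n - 2 * k else n div 2)"
proof (cases "n \<le> 4 * k - 1")
  case True
  obtain d where d: "n = 2 * k + d + 1" using assms by (metis add.commute add.assoc le_Suc_ex)
  have "(d + 2 choose 2) = (d + 1 choose 2) + (d + 1)" using choose2_Suc[of "d + 1"] by simp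
  then show ?thesis using True d assms by (cases "d = 0") (auto simp: ex_value_def)
next
  case False
  have "n\<^sup>2 div 4 = (n - 1)\<^sup>2 div 4 + n div 2"
  proof (cases "even n")
    case True
    then obtain m where m: "n = 2 * m" by auto
    then obtain q where "m = q + 1" using False assms(1) by (metis Suc_eq_plus1 mult_0_right not0_implies_Suc zero_le)
    moreover have "(2 * q + 1)\<^sup>2 = 4 * (q * q + q) + 1" by (simp add: power2_eq_square algebra_simps)
    ultimately show ?thesis using m by (simp add: power_mult_distrib) (simp add: power2_eq_square)
  next
    case False
    then obtain m where m: "n = 2 * m + 1" by (elim oddE)
    moreover have "(2 * m + 1)\<^sup>2 = 4 * (m * m + m) + 1" by (simp add: power2_eq_square algebra_simps)
    ultimately show ?thesis by (simp add: power_mult_distrib) (simp add: power2_eq_square)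
  qed
  then show ?thesis using False assms ex_value_large[of k n] ex_value_large[of k "n - 1"] by simp
qed

text \<open>The difference \<open>4 * ex_value k n - n\<^sup>2\<close> factors as (4k - 2 - n)(4k -
  n). In this range a graph with at most a quarter of \<open>n\<^sup>2\<close> edges can therefore
  be extremal only at \<open>4 * k - 2\<close>.\<close>

lemma ex_value_mid:
  assumes "2 \<le> k" "2 * k + 1 \<le> n" "n \<le> 4 * k - 2"
  shows "n\<^sup>2 \<le> 4 * ex_value k n" and "n\<^sup>2 = 4 * ex_value k n \<Longrightarrow> n = 4 * k - 2"
proof -
  have "ex_value k n = (2 * k choose 2) + (n - 2 * k + 1 choose 2)"
    using assms by (auto simp: ex_value_def)
  then have "2 * int (ex_value k n) = 2 * int (2 * k choose 2) + 2 * int (n - 2 * k + 1 choose 2)" by simp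
  also have "\<dots> = 2 * int k * (2 * int k - 1) + (int n - 2 * int k + 1) * (int n - 2 * int k)"
    unfolding choose2_int using assms by (simp add: of_nat_diff)
  finally have e: "4 * int (ex_value k n) = int n * int n + (4 * int k - 2 - int n) * (4 * int k - int n)"
    by (simp add: algebra_simps)
  have "(4 * int k - 2 - int n) * (4 * int k - int n) \<ge> 0" using assms by simp
  then have "int (n\<^sup>2) \<le> int (4 * ex_value k n)" using e by (simp add: power2_eq_square)
  then show "n\<^sup>2 \<le> 4 * ex_value k n" by (simp only: of_nat_le_iff)
  assume "n\<^sup>2 = 4 * ex_value k n"
  then have "int n * int n = 4 * int (ex_value k n)" by (metis of_nat_mult of_nat_numeral power2_eq_square)
  then have "(4 * int k - 2 - int n) * (4 * int k - int n) = 0" using e by simp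
  then show "n = 4 * k - 2" using assms by auto
qed

section \<open>Paths of prescribed order in complete and complete bipartite graphs\<close>

lemma clique_list:
  assumes "all_pairs X \<subseteq> E" "distinct ps" "set ps \<subseteq> X"
  shows "is_path E ps"
  using assms(2,3)
proof (induction ps)
  case (Cons a ps)
  moreover have "{a, hd ps} \<in> E" if "ps \<noteq> []"
  proof -
    have "hd ps \<in> set ps" using that by simp
    then have "{a, hd ps} \<in> all_pairs X" using Cons.prems by (auto simp: pair_in_all_pairs)
    then show ?thesis using assms(1) by auto
  qed
  ultimately show ?case by (auto simp: is_path_Cons)
qed simp

lemma clique_path:
  assumes "all_pairs X \<subseteq> E" "finite X" "u \<in> X" "w \<in> X" "u \<noteq> w" "2 \<le> m" "m \<le> card X"
  shows "\<exists>ps. is_path E ps \<and> length ps = m \<and> hd ps = u \<and> last ps = w \<and> set ps \<subseteq> X"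
proof -
  have "card (X - {u, w}) = card X - 2" using assms by (simp add: card_Diff_subset)
  then have "m - 2 \<le> card (X - {u, w})" using assms(7) by linarith
  then obtain D where D: "D \<subseteq> X - {u, w}" "card D = m - 2" "finite D"
    using obtain_subset_with_card_n by metis
  then obtain ds where ds: "set ds = D" "distinct ds" using finite_distinct_list by metis
  have "length ds = m - 2" using ds D by (metis distinct_card)
  then show ?thesis using assms D ds
    by (intro exI[of _ "u # ds @ [w]"] conjI clique_list[OF assms(1)]) auto
qed

text \<open>Two vertices are split off at the start: \<open>x\<close>, and a vertex of the other
  side different from the prescribed end \<open>y\<close>.\<close>

lemma alternating_path:
  assumes "finite X" "finite Y" "X \<inter> Y = {}" "\<And>x y. x \<in> X \<Longrightarrow> y \<in> Y \<Longrightarrow> {x, y} \<in> E"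
    "x \<in> X" "y \<in> Y" "1 \<le> m" "m \<le> card X" "m \<le> card Y"
  shows "\<exists>ps. is_path E ps \<and> length ps = 2 * m \<and> hd ps = x \<and> last ps = y \<and> set ps \<subseteq> X \<union> Y"
  using assms(7,1-6,8-9)
proof (induction m arbitrary: X Y x rule: nat_induct_at_least)
  case base
  then show ?case by (intro exI[of _ "[x, y]"]) (auto simp: is_path_Cons)
next
  case (Suc m)
  have "\<not> X \<subseteq> {x}" using Suc.prems Suc.hyps card_mono[of "{x}" X] by auto
  then obtain x' where x': "x' \<in> X" "x' \<noteq> x" by auto
  have "\<not> Y \<subseteq> {y}" using Suc.prems Suc.hyps card_mono[of "{y}" Y] by auto
  then obtain y' where y': "y' \<in> Y" "y' \<noteq> y" by auto
  have "\<exists>ps. is_path E ps \<and> length ps = 2 * m \<and> hd ps = x' \<and> last ps = y \<and> set ps \<subseteq> (X - {x}) \<union> (Y - {y'})"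
    using Suc.prems x' y' by (intro Suc.IH) (auto simp: card_Diff_singleton)
  then obtain ps where ps: "is_path E ps" "length ps = 2 * m" "hd ps = x'" "last ps = y"
    "set ps \<subseteq> (X - {x}) \<union> (Y - {y'})" by auto
  have "ps \<noteq> []" using ps(2) Suc.hyps by auto
  moreover have "{y', x'} \<in> E" using Suc.prems(4)[OF x'(1) y'(1)] by (simp add: insert_commute)
  moreover have "{x, y'} \<in> E" using Suc.prems(4)[OF Suc.prems(5) y'(1)] .
  moreover have "x \<noteq> y'" "x \<notin> set ps" "y' \<notin> set ps" using ps(5) Suc.prems(3,5) y' by auto
  ultimately show ?case using ps Suc.prems(5) y'
    by (intro exI[of _ "x # y' # ps"]) (auto simp: is_path_Cons)
qed

lemma extend_cyc:
  assumes "is_path E ps" "v \<notin> set ps" "2 \<le> length ps" "{hd ps, v} \<in> E" "{last ps, v} \<in> E"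
  shows "is_cyc E (v # ps)"
  using assms by (auto simp: is_cyc_def is_path_Cons insert_commute)

lemma is_cyc_mono: "is_cyc E xs \<Longrightarrow> E \<subseteq> E' \<Longrightarrow> is_cyc E' xs"
  by (auto simp: is_cyc_def is_path_def intro: successively_mono)

locale dense_graph = sgraph V E for V :: "'a set" and E +
  fixes k :: nat
  assumes k: "2 \<le> k" and free: "\<And>xs. is_cyc E xs \<Longrightarrow> length xs \<noteq> 2 * k + 1"
begin

lemma get_longest:
  assumes "is_cyc E xs"
  obtains c \<nu> where "longest_cycle V E c \<nu>" "length xs \<le> c"
proof -
  have "length ys \<le> card V" if "is_cyc E ys" for ys
  proof -
    have "{ys ! (i mod length ys), ys ! (Suc i mod length ys)} \<in> E" for i
      using is_cyc_cycfun[OF that] by (simp add: cycfun_def)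
    then have "range (\<lambda>i. ys ! (i mod length ys)) \<subseteq> V" using edgeD by blast
    moreover have "ys \<noteq> []" using that by (auto simp: is_cyc_def)
    ultimately have "set ys \<subseteq> V" by (simp add: range_cyc)
    moreover have "card (set ys) = length ys"
      using that by (auto simp: is_cyc_def is_path_def distinct_card)
    ultimately show ?thesis using card_mono[OF finV] by metis
  qed
  then have "\<forall>ys. is_cyc E ys \<longrightarrow> length ys < Suc (card V)" by (auto simp: less_Suc_eq_le)
  then obtain ys where ys: "is_cyc E ys" "\<And>zs. is_cyc E zs \<Longrightarrow> length zs \<le> length ys"
    using ex_has_greatest_nat[of "is_cyc E" xs length "Suc (card V)"] assms by blast
  have "longest_cycle V E (length ys) (\<lambda>i. ys ! (i mod length ys))"
    using ys is_cyc_cycfun[OF ys(1)] by unfold_locales auto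
  then show ?thesis using that ys(2)[OF assms] by blast
qed

text \<open>Larger degrees would force a cycle of at least \<open>2 * k + 1\<close>, hence more,
  vertices, and then the bound for a missing length contradicts the degree sum. At order
  \<open>4 * k - 1\<close> the threshold \<open>card V div 2\<close> equals the increment
  \<open>card V - 2 * k\<close>; at \<open>4 * k - 2\<close> it is larger by 1, so that order
  belongs to \<open>mid_range\<close>.\<close>

lemma high_range:
  assumes n: "4 * k - 1 \<le> card V"
  shows "\<exists>v\<in>V. card (nbrs E V v) \<le> card V div 2"
proof (rule ccontr)
  assume "\<not> ?thesis"
  then have deg: "\<And>v. v \<in> V \<Longrightarrow> card V div 2 + 1 \<le> card (nbrs E V v)" by (auto simp: not_le Suc_le_eq)
  have "V \<noteq> {}" using n k by auto
  moreover have "2 \<le> card V div 2 + 1" using n k by linarith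
  ultimately obtain xs where xs: "is_cyc E xs" "Suc (card V div 2 + 1) \<le> length xs"
    using long_cycle[of "card V div 2 + 1"] deg by metis
  obtain c \<nu> where lc: "longest_cycle V E c \<nu>" and c: "length xs \<le> c" by (rule get_longest[OF xs(1)])
  interpret longest_cycle V E c \<nu> by fact
  have "\<exists>ys. is_cyc E ys \<and> length ys = c" using cycfun_is_cyc[OF cyc] .
  then have "c \<noteq> 2 * k + 1" using free by blast
  then have lt: "2 * k + 1 < c" using c xs(2) n k by linarith
  have RV: "U \<union> (V - U) = V" using U_V by auto
  have cR: "card (V - U) = card V - c" using U_V finU cardU by (simp add: card_Diff_subset)
  have "4 * ecount E (U \<union> (V - U)) + (if V - U = {} then 0 else 1) \<le> (c + card (V - U))\<^sup>2"
    using lt k cR c xs(2) free by (intro missing_length_ecount[of "2 * k + 1"]) auto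
  moreover have "c \<le> card V" using card_mono[OF finV U_V] cardU by simp
  ultimately have e: "4 * ecount E V \<le> (card V)\<^sup>2" unfolding RV cR by simp
  have "(\<Sum>v\<in>V. card V div 2 + 1) \<le> (\<Sum>v\<in>V. card (nbrs E V v))" using deg by (rule sum_mono)
  then have "card V * (card V div 2 + 1) \<le> 2 * ecount E V" using handshake[OF finV] by simp
  then have up: "card V * (2 * (card V div 2 + 1)) \<le> (card V)\<^sup>2" using e by (simp add: algebra_simps)
  have half: "m + 1 \<le> 2 * (m div 2 + 1)" for m :: nat
    by presburger
  have "card V * (card V + 1) \<le> card V * (2 * (card V div 2 + 1))" by (rule mult_le_mono2[OF half])
  then have "card V * (card V + 1) \<le> card V * card V" using up by (simp only: power2_eq_square)
  moreover have "0 < card V" using n k by linarith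
  ultimately show False by simp
qed

text \<open>Only two shapes can appear without deleting a vertex: the join at
  \<open>3 * k - 1\<close>, when the longest cycle has length \<open>2 * k\<close>, and the balanced
  bipartite graph at \<open>4 * k - 2\<close>, when it is Hamiltonian.\<close>

lemma mid_range:
  assumes n: "2 * k + 1 \<le> card V" "card V \<le> 4 * k - 2"
    and deg: "\<And>v. v \<in> V \<Longrightarrow> card V - 2 * k + 1 \<le> card (nbrs E V v)"
    and many: "ex_value k (card V) \<le> card E"
  shows "card E = ex_value k (card V)" and "extremal_shape k V E"
proof -
  define d where "d = card V - 2 * k + 1"
  have ev: "ex_value k (card V) = (2 * k choose 2) + (d choose 2)" using n k by (auto simp: ex_value_def d_def)
  have "V \<noteq> {}" "2 \<le> d" using n k by (auto simp: d_def)
  then obtain xs where xs: "is_cyc E xs" "Suc d \<le> length xs"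
    using long_cycle[of d] deg unfolding d_def by metis
  obtain c \<nu> where lc: "longest_cycle V E c \<nu>" and "length xs \<le> c" by (rule get_longest[OF xs(1)])
  then have c: "Suc d \<le> c" using xs(2) by simp
  interpret longest_cycle V E c \<nu> by fact
  have "\<exists>ys. is_cyc E ys \<and> length ys = c" using cycfun_is_cyc[OF cyc] .
  then have c_ne: "c \<noteq> 2 * k + 1" using free by blast
  define R where "R = V - U"
  have RV: "U \<union> R = V" using U_V by (auto simp: R_def)
  have cV: "c \<le> card V" using card_mono[OF finV U_V] cardU by simp
  have cR: "card R = card V - c" using U_V finU cardU by (simp add: R_def card_Diff_subset)
  have bound: "card E \<le> (c choose 2) + (card R + 1 choose 2)"
    using extension_bound[of R] unfolding RV ecount_V by (simp add: R_def)
  have "card E = ex_value k (card V) \<and> extremal_shape k V E"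
  proof (cases c "2 * k" rule: linorder_cases)
    case less
    have e1: "2 * int (c choose 2) + 2 * int (card R + 1 choose 2) =
        int c * (int c - 1) + (int (card V) - int c + 1) * (int (card V) - int c)"
      unfolding choose2_int cR using cV by (simp add: of_nat_diff)
    have e2: "2 * int (2 * k choose 2) + 2 * int (d choose 2) =
        2 * int k * (2 * int k - 1) + (int (card V) - 2 * int k + 1) * (int (card V) - 2 * int k)"
      unfolding choose2_int d_def using n by (simp add: of_nat_diff)
    \<comment> \<open>This product is what the bound for \<open>c\<close> lacks compared with the
      one for \<open>2 * k\<close>; \<open>d\<close> and \<open>2 * k\<close> add up to
      \<open>card V + 1\<close> and give equal bounds.\<close>
    have "0 < (2 * int k - int c) * (int c - int d)" using less c by simp
    moreover have "int d = int (card V) - 2 * int k + 1" using n by (simp add: d_def of_nat_diff)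
    ultimately have "0 < (2 * int k - int c) * (int c - (int (card V) - 2 * int k + 1))" by simp
    then have "int (c choose 2) + int (card R + 1 choose 2) < int (2 * k choose 2) + int (d choose 2)"
      using e1 e2 by (simp add: algebra_simps)
    then have "card E < ex_value k (card V)" using bound ev by linarith
    then show ?thesis using many by simp
  next
    case equal
    have d: "card R + 1 = d" using cR equal by (simp add: d_def)
    have eE: "card E = ex_value k (card V)" using bound many ev d equal by simp
    have "card R \<noteq> 0" using cR n equal by simp
    then have "R \<noteq> {}" by (metis card.empty)
    moreover have "R \<subseteq> V - U" by (simp add: R_def)
    ultimately have R0: "R \<subseteq> V - U" "R \<noteq> {}" by auto
    have dR: "card R + 1 \<le> card (nbrs E (U \<union> R) v)" if "v \<in> R" for v
      using deg[of v] that unfolding RV d d_def by (simp add: R_def)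
    have eV: "ecount E (U \<union> R) = (c choose 2) + (card R + 1 choose 2)"
      unfolding RV ecount_V using eE ev d equal by simp
    have "c = 2 * (card R + 1)" using dense_outside(2)[OF R0 dR eV] .
    then have kR: "card R + 1 = k" using equal by simp
    have dk: "k \<le> card (nbrs E (U \<union> R) v)" if "v \<in> R" for v using dR[OF that] unfolding kR .
    have ek: "ecount E (U \<union> R) = (2 * k choose 2) + (k choose 2)" using eV unfolding kR equal .
    have "\<exists>A\<subseteq>V. card A = k \<and> E = {e \<in> all_pairs V. e \<inter> A \<noteq> {}}"
      by (rule tight_structure[OF equal R0 kR dk ek RV[symmetric]])
    then have "clique_join k V E" by (simp add: clique_join_def)
    moreover have "card V = 3 * k - 1" using kR cR equal n by linarith
    ultimately show ?thesis using eE by (auto simp: extremal_shape_def)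
  next
    case greater
    then have lt: "2 * k + 1 < c" using c_ne by simp
    have "4 * ecount E (U \<union> R) + (if R = {} then 0 else 1) \<le> (c + card R)\<^sup>2"
      using lt k cR cV n free by (intro missing_length_ecount[of "2 * k + 1"]) (auto simp: R_def)
    then have e: "4 * card E + (if R = {} then 0 else 1) \<le> (card V)\<^sup>2"
      unfolding RV ecount_V using cR cV by simp
    have ex: "(card V)\<^sup>2 \<le> 4 * ex_value k (card V)" "(card V)\<^sup>2 = 4 * ex_value k (card V) \<Longrightarrow> card V = 4 * k - 2"
      using ex_value_mid[OF k n] by auto
    have eE: "card E = ex_value k (card V)" "(card V)\<^sup>2 = 4 * ex_value k (card V)" and R0: "R = {}"
      using e ex(1) many by (auto split: if_splits)
    have nV: "card V = 4 * k - 2" using ex(2) eE(2) .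
    \<comment> \<open>The cycle has \<open>2 * m\<close> vertices and the missing length
      \<open>2 * k + 1\<close> is \<open>m + 2\<close>, which is the setting of
      \<open>alternating\<close>.\<close>
    define m where "m = 2 * k - 1"
    have cm: "c = 2 * m" and UV: "U = V" using nV RV R0 cardU k by (auto simp: m_def)
    interpret ml: missing_length V E c "2 * k + 1" \<nu> using cyc lt k free by unfold_locales auto
    have m_odd: "odd m" using k by (simp add: m_def)
    have alt: "{\<nu> i, \<nu> (i + s)} \<in> E" if "odd s" "s < c" for i s
    proof (rule ml.alternating[OF cm _ m_odd _ that])
      show "2 * k + 1 = m + 2" using k by (simp add: m_def)
      show "m \<le> card (nbrs E U (\<nu> i))" for i
        using deg[of "\<nu> i"] nV k unfolding UV[symmetric] by (simp add: m_def)
    qed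
    define X Y where "X = (\<lambda>t. \<nu> (2 * t)) ` {..<m}" and "Y = (\<lambda>t. \<nu> (2 * t + 1)) ` {..<m}"
    have inj: "x = y" if "\<nu> x = \<nu> y" "x < c" "y < c" for x y
      using inj_onD[OF cycfun_inj[OF cyc, of 0] that(1)] that by auto
    have "inj_on (\<lambda>t. \<nu> (2 * t)) {..<m}" "inj_on (\<lambda>t. \<nu> (2 * t + 1)) {..<m}"
      using inj cm by (auto simp: inj_on_def dest!: inj)
    then have cX: "card X = m" and cY: "card Y = m" by (simp_all add: X_def Y_def card_image)
    have dj: "X \<inter> Y = {}"
    proof (rule ccontr)
      assume "X \<inter> Y \<noteq> {}"
      then obtain a b where ab: "a < m" "b < m" "\<nu> (2 * a) = \<nu> (2 * b + 1)" by (auto simp: X_def Y_def)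
      then have "2 * a = 2 * b + 1" using cm by (intro inj) auto
      then show False by presburger
    qed
    have fin: "finite X" "finite Y" by (simp_all add: X_def Y_def)
    have "X \<union> Y \<subseteq> V" using UV by (auto simp: X_def Y_def)
    then have XY: "V = X \<union> Y"
      using finV cX cY dj fin nV k by (intro card_seteq[symmetric]) (auto simp: card_Un_disjoint m_def)
    have XYE: "{x, y} \<in> E" if xy: "x \<in> X" "y \<in> Y" for x y
    proof -
      obtain a b where ab: "a < m" "b < m" "x = \<nu> (2 * a)" "y = \<nu> (2 * b + 1)"
        using xy by (auto simp: X_def Y_def)
      show ?thesis
      proof (cases "a \<le> b")
        case True
        then obtain t where "b = a + t" using le_Suc_ex by blast
        then show ?thesis using alt[of "2 * t + 1" "2 * a"] ab cm by (simp add: algebra_simps)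
      next
        case False
        then obtain t where "a = b + t + 1" by (metis Suc_eq_plus1 add_Suc_right less_imp_Suc_add not_le add.assoc)
        then show ?thesis using alt[of "2 * t + 1" "2 * b + 1"] ab cm by (simp add: algebra_simps insert_commute)
      qed
    qed
    let ?T = "{{x, y} | x y. x \<in> X \<and> y \<in> Y}"
    have "?T = (\<lambda>(x, y). {x, y}) ` (X \<times> Y)" by auto
    moreover have "inj_on (\<lambda>(x, y). {x, y}) (X \<times> Y)"
      using dj by (auto simp: inj_on_def doubleton_eq_iff)
    ultimately have "card ?T = m * m" using cX cY by (simp add: card_image card_cartesian_product)
    moreover have "4 * card E = 4 * (m * m)"
      using eE nV k by (simp add: m_def power2_eq_square algebra_simps)
    ultimately have T: "E = ?T" using XYE finE by (intro card_seteq[symmetric]) auto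
    have h: "(card V + 1) div 2 = m" "card V div 2 = m" using nV k by (auto simp: m_def)
    have "balanced_bipartite V E" unfolding balanced_bipartite_def h
      by (intro exI[of _ X] exI[of _ Y] conjI) (rule XY dj cX cY T)+
    then show ?thesis using eE nV by (auto simp: extremal_shape_def)
  qed
  then show "card E = ex_value k (card V)" and "extremal_shape k V E" by auto
qed

end

section \<open>Adding a vertex to an extremal graph\<close>

lemma all_pairs_insert:
  "v \<notin> S \<Longrightarrow> all_pairs (insert v S) = all_pairs S \<union> (\<lambda>u. {u, v}) ` S"
  by (auto simp: all_pairs_def card_2_iff)

locale added_vertex = dense_graph V E k for V :: "'a set" and E k +
  fixes v :: 'a and W :: "'a set" and D :: "'a set set" and N :: "'a set"
  assumes v: "v \<notin> W" and V: "V = insert v W" and N: "N \<subseteq> W" and E_eq: "E = D \<union> (\<lambda>u. {u, v}) ` N"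
    and D: "D \<subseteq> all_pairs W"
begin

lemma finW: "finite W" and finN: "finite N" and cardV: "card V = Suc (card W)"
  using finV N v finite_subset by (auto simp: V)

lemma D_E: "D \<subseteq> E"
  by (auto simp: E_eq)

lemma N_edge: "u \<in> N \<Longrightarrow> {u, v} \<in> E"
  by (auto simp: E_eq)

text \<open>Every restriction on \<open>N\<close> below comes from a path on \<open>2 * k\<close>
  old vertices between two neighbours of \<open>v\<close>.\<close>

lemma no_closing_path:
  assumes "is_path E ps" "set ps \<subseteq> W" "length ps = 2 * k" "hd ps \<in> N" "last ps \<in> N"
  shows False
proof -
  have "is_cyc E (v # ps)" using assms k v by (intro extend_cyc N_edge) auto
  from free[OF this] show False using assms(3) by simp
qed

lemma clique_attachment:
  assumes "all_pairs X \<subseteq> D" "X \<subseteq> W" "2 * k \<le> card X" "u \<in> N" "w \<in> N" "u \<in> X" "w \<in> X"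
  shows "u = w"
proof (rule ccontr)
  assume "u \<noteq> w"
  then obtain ps where ps: "is_path E ps" "length ps = 2 * k" "hd ps = u" "last ps = w" "set ps \<subseteq> X"
    using clique_path[of X E u w "2 * k"] assms D_E finW finite_subset[of X W] k by auto
  moreover have "set ps \<subseteq> W" using ps(5) assms(2) by simp
  ultimately show False using no_closing_path[of ps] assms(4,5) by simp
qed

lemma clique_attachment_card:
  assumes "all_pairs X \<subseteq> D" "X \<subseteq> W" "2 * k \<le> card X"
  shows "card (N \<inter> X) \<le> 1"
  using clique_attachment[OF assms] finN card_le_Suc0_iff_eq[of "N \<inter> X"] by auto

lemma add_to_complete:
  assumes "D = all_pairs W" "card W = 2 * k" "card N = 1"
  shows "two_cliques k V E"
proof -
  obtain u where u: "N = {u}" using assms(3) by (auto simp: card_1_singleton_iff)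
  then have uv: "u \<noteq> v" "u \<in> W" using N v by auto
  have "all_pairs {u, v} = {{u, v}}" using uv by (auto simp: all_pairs_def card_2_iff doubleton_eq_iff)
  then have "E = all_pairs W \<union> all_pairs {u, v}" using E_eq assms(1) u by simp
  moreover have "W \<inter> {u, v} = {u}" "V = W \<union> {u, v}" using uv v V by auto
  moreover have "card {u, v} = card V - 2 * k + 1" using uv cardV assms(2) by simp
  ultimately show ?thesis unfolding two_cliques_def using assms(2) by blast
qed

text \<open>A neighbour \<open>u \<noteq> z\<close> in \<open>X\<close> excludes others in
  \<open>X\<close>, so a further neighbour \<open>w\<close> lies in \<open>Y\<close> alone. A path
  of \<open>2 * k - 1\<close> vertices from \<open>u\<close> to \<open>z\<close> in
  \<open>X\<close>, prolonged by \<open>w\<close>, is then forbidden. So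
  \<open>N \<subseteq> Y\<close>, and the degree fills \<open>Y\<close>.\<close>

lemma add_to_blocks:
  assumes B: "two_cliques k W D" and W: "2 * k + 1 \<le> card W" and cN: "card N + 2 * k = card V"
  shows "two_cliques k V E"
proof -
  obtain X Y z where X: "W = X \<union> Y" "X \<inter> Y = {z}" "card X = 2 * k"
     "card Y = card W - 2 * k + 1" "D = all_pairs X \<union> all_pairs Y"
    using B by (auto simp: two_cliques_def)
  have fin: "finite X" "finite Y" using finW X(1) by auto
  have z: "z \<in> X" "z \<in> Y" using X(2) by auto
  have cY: "card Y = card N" using X(4) cN W cardV by linarith
  have att: "u = w" if "u \<in> N" "w \<in> N" "u \<in> X" "w \<in> X" for u w
    using clique_attachment[of X u w] that X by auto
  have NY: "N \<subseteq> Y"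
  proof (rule ccontr)
    assume "\<not> N \<subseteq> Y"
    then obtain u where u: "u \<in> N" "u \<in> X" "u \<noteq> z" using N X(1) z by blast
    have "2 \<le> card N" using cN W cardV by linarith
    then have "\<not> N \<subseteq> {u}" using card_mono[of "{u}" N] by auto
    then obtain w where w: "w \<in> N" "w \<noteq> u" by blast
    then have wY: "w \<in> Y" "w \<notin> X" using att[of u w] u N X(1) by auto
    have "all_pairs X \<subseteq> E" using X(5) D_E by auto
    then obtain ps where ps: "is_path E ps" "length ps = 2 * k - 1" "hd ps = u" "last ps = z" "set ps \<subseteq> X"
    proof -
      have "2 \<le> 2 * k - 1" "2 * k - 1 \<le> card X" using k X(3) by linarith+
      then show ?thesis
        using clique_path[OF \<open>all_pairs X \<subseteq> E\<close> fin(1) u(2) z(1) u(3)] that by blast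
    qed
    have "{z, w} \<in> all_pairs Y" using z wY by (auto simp: pair_in_all_pairs)
    then have "{z, w} \<in> E" using X(5) D_E by auto
    moreover have "ps \<noteq> []" using ps(2) k by auto
    moreover have "w \<notin> set ps" using ps(5) wY by auto
    ultimately have "is_path E (ps @ [w])" using ps by (auto simp: is_path_append)
    then show False
      using no_closing_path[of "ps @ [w]"] ps w u wY X(1) k \<open>ps \<noteq> []\<close> by (auto simp: hd_append)
  qed
  then have NY: "N = Y" using fin cY by (intro card_subset_eq) auto
  have "v \<notin> Y" using v X(1) by auto
  then have "E = all_pairs X \<union> all_pairs (insert v Y)" using E_eq X(5) NY by (auto simp: all_pairs_insert)
  moreover have "X \<inter> insert v Y = {z}" "V = X \<union> insert v Y" using X(1,2) v V by auto
  moreover have "card (insert v Y) = card V - 2 * k + 1"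
    using X(4) \<open>v \<notin> Y\<close> fin cardV W by simp
  ultimately show ?thesis unfolding two_cliques_def using X(3) by blast
qed

text \<open>Both cliques have \<open>2 * k\<close> vertices and each accepts at most one neighbour.
  This ends the two-clique graphs at order \<open>4 * k - 1\<close>.\<close>

lemma add_to_two_large_blocks:
  assumes B: "two_cliques k W D" and W: "card W = 4 * k - 1" and cN: "2 < card N"
  shows False
proof -
  obtain X Y z where X: "W = X \<union> Y" "X \<inter> Y = {z}" "card X = 2 * k"
     "card Y = card W - 2 * k + 1" "D = all_pairs X \<union> all_pairs Y"
    using B by (auto simp: two_cliques_def)
  have "card (N \<inter> X) \<le> 1" by (rule clique_attachment_card) (use X in auto)
  moreover have "card (N \<inter> Y) \<le> 1" by (rule clique_attachment_card) (use X W k in auto)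
  moreover have "N = (N \<inter> X) \<union> (N \<inter> Y)" using N X(1) by auto
  ultimately show False using cN card_Un_le[of "N \<inter> X" "N \<inter> Y"] by simp
qed

lemma bipartite_attachment:
  assumes "X \<inter> Y = {}" "X \<union> Y \<subseteq> W" "\<And>x y. x \<in> X \<Longrightarrow> y \<in> Y \<Longrightarrow> {x, y} \<in> D"
    "k \<le> card X" "k \<le> card Y"
  shows "N \<inter> X = {} \<or> N \<inter> Y = {}"
proof (rule ccontr)
  assume "\<not> ?thesis"
  then obtain x y where xy: "x \<in> N" "x \<in> X" "y \<in> N" "y \<in> Y" by auto
  have fin: "finite X" "finite Y" using assms(2) finW finite_subset by auto
  have e: "{a, b} \<in> E" if "a \<in> X" "b \<in> Y" for a b using assms(3)[OF that] D_E by auto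
  obtain ps where ps: "is_path E ps" "length ps = 2 * k" "hd ps = x" "last ps = y" "set ps \<subseteq> X \<union> Y"
    using alternating_path[OF fin assms(1) e xy(2,4) _ assms(4,5)] k by auto
  then show False using no_closing_path[of ps] xy assms(2) by auto
qed

text \<open>All neighbours lie in one part, and there are as many of them as \<open>X\<close> has
  vertices; \<open>Y\<close> is possible only if the two parts have equal size.\<close>

lemma add_to_bipartite:
  assumes T: "balanced_bipartite W D" and W: "2 * k \<le> card W" and cN: "card N = card V div 2"
  shows "balanced_bipartite V E"
proof -
  obtain X Y where X: "W = X \<union> Y" "X \<inter> Y = {}" "card X = (card W + 1) div 2"
     "card Y = card W div 2" "D = {{x, y} | x y. x \<in> X \<and> y \<in> Y}"
    using T unfolding balanced_bipartite_def by blast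
  have fin: "finite X" "finite Y" using finW X(1) by auto
  have XY: "{x, y} \<in> D" if "x \<in> X" "y \<in> Y" for x y using that X(5) by auto
  have "N \<inter> X = {} \<or> N \<inter> Y = {}"
    using X W by (intro bipartite_attachment) (auto intro: XY)
  then show ?thesis
  proof
    assume "N \<inter> Y = {}"
    then have "N = X" using fin X cN cardV N by (intro card_subset_eq) auto
    then have "E = {{x, y} | x y. x \<in> insert v Y \<and> y \<in> X}"
      unfolding E_eq X(5) by (auto simp: insert_commute)
    moreover have "V = insert v Y \<union> X" "insert v Y \<inter> X = {}" "v \<notin> Y" using X(1,2) v V by auto
    moreover from this have "card (insert v Y) = (card V + 1) div 2" using fin X(4) cardV by simp
    moreover have "card X = card V div 2" using X(3) cardV by simp
    ultimately show ?thesis unfolding balanced_bipartite_def by blast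
  next
    assume "N \<inter> X = {}"
    then have NY: "N \<subseteq> Y" using N X(1) by auto
    then have le: "card N \<le> card Y" using fin by (intro card_mono)
    have cYN: "card Y = card N" using le cN cardV X(4) by linarith
    then have "N = Y" using fin NY by (intro card_subset_eq) auto
    then have "E = {{x, y} | x y. x \<in> insert v X \<and> y \<in> Y}"
      unfolding E_eq X(5) by (auto simp: insert_commute)
    moreover have "V = insert v X \<union> Y" "insert v X \<inter> Y = {}" "v \<notin> X" using X(1,2) v V by auto
    moreover have "card (insert v X) = (card V + 1) div 2"
    proof -
      have "card X = card W div 2" using cYN cN X(3,4) cardV by simp
      then show ?thesis using fin \<open>v \<notin> X\<close> cardV by simp
    qed
    moreover have "card Y = card V div 2" using cYN cN by simp
    ultimately show ?thesis unfolding balanced_bipartite_def by blast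
  qed
qed

text \<open>Neighbours both in \<open>A\<close> and off \<open>A\<close> are excluded by an
  alternating path. If all were off \<open>A\<close>, two of them would be joined by a path
  \<open>u\<close>, \<open>a\<close>, \<open>b\<close>, ..., \<open>w\<close>, whose edge between
  \<open>a\<close> and \<open>b\<close> inside \<open>A\<close> gives the even number
  \<open>2 * k\<close> of vertices.\<close>

lemma add_to_H:
  assumes H: "clique_join k W D" and W: "3 * k - 1 \<le> card W" and cN: "k \<le> card N"
  shows "card N = k \<and> clique_join k V E"
proof -
  obtain A where A: "A \<subseteq> W" "card A = k" "D = {e \<in> all_pairs W. e \<inter> A \<noteq> {}}"
    using H by (auto simp: clique_join_def)
  define I where "I = W - A"
  have fin: "finite A" "finite I" using A(1) finW finite_subset by (auto simp: I_def)
  have cI: "2 * k - 1 \<le> card I" using A(1,2) W fin by (simp add: I_def card_Diff_subset)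
  have IA: "{x, y} \<in> D" if "x \<in> I" "y \<in> A" for x y
    using that A(1,3) by (auto simp: I_def pair_in_all_pairs)
  have AA: "{x, y} \<in> D" if "x \<in> A" "y \<in> A" "x \<noteq> y" for x y
    using that A(1,3) by (auto simp: pair_in_all_pairs)
  have "N \<inter> I = {} \<or> N \<inter> A = {}"
  proof (rule bipartite_attachment)
    show "I \<inter> A = {}" "I \<union> A \<subseteq> W" using A(1) by (auto simp: I_def)
    show "k \<le> card I" "k \<le> card A" using cI A(2) k by auto
  qed (rule IA)
  moreover have "N \<inter> A \<noteq> {}"
  proof
    assume "N \<inter> A = {}"
    then have NI: "N \<subseteq> I" using N by (auto simp: I_def)
    have "2 \<le> card N" using cN k by simp
    then obtain u where "u \<in> N" by fastforce
    have "\<not> N \<subseteq> {u}" using \<open>2 \<le> card N\<close> card_mono[of "{u}" N] by auto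
    then obtain w where uw: "u \<in> N" "w \<in> N" "u \<noteq> w" using \<open>u \<in> N\<close> by blast
    have "\<not> A \<subseteq> {}" using A(2) k by auto
    then obtain a where a: "a \<in> A" by blast
    have "\<not> A \<subseteq> {a}" using A(2) k card_mono[of "{a}" A] by auto
    then obtain b where ab: "b \<in> A" "a \<noteq> b" by blast
    have e: "{x, y} \<in> E" if "x \<in> A - {a}" "y \<in> I - {u}" for x y
      using IA[of y x] that D_E by (auto simp: insert_commute)
    have "\<exists>ps. is_path E ps \<and> length ps = 2 * (k - 1) \<and> hd ps = b \<and> last ps = w \<and>
        set ps \<subseteq> (A - {a}) \<union> (I - {u})"
      using fin e ab a uw NI A(2) cI k
      by (intro alternating_path) (auto simp: I_def card_Diff_singleton)
    then obtain ps where ps: "is_path E ps" "length ps = 2 * (k - 1)" "hd ps = b" "last ps = w"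
      "set ps \<subseteq> (A - {a}) \<union> (I - {u})" by auto
    have ps0: "ps \<noteq> []" using ps(2) k by auto
    have uI: "u \<in> I" using uw NI by auto
    have "{u, a} \<in> E" "{a, b} \<in> E" using IA[OF uI a] AA[OF a ab] D_E by auto
    moreover have "u \<noteq> a" "u \<notin> set ps" "a \<notin> set ps" using ps(5) uI a by (auto simp: I_def)
    ultimately have "is_path E (u # a # ps)" using ps ps0 by (auto simp: is_path_Cons)
    moreover have "set (u # a # ps) \<subseteq> W" using ps(5) uI a A(1) by (auto simp: I_def)
    moreover have "length (u # a # ps) = 2 * k" using ps(2) k by simp
    ultimately show False using no_closing_path[of "u # a # ps"] ps(4) ps0 uw by simp
  qed
  ultimately have "N \<subseteq> A" using N by (auto simp: I_def)
  then have NA: "N = A" using fin A(2) cN by (intro card_seteq) auto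
  have "E = {e \<in> all_pairs V. e \<inter> A \<noteq> {}}"
    unfolding E_eq A(3) NA V all_pairs_insert[OF v] using A(1) v by (auto simp: all_pairs_def)
  then show ?thesis using NA A(1,2) V unfolding clique_join_def by blast
qed

end

section \<open>The extremal number\<close>

text \<open>Bound and equality case go through one induction, because equality for the larger graph
  is decided by the shape of the smaller one.\<close>

theorem odd_cycle_bound:
  assumes "sgraph V E" "2 \<le> k" "V \<noteq> {}" "\<And>xs. is_cyc E xs \<Longrightarrow> length xs \<noteq> 2 * k + 1"
  shows "card E \<le> ex_value k (card V)" and "card E = ex_value k (card V) \<Longrightarrow> extremal_shape k V E"
proof -
  have "card E \<le> ex_value k (card V) \<and> (card E = ex_value k (card V) \<longrightarrow> extremal_shape k V E)"
    using assms(1,3,4)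
  proof (induction "card V" arbitrary: V E)
    case 0
    then show ?case by (auto simp: sgraph_def)
  next
    case (Suc m)
    interpret dense_graph V E k using Suc.prems assms(2) by (auto simp: dense_graph_def dense_graph_axioms_def)
    let ?n = "card V"
    have finAll: "finite (all_pairs V)" using finV by (auto simp: all_pairs_def)
    show ?case
    proof (cases "?n \<le> 2 * k")
      case True
      have le: "card E \<le> card (all_pairs V)" using E finAll by (intro card_mono)
      then have "E = all_pairs V" if "card E = card (all_pairs V)"
        using that E finAll by (intro card_subset_eq) auto
      then show ?thesis using le True card_all_pairs[OF finV] by (auto simp: ex_value_def extremal_shape_def)
    next
      case False
      then have n: "2 * k + 1 \<le> ?n" by simp
      define \<delta> where "\<delta> = (if ?n \<le> 4 * k - 1 then ?n - 2 * k else ?n div 2)"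
      have st: "ex_value k ?n = ex_value k (?n - 1) + \<delta>" using ex_value_step[OF k n] by (simp add: \<delta>_def)
      show ?thesis
      proof (cases "\<exists>v\<in>V. card (nbrs E V v) \<le> \<delta>")
        case True
        then obtain v where vV: "v \<in> V" "card (nbrs E V v) \<le> \<delta>" by auto
        define W D N where "W = V - {v}" and "D = {e \<in> E. v \<notin> e}" and "N = nbrs E V v"
        have D: "D \<subseteq> all_pairs W" using E by (auto simp: D_def W_def all_pairs_def)
        have E_eq: "E = D \<union> (\<lambda>u. {u, v}) ` N"
        proof (intro equalityI subsetI)
          fix e assume e: "e \<in> E"
          then obtain x y where xy: "e = {x, y}" "x \<in> V" "y \<in> V" using edgeD by (metis edge_cases)
          show "e \<in> D \<union> (\<lambda>u. {u, v}) ` N"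
          proof (cases "v \<in> e")
            case True
            then obtain u where "e = {u, v}" "u \<in> V" using xy by (auto simp: insert_commute)
            then show ?thesis using e by (auto simp: N_def nbrs_def)
          qed (use e in \<open>auto simp: D_def\<close>)
        qed (auto simp: D_def N_def nbrs_def)
        have NW: "N \<subseteq> W" using edgeD by (auto simp: N_def W_def nbrs_def)
        interpret added_vertex V E k v W D N
          using vV(1) E_eq NW D by unfold_locales (auto simp: W_def)
        have "D \<inter> (\<lambda>u. {u, v}) ` N = {}" by (auto simp: D_def)
        moreover have "inj_on (\<lambda>u. {u, v}) N" by (auto simp: inj_on_def doubleton_eq_iff)
        moreover have "finite D" using finE D_E finite_subset by auto
        ultimately have cE: "card E = card D + card N"
          using finN by (subst E_eq) (simp add: card_Un_disjoint card_image)
        have sg: "sgraph W D" using finW D by unfold_locales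
        have fr: "length xs \<noteq> 2 * k + 1" if "is_cyc D xs" for xs
          using free is_cyc_mono[OF that D_E] by blast
        have W0: "W \<noteq> {}" using cardV n k by auto
        have "m = card W" using Suc.hyps(2) cardV by simp
        from Suc.hyps(1)[OF this sg W0 fr]
        have IH: "card D \<le> ex_value k (card W)" "card D = ex_value k (card W) \<Longrightarrow> extremal_shape k W D"
          by auto
        have W_n: "card W = ?n - 1" using cardV by simp
        have le: "card E \<le> ex_value k ?n" using cE IH(1) vV(2) st W_n by (simp add: N_def)
        have "extremal_shape k V E" if eq: "card E = ex_value k ?n"
        proof -
          have st': "ex_value k ?n = ex_value k (card W) + \<delta>" using st W_n by simp
          have Nd: "card N \<le> \<delta>" using vV(2) by (simp add: N_def)
          have cN: "card N = \<delta>" using eq cE IH(1) Nd st' by linarith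
          have cD: "card D = ex_value k (card W)" using eq cE IH(1) Nd st' by linarith
          have sh: "extremal_shape k W D" using IH(2)[OF cD] .
          consider "card W \<le> 2 * k" "D = all_pairs W"
            | "2 * k + 1 \<le> card W" "card W \<le> 4 * k - 1" "two_cliques k W D"
            | "card W \<in> {3 * k - 1, 3 * k}" "clique_join k W D" | "4 * k - 2 \<le> card W" "balanced_bipartite W D"
            using sh by (auto simp: extremal_shape_def Let_def)
          then show ?thesis
          proof cases
            case 1
            then have "two_cliques k V E" using n W_n cN k by (intro add_to_complete) (auto simp: \<delta>_def)
            moreover have "?n \<le> 4 * k - 1" using 1(1) W_n k by linarith
            ultimately show ?thesis using n by (simp add: extremal_shape_def Let_def)
          next
            case 2
            show ?thesis
            proof (cases "card W = 4 * k - 1")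
              case True
              then have "2 < card N" using cN W_n n k by (auto simp: \<delta>_def)
              then show ?thesis using add_to_two_large_blocks[OF 2(3) True] by simp
            next
              case False
              then have "two_cliques k V E" using 2 cN W_n n by (intro add_to_blocks) (auto simp: \<delta>_def)
              moreover have "?n \<le> 4 * k - 1" using 2(2) False W_n by linarith
              ultimately show ?thesis using n by (simp add: extremal_shape_def Let_def)
            qed
          next
            case 3
            \<comment> \<open>The threshold is \<open>k\<close> or \<open>k + 1\<close> here, and
              \<open>add_to_H\<close> admits only \<open>k\<close>, that is, order
              \<open>3 * k\<close>.\<close>
            have "k \<le> \<delta>" using 3(1) n W_n k by (auto simp: \<delta>_def)
            then have "card N = k \<and> clique_join k V E" using 3 cN by (intro add_to_H) auto
            moreover from this have "?n = 3 * k" using 3(1) cN W_n n k by (auto simp: \<delta>_def split: if_splits)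
            ultimately show ?thesis by (auto simp: extremal_shape_def)
          next
            case 4
            have "\<delta> = ?n div 2" using 4(1) W_n n k by (auto simp: \<delta>_def)
            then have "balanced_bipartite V E" using 4 cN k by (intro add_to_bipartite) auto
            moreover have "4 * k - 2 \<le> ?n" using 4(1) W_n by linarith
            ultimately show ?thesis by (simp add: extremal_shape_def Let_def)
          qed
        qed
        then show ?thesis using le by simp
      next
        case False
        then have big: "\<delta> + 1 \<le> card (nbrs E V v)" if "v \<in> V" for v using that by (auto simp: not_le Suc_le_eq)
        show ?thesis
        proof (cases "?n \<le> 4 * k - 2")
          case True
          then have "?n \<le> 4 * k - 1" by linarith
          then have "\<delta> = ?n - 2 * k" by (simp add: \<delta>_def)
          then have dg: "\<And>v. v \<in> V \<Longrightarrow> ?n - 2 * k + 1 \<le> card (nbrs E V v)"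
            using big by simp
          show ?thesis
          proof (cases "ex_value k ?n \<le> card E")
            case many: True
            then show ?thesis using mid_range[OF n True dg many] by simp
          next
            case False
            then show ?thesis by simp
          qed
        next
          case False
          then have lo: "4 * k - 1 \<le> ?n" by linarith
          then obtain v where "v \<in> V" "card (nbrs E V v) \<le> ?n div 2" using high_range by auto
          \<comment> \<open>Only order \<open>4 * k - 1\<close> needs an argument, where the first
            form of \<delta> is still in force.\<close>
          moreover have "?n div 2 \<le> \<delta>"
          proof (cases "?n \<le> 4 * k - 1")
            case True
            then have n_eq: "?n = 2 * (2 * k - 1) + 1" using lo k by linarith
            have "(2 * (2 * k - 1) + 1) div 2 = 2 * k - 1" by simp
            then have "?n div 2 = 2 * k - 1" unfolding n_eq .
            moreover have "\<delta> = ?n - 2 * k" using True by (simp add: \<delta>_def)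
            ultimately show ?thesis using n_eq by linarith
          qed (simp add: \<delta>_def)
          ultimately show ?thesis using big[of v] by simp
        qed
      qed
    qed
  qed
  then show "card E \<le> ex_value k (card V)" and "card E = ex_value k (card V) \<Longrightarrow> extremal_shape k V E"
    by auto
qed

section \<open>Transfer to extremal numbers, cacti and isomorphism types\<close>

lemma free_of_odd_cycle_iff:
  assumes "simple_graph G" "2 \<le> k"
  shows "free_of (cycle_graph (2 * k + 1)) G \<longleftrightarrow> (\<forall>xs. is_cyc (edges G) xs \<longrightarrow> length xs \<noteq> 2 * k + 1)"
  using contains_cycle_iff[OF assms(1), of "2 * k + 1"] assms(2) by (auto simp: free_of_def)

lemma simple_sgraph: "simple_graph G \<Longrightarrow> sgraph (verts G) (edges G)"
  by (simp add: simple_graph_def sgraph_def)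

lemma shape_free:
  assumes "simple_graph G" "2 \<le> k" "extremal_shape k (verts G) (edges G)"
  shows "free_of (cycle_graph (2 * k + 1)) G"
proof -
  have "finite (verts G)" using assms(1) by (simp add: simple_graph_def)
  then show ?thesis
    unfolding free_of_odd_cycle_iff[OF assms(1,2)] using odd_cyc_excluded[OF _ assms(3)] by blast
qed

lemma simple_two_blocks: "2 \<le> a \<Longrightarrow> 2 \<le> b \<Longrightarrow> simple_graph (two_blocks a b)"
  using cactus_two_blocks[of a b] by (simp add: cactus_def)

lemma simple_complete_bipartite: "simple_graph (complete_bipartite a b)"
  by (auto simp: simple_graph_def complete_bipartite_def pair_in_all_pairs)

lemma simple_complete: "simple_graph (complete_graph n)"
  by (simp add: simple_graph_def complete_graph_def)

lemma simple_H1: "k \<le> n \<Longrightarrow> simple_graph (H1 n k)"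
  by (auto simp: simple_graph_def H1_def complete_bipartite_def pair_in_all_pairs) (auto simp: all_pairs_def)

lemma ex_number_odd_cycle:
  assumes "2 \<le> k" "1 \<le> n"
  shows "ex_number n (cycle_graph (2 * k + 1)) = ex_value k n"
proof -
  let ?C = "cycle_graph (2 * k + 1)"
  let ?S = "{card (edges G) | G :: nat ugraph. simple_graph G \<and> card (verts G) = n \<and> free_of ?C G}"
  have ub: "m \<le> ex_value k n" if m: "m \<in> ?S" for m
  proof -
    obtain G :: "nat ugraph" where G: "m = card (edges G)" "simple_graph G" "card (verts G) = n" "free_of ?C G"
      using m by auto
    have "verts G \<noteq> {}" using G(3) assms(2) by auto
    from odd_cycle_bound(1)[OF simple_sgraph[OF G(2)] assms(1) this] show ?thesis
      using G free_of_odd_cycle_iff[OF G(2) assms(1)] by auto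
  qed
  have "\<exists>G :: nat ugraph. simple_graph G \<and> card (verts G) = n \<and> extremal_shape k (verts G) (edges G)"
  proof -
    consider "n \<le> 2 * k" | "2 * k + 1 \<le> n" "n \<le> 4 * k - 1" | "4 * k - 2 \<le> n" using assms(1) by linarith
    then show ?thesis
    proof cases
      case 1
      then show ?thesis using simple_complete[of n]
        by (intro exI[of _ "complete_graph n"]) (auto simp: extremal_shape_def complete_graph_def)
    next
      case 2
      let ?G = "two_blocks (2 * k) (n - 2 * k + 1)"
      have "simple_graph ?G" using assms 2 by (intro simple_two_blocks) auto
      then show ?thesis using two_blocks_two_cliques[of k n] 2 assms
        by (intro exI[of _ ?G]) (auto simp: extremal_shape_def)
    next
      case 3
      then show ?thesis using bipartite_balanced_bipartite[of n] simple_complete_bipartite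
        by (intro exI[of _ "complete_bipartite ((n + 1) div 2) (n div 2)"]) (auto simp: extremal_shape_def)
    qed
  qed
  then obtain G :: "nat ugraph" where G: "simple_graph G" "card (verts G) = n"
    "extremal_shape k (verts G) (edges G)" by auto
  have "finite (verts G)" using G(1) by (simp add: simple_graph_def)
  then have "card (edges G) = ex_value k n" using card_shape[OF _ G(3) assms(1)] G(2) by simp
  then have "ex_value k n \<in> ?S" using G shape_free[OF G(1) assms(1) G(3)]
    by (intro CollectI exI[of _ G]) simp
  moreover have "finite ?S" using ub by (intro finite_subset[of ?S "{..ex_value k n}"]) auto
  ultimately show ?thesis unfolding ex_number_def using ub by (intro Max_eqI) auto
qed

text \<open>A cactus obeys the bound for all graphs, and the two-clique cactus attains it; so the
  maximum is found without an analysis of general cacti.\<close>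

lemma g_cactus_value:
  assumes k: "2 \<le> k" and n: "2 * k + 1 \<le> n" "n \<le> 4 * k - 1"
  shows "g_cactus n k = ex_value k n"
proof -
  let ?C = "cycle_graph (2 * k + 1)"
  let ?S = "{card (edges G) | G :: nat ugraph. (\<exists>ns. cactus G ns) \<and> card (verts G) = n \<and> free_of ?C G}"
  have ub: "m \<le> ex_value k n" if m: "m \<in> ?S" for m
  proof -
    obtain G :: "nat ugraph" where G: "m = card (edges G)" "\<exists>ns. cactus G ns" "card (verts G) = n" "free_of ?C G"
      using m by blast
    then have s: "simple_graph G" by (auto simp: cactus_def)
    have "verts G \<noteq> {}" using G(3) n by auto
    from odd_cycle_bound(1)[OF simple_sgraph[OF s] k this] show ?thesis
      using G free_of_odd_cycle_iff[OF s k] by auto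
  qed
  let ?G = "two_blocks (2 * k) (n - 2 * k + 1)"
  have c: "cactus ?G [2 * k, n - 2 * k + 1]" using k n by (intro cactus_two_blocks) auto
  have B: "two_cliques k (verts ?G) (edges ?G)" "card (verts ?G) = n" using two_blocks_two_cliques[of k n] k n by auto
  have s: "simple_graph ?G" using c by (simp add: cactus_def)
  have sh: "extremal_shape k (verts ?G) (edges ?G)" using B n by (auto simp: extremal_shape_def)
  have "finite (verts ?G)" using s by (simp add: simple_graph_def)
  then have "card (edges ?G) = ex_value k n" using card_shape[OF _ sh k] B(2) by simp
  moreover have "\<exists>ns. cactus ?G ns" using c by blast
  ultimately have "ex_value k n \<in> ?S" using B(2) shape_free[OF s k sh]
    by (intro CollectI exI[of _ ?G]) simp
  moreover have "finite ?S" using ub by (intro finite_subset[of ?S "{..ex_value k n}"]) auto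
  ultimately show ?thesis unfolding g_cactus_def using ub by (intro Max_eqI) auto
qed

lemma iso_extremal:
  assumes G: "simple_graph (G :: 'a ugraph)" and K: "simple_graph (K :: nat ugraph)" and iso: "graph_iso G K"
    and sh: "extremal_shape k (verts K) (edges K)" and c: "card (verts K) = n" and k: "2 \<le> k" "1 \<le> n"
  shows "extremal_graph n (cycle_graph (2 * k + 1)) G"
proof -
  have "finite (verts K)" using K by (simp add: simple_graph_def)
  then have "card (edges K) = ex_value k n" using card_shape[OF _ sh k(1)] c by simp
  moreover have "free_of (cycle_graph (2 * k + 1)) G"
    using shape_free[OF K k(1) sh] iso_contains_copy[OF iso] unfolding free_of_def by blast
  ultimately show ?thesis
    using G iso_card_edges[OF G iso] c ex_number_odd_cycle[OF k] by (simp add: extremal_graph_def)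
qed

theorem theorem1:
  fixes k n :: nat
  assumes "k \<ge> 2" and "n \<ge> 1"
  shows "(n \<le> 2 * k \<longrightarrow> ex_number n (cycle_graph (2 * k + 1)) = n choose 2) \<and>
    (2 * k + 1 \<le> n \<and> n \<le> 4 * k - 1 \<longrightarrow> ex_number n (cycle_graph (2 * k + 1)) = g_cactus n k) \<and>
    (4 * k - 2 \<le> n \<longrightarrow> ex_number n (cycle_graph (2 * k + 1)) = n\<^sup>2 div 4) \<and>
    (\<forall>G :: 'a ugraph. simple_graph G \<longrightarrow> (extremal_graph n (cycle_graph (2 * k + 1)) G \<longleftrightarrow>
       (n \<le> 2 * k \<and> graph_iso G (complete_graph n)) \<or>
       (2 * k + 1 \<le> n \<and> n \<le> 4 * k - 1 \<and> graph_iso G (two_blocks (2 * k) (n - 2 * k + 1))) \<or>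
       (n \<in> {3 * k - 1, 3 * k} \<and> graph_iso G (H1 n k)) \<or>
       (4 * k - 2 \<le> n \<and> graph_iso G (complete_bipartite ((n + 1) div 2) (n div 2)))))"
proof (intro conjI allI impI)
  let ?C = "cycle_graph (2 * k + 1)"
  note ex = ex_number_odd_cycle[OF assms]
  show "ex_number n ?C = n choose 2" if "n \<le> 2 * k" using ex that by (simp add: ex_value_def)
  show "ex_number n ?C = g_cactus n k" if "2 * k + 1 \<le> n \<and> n \<le> 4 * k - 1"
    using ex that g_cactus_value[OF assms(1)] by simp
  show "ex_number n ?C = n\<^sup>2 div 4" if "4 * k - 2 \<le> n" using ex that ex_value_large[of k n] assms(1) by simp
  fix G :: "'a ugraph" assume G: "simple_graph G"
  let ?K = "complete_graph n" and ?B = "two_blocks (2 * k) (n - 2 * k + 1)" and ?H = "H1 n k"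
    and ?T = "complete_bipartite ((n + 1) div 2) (n div 2)"
  have finG: "finite (verts G)" using G by (simp add: simple_graph_def)
  have K: "verts ?K = {..<n}" "edges ?K = all_pairs {..<n}" by (simp_all add: complete_graph_def)
  have B: "two_cliques k (verts ?B) (edges ?B)" "card (verts ?B) = n" "simple_graph ?B" if "2 * k + 1 \<le> n"
    using two_blocks_two_cliques[of k n] that assms(1) by (auto intro!: simple_two_blocks)
  have H: "clique_join k (verts ?H) (edges ?H)" "card (verts ?H) = n" "simple_graph ?H" if "n \<in> {3 * k - 1, 3 * k}"
    using H1_clique_join[of k n] simple_H1[of k n] that assms(1) by auto
  have T: "balanced_bipartite (verts ?T) (edges ?T)" "card (verts ?T) = n" "simple_graph ?T"
    using bipartite_balanced_bipartite[of n] simple_complete_bipartite by auto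
  show "extremal_graph n ?C G \<longleftrightarrow>
       (n \<le> 2 * k \<and> graph_iso G ?K) \<or>
       (2 * k + 1 \<le> n \<and> n \<le> 4 * k - 1 \<and> graph_iso G ?B) \<or>
       (n \<in> {3 * k - 1, 3 * k} \<and> graph_iso G ?H) \<or> (4 * k - 2 \<le> n \<and> graph_iso G ?T)" (is "_ \<longleftrightarrow> ?R")
  proof
    assume e: "extremal_graph n ?C G"
    then have c: "card (verts G) = n" "card (edges G) = ex_value k (card (verts G))" "free_of ?C G"
      using ex by (auto simp: extremal_graph_def)
    have "verts G \<noteq> {}" using c(1) assms(2) by auto
    then have "extremal_shape k (verts G) (edges G)"
      using odd_cycle_bound(2)[OF simple_sgraph[OF G] assms(1) _ _ c(2)] c(3)
        free_of_odd_cycle_iff[OF G assms(1)] by blast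
    then consider "n \<le> 2 * k" "edges G = all_pairs (verts G)"
      | "2 * k + 1 \<le> n" "n \<le> 4 * k - 1" "two_cliques k (verts G) (edges G)"
      | "n \<in> {3 * k - 1, 3 * k}" "clique_join k (verts G) (edges G)" | "4 * k - 2 \<le> n" "balanced_bipartite (verts G) (edges G)"
      using c(1) by (auto simp: extremal_shape_def Let_def)
    then show ?R
    proof cases
      case 1
      then have "graph_iso G ?K" using complete_iso[of "verts G" "{..<n}"] finG c(1) K
        by (metis card_lessThan finite_lessThan prod.collapse)
      then show ?thesis using 1 by simp
    next
      case 2
      have "finite (verts ?B)" using B(3)[OF 2(1)] by (simp add: simple_graph_def)
      then have "graph_iso G ?B" using two_cliques_iso[of "verts G" "verts ?B" k "edges G" "edges ?B"] finG c(1) 2 B by simp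
      then show ?thesis using 2 by simp
    next
      case 3
      have "finite (verts ?H)" using H(3)[OF 3(1)] by (simp add: simple_graph_def)
      then have "graph_iso G ?H" using clique_join_iso[of "verts G" "verts ?H" k "edges G" "edges ?H"] finG c(1) 3 H by simp
      then show ?thesis using 3 by simp
    next
      case 4
      have "finite (verts ?T)" using T(3) by (simp add: simple_graph_def)
      then have "graph_iso G ?T" using balanced_bipartite_iso[of "verts G" "verts ?T" "edges G" "edges ?T"] finG c(1) 4 T by simp
      then show ?thesis using 4 by simp
    qed
  next
    assume ?R
    then consider "n \<le> 2 * k" "graph_iso G ?K"
      | "2 * k + 1 \<le> n" "n \<le> 4 * k - 1" "graph_iso G ?B"
      | "n \<in> {3 * k - 1, 3 * k}" "graph_iso G ?H" | "4 * k - 2 \<le> n" "graph_iso G ?T" by auto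
    then show "extremal_graph n ?C G"
    proof cases
      case 1
      then show ?thesis using K by (intro iso_extremal[OF G simple_complete 1(2) _ _ assms]) (auto simp: extremal_shape_def)
    next
      case 2
      then show ?thesis using B[OF 2(1)] by (intro iso_extremal[OF G _ 2(3) _ _ assms]) (auto simp: extremal_shape_def)
    next
      case 3
      then show ?thesis using H[OF 3(1)] by (intro iso_extremal[OF G _ 3(2) _ _ assms]) (auto simp: extremal_shape_def)
    next
      case 4
      then show ?thesis using T by (intro iso_extremal[OF G _ 4(2) _ _ assms]) (auto simp: extremal_shape_def)
    qed
  qed
qed

end
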